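(* Let $\ell,\ell'$ be geodesic lines of $\mathbb{H}^2$ and $g,g'\in G_0$. The following are equivalent: (1) the left $\mathrm{AdS}$ crooked planes $g\mathsf{C}(\ell)$ and $g'\mathsf{C}(\ell')$ are disjoint; (2) there exists $K>0$ such that $d(g\cdot x,g'\cdot x')-d(x,x')\geq K$ for all $x\in\ell$, $x'\in\ell'$; (3) for any endpoint $\xi$ of $\ell$ and any endpoint $\xi'$ of $\ell'$, we have $g\cdot\xi\neq g'\cdot\xi'$ and $F_{g,g'}(\xi,\xi')>0$. If these conditions hold, then $g\cdot\ell$ and $g'\cdot\ell'$ have disjoint closures in $\overline{\mathbb{H}^2}$. Moreover, given transverse orientations of $g\cdot\ell$ and $g'\cdot\ell'$ (and the transverse orientations of $\ell,\ell'$ induced via $g^{-1},g'^{-1}$), the closed left crooked half-spaces $g\,\overline{\mathsf{H}_+(\ell)}$ and $g'\,\overline{\mathsf{H}_+(\ell')}$ are disjoint if and only if (1), (2), (3) hold and $g\cdot\ell$ and $g'\cdot\ell'$ are transversely oriented away from each other.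
   Context: $\mathbb{H}^2$ is the hyperbolic plane with metric $d$, $\overline{\mathbb{H}^2}=\mathbb{H}^2\cup\partial_\infty\mathbb{H}^2$, $G_0=\mathrm{PSL}_2(\mathbb{R})$, and $\mathrm{AdS}^3$ is identified with $G_0$ (with bi-invariant Lorentzian metric from half the Killing form). For a geodesic line $\ell$ with closure $\overline\ell$, $\mathsf{C}(\ell)$ is the set of $h\in G_0$ having a nonrepelling fixed point in $\overline\ell$ (identity: every point; elliptic: its fixed point in $\mathbb{H}^2$; parabolic: its fixed point at infinity; hyperbolic: its attracting fixed point). If $\ell$ is transversely oriented, $\mathsf{H}_+(\ell)$ is the set of nontrivial $h\in G_0$ having a nonrepelling fixed point in $\overline{\mathbb{H}^2}\smallsetminus\overline\ell$ on the positive side of $\overline\ell$, and $\overline{\mathsf{H}_+(\ell)}=\mathsf{H}_+(\ell)\cup\mathsf{C}(\ell)$. For $g,g'\in G_0$, $F_{g,g'}(x,x')=d(g\cdot x,g'\cdot x')-d(x,x')$ for $x,x'\in\mathbb{H}^2$, and for ideal points $\xi,\xi'$ (not with both $\xi=\xi'$ and $g\cdot\xi=g'\cdot\xi'$) it is the continuous extension, given by $F_{g,g'}(\xi,\xi')=d(g\cdot B,g'\cdot B')-d(B,B')$ for any sufficiently small horoballs $B,B'$ centered at $\xi,\xi'$; here the distance between disjoint sets is the infimum of pointwise distances, and the distance between concentric horoballs is declared to be $-\infty$. *)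

theory Defs
  imports "HOL-Analysis.Analysis"
begin

text \<open>Model: Poincare disk. The hyperbolic plane is ball 0 1 (in the complex plane),
its compactification is cball 0 1, the ideal boundary is sphere 0 1.\<close>

definition hdist :: "complex \<Rightarrow> complex \<Rightarrow> real" where
  "hdist z w = arcosh (1 + 2 * (cmod (z - w))\<^sup>2 / ((1 - (cmod z)\<^sup>2) * (1 - (cmod w)\<^sup>2)))"

text \<open>G0 = PSL2(R) = PSU(1,1), acting on the closed disk by Moebius maps;
elements are represented as functions, normalised to 0 outside the closed disk.\<close>

definition mob :: "complex \<Rightarrow> complex \<Rightarrow> complex \<Rightarrow> complex" where
  "mob a b = (\<lambda>z. if cmod z \<le> 1 then (a * z + b) / (cnj b * z + cnj a) else 0)"

definition G0 :: "(complex \<Rightarrow> complex) set" where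
  "G0 = {h. \<exists>a b. (cmod a)\<^sup>2 - (cmod b)\<^sup>2 = 1 \<and> h = mob a b}"

definition G0_id :: "complex \<Rightarrow> complex" where
  "G0_id = mob 1 0"

definition gmul :: "(complex \<Rightarrow> complex) \<Rightarrow> (complex \<Rightarrow> complex) \<Rightarrow> (complex \<Rightarrow> complex)" where
  "gmul g h = (\<lambda>z. if cmod z \<le> 1 then g (h z) else 0)"

definition geodesic_line :: "complex set \<Rightarrow> bool" where
  "geodesic_line L \<longleftrightarrow> (\<exists>\<gamma> :: real \<Rightarrow> complex. (\<forall>t. cmod (\<gamma> t) < 1)
      \<and> (\<forall>s t. hdist (\<gamma> s) (\<gamma> t) = \<bar>s - t\<bar>) \<and> L = range \<gamma>)"

definition endpoints :: "complex set \<Rightarrow> complex set" where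
  "endpoints L = closure L \<inter> sphere 0 1"

definition fixset :: "(complex \<Rightarrow> complex) \<Rightarrow> complex set" where
  "fixset h = {z \<in> cball 0 1. h z = z}"

text \<open>Nonrepelling fixed points: identity: every point; elliptic: its fixed point in the
open disk; parabolic: its unique fixed point (at infinity); hyperbolic (two ideal fixed
points): the attracting one.\<close>
definition nonrepelling_fixed :: "(complex \<Rightarrow> complex) \<Rightarrow> complex \<Rightarrow> bool" where
  "nonrepelling_fixed h p \<longleftrightarrow> p \<in> fixset h \<and>
     (h = G0_id \<or> cmod p < 1 \<or> fixset h = {p}
      \<or> (card (fixset h) = 2 \<and> (\<forall>z \<in> ball 0 1. (\<lambda>n. (h ^^ n) z) \<longlonglongrightarrow> p)))"

definition Cset :: "complex set \<Rightarrow> (complex \<Rightarrow> complex) set" where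
  "Cset L = {h \<in> G0. \<exists>p \<in> closure L. nonrepelling_fixed h p}"

text \<open>A transverse orientation of L is a choice P of one of the two components of
cball 0 1 minus closure L (the positive side).\<close>
definition transverse_orientation :: "complex set \<Rightarrow> complex set \<Rightarrow> bool" where
  "transverse_orientation L P \<longleftrightarrow> P \<in> components (cball 0 1 - closure L)"

definition Hplus :: "complex set \<Rightarrow> complex set \<Rightarrow> (complex \<Rightarrow> complex) set" where
  "Hplus L P = {h \<in> G0. h \<noteq> G0_id \<and> (\<exists>p \<in> P. nonrepelling_fixed h p)}"

definition Hplus_closed :: "complex set \<Rightarrow> complex set \<Rightarrow> (complex \<Rightarrow> complex) set" where
  "Hplus_closed L P = Hplus L P \<union> Cset L"

definition horoball :: "complex \<Rightarrow> real \<Rightarrow> complex set" where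
  "horoball \<xi> r = {z. cmod (z - of_real (1 - r) * \<xi>) < r}"

definition is_horoball_at :: "complex \<Rightarrow> complex set \<Rightarrow> bool" where
  "is_horoball_at \<xi> A \<longleftrightarrow> cmod \<xi> = 1 \<and> (\<exists>r. 0 < r \<and> r < 1 \<and> A = horoball \<xi> r)"

definition hsetdist :: "complex set \<Rightarrow> complex set \<Rightarrow> ereal" where
  "hsetdist A B = (if \<exists>\<xi>. is_horoball_at \<xi> A \<and> is_horoball_at \<xi> B then - \<infinity>
      else ereal (Inf {hdist x y | x y. x \<in> A \<and> y \<in> B}))"

definition F_ideal :: "(complex \<Rightarrow> complex) \<Rightarrow> (complex \<Rightarrow> complex) \<Rightarrow> complex \<Rightarrow> complex \<Rightarrow> ereal" where
  "F_ideal g g' \<xi> \<xi>' = (THE v. \<exists>r0 > 0. \<forall>r r'. 0 < r \<and> r < r0 \<and> 0 < r' \<and> r' < r0 \<longrightarrow>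
      hsetdist (g ` horoball \<xi> r) (g' ` horoball \<xi>' r') - hsetdist (horoball \<xi> r) (horoball \<xi>' r') = v)"

definition oriented_away :: "complex set \<Rightarrow> complex set \<Rightarrow> complex set \<Rightarrow> complex set \<Rightarrow> bool" where
  "oriented_away L P L' P' \<longleftrightarrow> closure L' \<inter> P = {} \<and> closure L \<inter> P' = {}"

end

theory Submission
  imports Defs
begin

text \<open>
An element of \<open>G\<^sub>0\<close> acts on real spinors \<open>z \<in> \<complex> = \<real>\<^sup>2\<close> by the determinant-one real-linear map
\<open>T z = a z + b z\<^sup>*\<close>, where \<open>z\<close> represents the ideal point \<open>z / z\<^sup>*\<close>, and points of the closed disk are
nonnegative combinations of the symmetric tensors \<open>z \<otimes> z\<close>, i.e. causal vectors of Minkowski space.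
A fixed point is nonrepelling iff the corresponding eigenvalue is at least one, so a common element
of the two crooked planes forces a pair of points with \<open>\<langle>gx, g'x'\<rangle> \<le> \<langle>x, x'\<rangle>\<close>. Both pairings
are bilinear in tensors, and on tensors of spinors they are squares of determinants; hence everything
is decided at the four pairs of endpoints. There conditions (2) and (3) both say that
\<open>\<bar>det (g z) (g' w)\<bar> > \<bar>det z w\<bar>\<close>, and if this fails a common element is found either directly by
linear algebra on spinors or, by the intermediate value theorem, from a pair of interior points whose
distance is preserved. For half-spaces, being oriented away means that the four numbers
\<open>det (g z) (g' w)\<close> have the same sign; then the inequality extends bilinearly to all
nonnegative spinors, i.e. to the two half-planes.
\<close>

subsection \<open>Moebius maps and the Minkowski pairing\<close>

text \<open>The delicate pairs of endpoints are those with \<open>det (g z) (g' w) = 0\<close>. If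
  \<open>det z w\<close> is nonzero there, two distinct endpoints have a common image, so no
  isometry can agree with \<open>g\<close> at one and with \<open>g'\<close> at the other, and a
  common element must be sought over interior points instead: distances shrink near this pair of
  endpoints and grow near another one, so somewhere in between a distance is preserved. If both
  determinants vanish, the uniform growth in (2) says only \<open>0 >= 0\<close>, and strictness
  comes from the Pluecker relation: the four determinants of two lines satisfy
  \<open>d11 * d22 - d12 * d21 = 1\<close>, before as well as after applying \<open>g\<close> and
  \<open>g'\<close>. So when both vanish at one pair, the products of the two determinants on the
  other diagonal agree before and after, which contradicts growth by a factor above 1. Orientations
  are absorbed into the parametrisation: a half-turn reverses the sides of a line and keeps the
  line. The constant in (2) is the logarithm of a factor \<open>m > 1\<close> common to the four
  pairs, because \<open>cosh (d + ln m) <= m * cosh d\<close>.\<close>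

definition minkowski :: "complex \<Rightarrow> complex \<Rightarrow> real" where
  "minkowski p q = (1 + (cmod p)\<^sup>2) * (1 + (cmod q)\<^sup>2) - 4 * Re (p * cnj q)"

text \<open>\<open>minkowski\<close> is the Minkowski product of the vectors \<open>(1 + \<bar>p\<bar>\<^sup>2, 2 p)\<close>, which are null for ideal \<open>p\<close>.
An element \<open>h\<close> of \<open>G\<^sub>0\<close> maps the vector of \<open>p\<close> to \<open>conf_factor h p\<close> times the vector of \<open>h p\<close>;
for \<open>h = mob a b\<close> this factor is \<open>\<bar>cnj b * p + cnj a\<bar>\<^sup>2\<close>, the inverse of \<open>\<bar>h' p\<bar>\<close>.\<close>

definition conf_factor :: "(complex \<Rightarrow> complex) \<Rightarrow> complex \<Rightarrow> real" where
  "conf_factor h p = (1 + (cmod p)\<^sup>2) * (1 - (cmod (h 0))\<^sup>2) / minkowski (h p) (h 0)"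

definition unimodular :: "complex \<Rightarrow> complex \<Rightarrow> bool" where
  "unimodular a b \<longleftrightarrow> (cmod a)\<^sup>2 - (cmod b)\<^sup>2 = 1"

definition mob_num :: "complex \<Rightarrow> complex \<Rightarrow> complex \<Rightarrow> complex" where
  "mob_num a b z = a * z + b"

definition mob_den :: "complex \<Rightarrow> complex \<Rightarrow> complex \<Rightarrow> complex" where
  "mob_den a b z = cnj b * z + cnj a"

lemma minkowski_alt: "minkowski p q = (1 - (cmod p)\<^sup>2) * (1 - (cmod q)\<^sup>2) + 2 * (cmod (p - q))\<^sup>2"
  unfolding minkowski_def cmod_power2 by (simp add: algebra_simps power2_eq_square)

lemma minkowski_self: "minkowski p p = (1 - (cmod p)\<^sup>2)\<^sup>2"
  unfolding minkowski_alt by (simp add: power2_eq_square)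

lemma minkowski_nonneg:
  assumes "cmod p \<le> 1" "cmod q \<le> 1"
  shows "minkowski p q \<ge> 0"
proof -
  have "(cmod p)\<^sup>2 \<le> 1" "(cmod q)\<^sup>2 \<le> 1"
    using assms by (simp_all add: abs_square_le_1)
  then show ?thesis unfolding minkowski_alt by simp
qed

lemma minkowski_sphere: "cmod p = 1 \<Longrightarrow> minkowski p q = 2 * (cmod (p - q))\<^sup>2"
  by (simp add: minkowski_alt)

text \<open>Homogeneous form of \<open>minkowski\<close>: once denominators are cleared, both
  summands consist of expressions that a unimodular matrix preserves, namely the Hermitian form
  \<open>|D|^2 - |N|^2\<close> and a determinant.\<close>

lemma minkowski_quotient:
  assumes "D \<noteq> 0" "D' \<noteq> 0"
  shows "minkowski (N / D) (N' / D') * (cmod D)\<^sup>2 * (cmod D')\<^sup>2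
    = ((cmod D)\<^sup>2 - (cmod N)\<^sup>2) * ((cmod D')\<^sup>2 - (cmod N')\<^sup>2) + 2 * (cmod (N * D' - N' * D))\<^sup>2"
proof -
  have "N / D - N' / D' = (N * D' - N' * D) / (D * D')" using assms by (simp add: field_simps)
  then have eq: "cmod (N / D - N' / D') = cmod (N * D' - N' * D) / (cmod D * cmod D')"
    by (simp add: norm_divide norm_mult)
  define d e n m k where "d = cmod D" "e = cmod D'" "n = cmod N" "m = cmod N'" "k = cmod (N * D' - N' * D)"
  have "d \<noteq> 0" "e \<noteq> 0" using assms by (simp_all add: d_e_n_m_k_def)
  then have "((1 - (n / d)\<^sup>2) * (1 - (m / e)\<^sup>2) + 2 * (k / (d * e))\<^sup>2) * d\<^sup>2 * e\<^sup>2
    = (d\<^sup>2 - n\<^sup>2) * (e\<^sup>2 - m\<^sup>2) + 2 * k\<^sup>2"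
    by (simp add: field_simps)
  then show ?thesis unfolding minkowski_alt eq by (simp add: norm_divide d_e_n_m_k_def)
qed

text \<open>A unimodular pair is a matrix of SU(1,1) acting on the column \<open>(z, 1)\<close>, and
  it preserves the Hermitian form of signature (1,1).\<close>

lemma mob_den_num_norm:
  assumes "unimodular a b"
  shows "(cmod (mob_den a b z))\<^sup>2 - (cmod (mob_num a b z))\<^sup>2 = 1 - (cmod z)\<^sup>2"
proof -
  have "(cmod (mob_den a b z))\<^sup>2 - (cmod (mob_num a b z))\<^sup>2 = ((cmod a)\<^sup>2 - (cmod b)\<^sup>2) * (1 - (cmod z)\<^sup>2)"
    unfolding mob_den_def mob_num_def cmod_power2 by (simp add: algebra_simps power2_eq_square)
  then show ?thesis using assms by (simp add: unimodular_def)
qed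

lemma unimodular_mult_cnj:
  assumes "unimodular a b" shows "a * cnj a - b * cnj b = 1"
proof -
  have "a * cnj a - b * cnj b = of_real ((cmod a)\<^sup>2 - (cmod b)\<^sup>2)"
    by (simp flip: complex_norm_square)
  then show ?thesis using assms unfolding unimodular_def by (metis of_real_1)
qed

text \<open>The left side is the determinant of the images of the columns \<open>(z, 1)\<close> and
  \<open>(w, 1)\<close>, and the matrix has determinant 1.\<close>

lemma mob_num_den_diff:
  assumes "unimodular a b"
  shows "mob_num a b z * mob_den a b w - mob_num a b w * mob_den a b z = z - w"
proof -
  have "mob_num a b z * mob_den a b w - mob_num a b w * mob_den a b z = (a * cnj a - b * cnj b) * (z - w)"
    unfolding mob_num_def mob_den_def by (simp add: algebra_simps)
  then show ?thesis using unimodular_mult_cnj[OF assms] by simp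
qed

lemma mob_den_nz:
  assumes "unimodular a b" "cmod z \<le> 1" shows "mob_den a b z \<noteq> 0"
proof
  assume "mob_den a b z = 0"
  then have "cnj a = - (cnj b * z)" by (simp add: mob_den_def add_eq_0_iff)
  then have "cmod a = cmod b * cmod z"
    by (metis complex_mod_cnj norm_minus_cancel norm_mult)
  also have "\<dots> \<le> cmod b" using assms(2) by (simp add: mult_left_le)
  finally have "(cmod a)\<^sup>2 \<le> (cmod b)\<^sup>2" by (rule power_mono) simp
  then show False using assms(1) unfolding unimodular_def by linarith
qed

lemma mob_eq: "cmod z \<le> 1 \<Longrightarrow> mob a b z = mob_num a b z / mob_den a b z"
  by (simp add: mob_def mob_num_def mob_den_def)

lemma mob_norm:
  assumes "unimodular a b" "cmod z \<le> 1"
  shows "(1 - (cmod (mob a b z))\<^sup>2) * (cmod (mob_den a b z))\<^sup>2 = 1 - (cmod z)\<^sup>2"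
proof -
  have "(1 - (cmod (mob a b z))\<^sup>2) * (cmod (mob_den a b z))\<^sup>2 = (cmod (mob_den a b z))\<^sup>2 - (cmod (mob_num a b z))\<^sup>2"
    using mob_den_nz[OF assms] by (simp add: mob_eq assms norm_divide power_divide left_diff_distrib)
  then show ?thesis using mob_den_num_norm[OF assms(1)] by simp
qed

lemma minkowski_mob:
  assumes "unimodular a b" "cmod p \<le> 1" "cmod q \<le> 1"
  shows "minkowski (mob a b p) (mob a b q) * (cmod (mob_den a b p))\<^sup>2 * (cmod (mob_den a b q))\<^sup>2 = minkowski p q"
  using minkowski_quotient[OF mob_den_nz[OF assms(1,2)] mob_den_nz[OF assms(1,3)], of "mob_num a b p" "mob_num a b q"]
  by (simp add: mob_eq assms mob_den_num_norm mob_num_den_diff minkowski_alt)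

lemma conf_factor_mob:
  assumes "unimodular a b" "cmod p \<le> 1"
  shows "conf_factor (mob a b) p = (cmod (mob_den a b p))\<^sup>2"
proof -
  have 1: "minkowski (mob a b p) (mob a b 0) * (cmod (mob_den a b p))\<^sup>2 * (cmod (mob_den a b 0))\<^sup>2 = 1 + (cmod p)\<^sup>2"
    using minkowski_mob[OF assms, of 0] by (simp add: minkowski_def)
  have 2: "(1 - (cmod (mob a b 0))\<^sup>2) * (cmod (mob_den a b 0))\<^sup>2 = 1"
    using mob_norm[OF assms(1), of 0] by simp
  have 3: "minkowski (mob a b p) (mob a b 0) \<noteq> 0"
  proof
    assume "minkowski (mob a b p) (mob a b 0) = 0"
    then have "1 + (cmod p)\<^sup>2 = 0" using 1 by simp
    moreover have "(cmod p)\<^sup>2 \<ge> 0" by simp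
    ultimately show False by linarith
  qed
  have "(1 + (cmod p)\<^sup>2) * (1 - (cmod (mob a b 0))\<^sup>2)
     = minkowski (mob a b p) (mob a b 0) * (cmod (mob_den a b p))\<^sup>2 *
         ((1 - (cmod (mob a b 0))\<^sup>2) * (cmod (mob_den a b 0))\<^sup>2)"
    by (subst 1[symmetric]) simp
  also have "\<dots> = minkowski (mob a b p) (mob a b 0) * (cmod (mob_den a b p))\<^sup>2" using 2 by simp
  finally show ?thesis unfolding conf_factor_def using 3 by simp
qed

lemma G0_mob: "h \<in> G0 \<longleftrightarrow> (\<exists>a b. unimodular a b \<and> h = mob a b)"
  by (auto simp: G0_def unimodular_def)

lemma conf_factor_pos: "h \<in> G0 \<Longrightarrow> cmod p \<le> 1 \<Longrightarrow> conf_factor h p > 0"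
  by (auto simp: G0_mob conf_factor_mob mob_den_nz)

lemma G0_norm: "h \<in> G0 \<Longrightarrow> cmod p \<le> 1 \<Longrightarrow> (1 - (cmod (h p))\<^sup>2) * conf_factor h p = 1 - (cmod p)\<^sup>2"
  by (auto simp: G0_mob conf_factor_mob mob_norm)

lemma G0_minkowski:
  "h \<in> G0 \<Longrightarrow> cmod p \<le> 1 \<Longrightarrow> cmod q \<le> 1 \<Longrightarrow> minkowski (h p) (h q) * conf_factor h p * conf_factor h q = minkowski p q"
  by (auto simp: G0_mob conf_factor_mob minkowski_mob)

lemma G0_norm_le:
  assumes "h \<in> G0" "cmod p \<le> 1" shows "cmod (h p) \<le> 1"
proof -
  have "(1 - (cmod (h p))\<^sup>2) * conf_factor h p \<ge> 0"
    using assms by (simp add: G0_norm abs_square_le_1)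
  then have "(cmod (h p))\<^sup>2 \<le> 1" using conf_factor_pos[OF assms] by (simp add: zero_le_mult_iff)
  then show ?thesis by (simp add: abs_square_le_1)
qed

lemma G0_norm_eq_1:
  assumes "h \<in> G0" "cmod p \<le> 1" shows "cmod (h p) = 1 \<longleftrightarrow> cmod p = 1"
proof -
  have "cmod (h p) = 1 \<longleftrightarrow> 1 - (cmod (h p))\<^sup>2 = 0" using abs_square_eq_1[of "cmod (h p)"] by auto
  also have "\<dots> \<longleftrightarrow> 1 - (cmod p)\<^sup>2 = 0" using G0_norm[OF assms] conf_factor_pos[OF assms] by auto
  also have "\<dots> \<longleftrightarrow> cmod p = 1" using abs_square_eq_1[of "cmod p"] by auto
  finally show ?thesis .
qed

lemma G0_norm_less: "h \<in> G0 \<Longrightarrow> cmod p < 1 \<Longrightarrow> cmod (h p) < 1"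
  using G0_norm_le[of h p] G0_norm_eq_1[of h p] by (simp add: less_le)

text \<open>The chordal distance scales by the derivatives at both points. This is what remains of
  the invariance of \<open>minkowski\<close> after the radial terms of \<open>minkowski_alt\<close>
  cancel.\<close>

lemma G0_dist:
  assumes "h \<in> G0" "cmod p \<le> 1" "cmod q \<le> 1"
  shows "(cmod (h p - h q))\<^sup>2 * conf_factor h p * conf_factor h q = (cmod (p - q))\<^sup>2"
proof -
  have "minkowski (h p) (h q) * conf_factor h p * conf_factor h q =
     ((1 - (cmod (h p))\<^sup>2) * conf_factor h p) * ((1 - (cmod (h q))\<^sup>2) * conf_factor h q)
      + 2 * ((cmod (h p - h q))\<^sup>2 * conf_factor h p * conf_factor h q)"
    unfolding minkowski_alt by (simp add: algebra_simps)
  also have "\<dots> = (1 - (cmod p)\<^sup>2) * (1 - (cmod q)\<^sup>2) + 2 * ((cmod (h p - h q))\<^sup>2 * conf_factor h p * conf_factor h q)"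
    using assms by (simp add: G0_norm)
  finally show ?thesis using G0_minkowski[OF assms] by (simp add: minkowski_alt[of p q])
qed

lemma G0_inj: "h \<in> G0 \<Longrightarrow> inj_on h (cball 0 1)"
  using G0_dist by (fastforce simp: inj_on_def)

section \<open>Composition, inverses and continuity\<close>

lemma mob_num_den_comp:
  assumes "mob_den c d z \<noteq> 0"
  shows "mob_num a b (mob_num c d z / mob_den c d z) = mob_num (a * c + b * cnj d) (a * d + b * cnj c) z / mob_den c d z"
    and "mob_den a b (mob_num c d z / mob_den c d z) = mob_den (a * c + b * cnj d) (a * d + b * cnj c) z / mob_den c d z"
  using assms unfolding mob_num_def mob_den_def by (simp_all add: field_simps)

lemma mob_comp:
  assumes "unimodular c d" "cmod z \<le> 1"
  shows "mob a b (mob c d z) = mob (a * c + b * cnj d) (a * d + b * cnj c) z"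
proof -
  have "mob c d \<in> G0" using assms by (auto simp: G0_mob)
  then have "cmod (mob c d z) \<le> 1" using G0_norm_le assms(2) by blast
  then have "mob a b (mob c d z) = mob_num a b (mob c d z) / mob_den a b (mob c d z)" by (rule mob_eq)
  also have "\<dots> = mob (a * c + b * cnj d) (a * d + b * cnj c) z"
    using mob_num_den_comp[OF mob_den_nz[OF assms]] mob_den_nz[OF assms] by (simp add: mob_eq assms)
  finally show ?thesis .
qed

lemma gmul_mob: "unimodular c d \<Longrightarrow> gmul (mob a b) (mob c d) = mob (a * c + b * cnj d) (a * d + b * cnj c)"
  by (auto simp: gmul_def mob_comp fun_eq_iff) (simp add: mob_def)

lemma unimodular_comp:
  assumes "unimodular a b" "unimodular c d" shows "unimodular (a * c + b * cnj d) (a * d + b * cnj c)"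
proof -
  have "(cmod (a * c + b * cnj d))\<^sup>2 - (cmod (a * d + b * cnj c))\<^sup>2
     = ((cmod a)\<^sup>2 - (cmod b)\<^sup>2) * ((cmod c)\<^sup>2 - (cmod d)\<^sup>2)"
    unfolding cmod_power2 by (simp add: algebra_simps power2_eq_square)
  then show ?thesis using assms by (simp add: unimodular_def)
qed

lemma gmul_G0: "g \<in> G0 \<Longrightarrow> h \<in> G0 \<Longrightarrow> gmul g h \<in> G0"
  unfolding G0_mob using gmul_mob unimodular_comp by metis

lemma gmul_apply: "cmod z \<le> 1 \<Longrightarrow> gmul g h z = g (h z)"
  by (simp add: gmul_def)

text \<open>Chain rule for the inverse derivative; on matrices, the denominators multiply.\<close>

lemma conf_factor_gmul:
  assumes "g \<in> G0" "h \<in> G0" "cmod p \<le> 1"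
  shows "conf_factor (gmul g h) p = conf_factor g (h p) * conf_factor h p"
proof -
  obtain a b c d where ab: "unimodular a b" "g = mob a b" and cd: "unimodular c d" "h = mob c d"
    using assms by (auto simp: G0_mob)
  have "cmod (h p) \<le> 1" using assms G0_norm_le by blast
  then have "conf_factor g (h p) * conf_factor h p = (cmod (mob_den a b (h p) * mob_den c d p))\<^sup>2"
    using assms ab cd by (simp add: conf_factor_mob norm_mult power_mult_distrib)
  also have "mob_den a b (h p) * mob_den c d p = mob_den (a * c + b * cnj d) (a * d + b * cnj c) p"
    using mob_num_den_comp(2)[OF mob_den_nz[OF cd(1) assms(3)]] mob_den_nz[OF cd(1) assms(3)]
    by (simp add: cd mob_eq assms)
  finally show ?thesis using ab cd assms by (simp add: gmul_mob conf_factor_mob unimodular_comp)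
qed

lemma G0_id_apply: "cmod z \<le> 1 \<Longrightarrow> G0_id z = z"
  by (simp add: G0_id_def mob_def)

lemma G0_id_in: "G0_id \<in> G0"
  unfolding G0_mob G0_id_def unimodular_def by (intro exI[of _ 1] exI[of _ 0]) simp

lemma conf_factor_id: "cmod p \<le> 1 \<Longrightarrow> conf_factor G0_id p = 1"
  unfolding G0_id_def by (subst conf_factor_mob) (auto simp: unimodular_def mob_den_def)

lemma gmul_assoc:
  "h \<in> G0 \<Longrightarrow> gmul (gmul f g) h = gmul f (gmul g h)"
  using G0_norm_le by (auto simp: gmul_def fun_eq_iff)

lemma gmul_id: "h \<in> G0 \<Longrightarrow> gmul G0_id h = h"
  using G0_norm_le by (auto simp: gmul_def fun_eq_iff G0_id_apply G0_mob) (simp add: mob_def)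

lemma G0_inverse:
  assumes "g \<in> G0"
  obtains g1 where "g1 \<in> G0" "gmul g g1 = G0_id" "gmul g1 g = G0_id"
proof -
  obtain a b where ab: "unimodular a b" "g = mob a b" using assms by (auto simp: G0_mob)
  have unimodular: "unimodular (cnj a) (- b)" using ab by (simp add: unimodular_def)
  have "gmul g (mob (cnj a) (- b)) = mob 1 0" "gmul (mob (cnj a) (- b)) g = mob 1 0"
    using unimodular_mult_cnj[OF ab(1)] ab unimodular by (simp_all add: gmul_mob algebra_simps)
  then show thesis using unimodular that by (auto simp: G0_mob G0_id_def)
qed

lemma G0_inverse_apply:
  assumes "g \<in> G0"
  obtains g1 where "g1 \<in> G0" "\<And>z. cmod z \<le> 1 \<Longrightarrow> g (g1 z) = z" "\<And>z. cmod z \<le> 1 \<Longrightarrow> g1 (g z) = z"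
  using G0_inverse[OF assms] by (metis gmul_apply G0_id_apply)

lemma G0_continuous: "h \<in> G0 \<Longrightarrow> continuous_on (cball 0 1) h"
proof -
  assume "h \<in> G0"
  then obtain a b where ab: "unimodular a b" "h = mob a b" by (auto simp: G0_mob)
  have "continuous_on (cball 0 1) (\<lambda>z. mob_num a b z / mob_den a b z)"
    by (intro continuous_intros) (auto simp: mob_num_def mob_den_def intro!: continuous_intros dest!: mob_den_nz[OF ab(1)])
  then show ?thesis
    by (rule continuous_on_cong[THEN iffD1, rotated 2]) (auto simp: ab mob_eq)
qed

lemma conf_factor_continuous: "h \<in> G0 \<Longrightarrow> continuous_on (cball 0 1) (conf_factor h)"
proof -
  assume "h \<in> G0"
  then obtain a b where ab: "unimodular a b" "h = mob a b" by (auto simp: G0_mob)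
  have "continuous_on (cball 0 1) (\<lambda>z. (cmod (mob_den a b z))\<^sup>2)"
    unfolding mob_den_def by (intro continuous_intros)
  then show ?thesis
    by (rule continuous_on_cong[THEN iffD1, rotated 2]) (auto simp: ab conf_factor_mob)
qed

section \<open>Hyperbolic distance as a Minkowski product\<close>

lemma cosh_hdist:
  assumes "cmod p < 1" "cmod q < 1"
  shows "cosh (hdist p q) = minkowski p q / ((1 - (cmod p)\<^sup>2) * (1 - (cmod q)\<^sup>2))"
    and "hdist p q \<ge> 0"
proof -
  have "(cmod p)\<^sup>2 < 1" "(cmod q)\<^sup>2 < 1" using assms by (simp_all add: abs_square_less_1)
  then have pos: "(1 - (cmod p)\<^sup>2) * (1 - (cmod q)\<^sup>2) > 0" by simp
  then have ge: "1 + 2 * (cmod (p - q))\<^sup>2 / ((1 - (cmod p)\<^sup>2) * (1 - (cmod q)\<^sup>2)) \<ge> 1" by simp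
  show "hdist p q \<ge> 0" unfolding hdist_def using ge arcosh_nonneg_real by blast
  show "cosh (hdist p q) = minkowski p q / ((1 - (cmod p)\<^sup>2) * (1 - (cmod q)\<^sup>2))"
    unfolding hdist_def using cosh_arcosh_real[OF ge] pos by (simp add: minkowski_alt field_simps)
qed

lemma hdist_isometry:
  assumes "h \<in> G0" "cmod p < 1" "cmod q < 1"
  shows "hdist (h p) (h q) = hdist p q"
proof -
  note le = less_imp_le[OF assms(2)] less_imp_le[OF assms(3)]
  have pos: "conf_factor h p > 0" "conf_factor h q > 0" using conf_factor_pos assms(1) le by auto
  have "(cmod (p - q))\<^sup>2 / ((1 - (cmod p)\<^sup>2) * (1 - (cmod q)\<^sup>2))
    = (cmod (h p - h q))\<^sup>2 * conf_factor h p * conf_factor h q /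
      (((1 - (cmod (h p))\<^sup>2) * conf_factor h p) * ((1 - (cmod (h q))\<^sup>2) * conf_factor h q))"
    using G0_dist[OF assms(1) le] G0_norm[OF assms(1)] le by simp
  also have "\<dots> = (cmod (h p - h q))\<^sup>2 / ((1 - (cmod (h p))\<^sup>2) * (1 - (cmod (h q))\<^sup>2))"
    using pos by simp
  finally show ?thesis unfolding hdist_def by (metis times_divide_eq_right)
qed

subsection \<open>Nonrepelling fixed points\<close>

lemma conf_factor_fixed_interior:
  assumes "h \<in> G0" "cmod p < 1" "h p = p" shows "conf_factor h p = 1"
proof -
  have "(cmod p)\<^sup>2 < 1" using assms by (simp add: abs_square_less_1)
  then show ?thesis using G0_norm[of h p] assms by simp
qed

lemma conf_factor_fixed_mult:
  assumes "h \<in> G0" "cmod p \<le> 1" "cmod q \<le> 1" "h p = p" "h q = q" "p \<noteq> q"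
  shows "conf_factor h p * conf_factor h q = 1"
  using G0_dist[OF assms(1-3)] assms by simp

lemma mob_fixed_iff:
  assumes "unimodular a b" "cmod p \<le> 1"
  shows "mob a b p = p \<longleftrightarrow> mob_num a b p = p * mob_den a b p"
  using mob_den_nz[OF assms] by (simp add: mob_eq assms field_simps)

text \<open>At a fixed point \<open>p\<close> the column \<open>(p, 1)\<close> is an eigenvector
  with eigenvalue \<open>mob_den a b p\<close>; two eigenvalues multiply to the determinant
  1.\<close>

lemma mob_den_fixed_mult:
  assumes "unimodular a b" "cmod p \<le> 1" "cmod q \<le> 1" "mob a b p = p" "mob a b q = q" "p \<noteq> q"
  shows "mob_den a b p * mob_den a b q = 1"
proof -
  have "(p - q) * (mob_den a b p * mob_den a b q) = p - q"
    using mob_num_den_diff[OF assms(1), of p q] assms by (simp add: mob_fixed_iff algebra_simps)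
  then show ?thesis using assms by simp
qed

text \<open>The matrix commutes with the antilinear involution
  \<open>(u, v) -> (cnj v, cnj u)\<close>, which preserves the line spanned by \<open>(p, 1)\<close>
  when \<open>p\<close> is ideal. The eigenvalue is therefore real.\<close>

lemma mob_den_fixed_real:
  assumes "unimodular a b" "cmod p = 1" "mob a b p = p"
  shows "mob_den a b p \<in> \<real>"
proof -
  have pp: "p * cnj p = 1" using assms(2) by (simp flip: complex_norm_square)
  have "a * p + b = p * mob_den a b p" using assms by (simp add: mob_fixed_iff mob_num_def[symmetric])
  then have "cnj (a * p + b) * p = cnj (p * mob_den a b p) * p" by simp
  then have "(cnj a * (p * cnj p) + cnj b * p) = (p * cnj p) * cnj (mob_den a b p)"
    by (simp add: algebra_simps)
  then have "mob_den a b p = cnj (mob_den a b p)" using pp by (simp add: mob_den_def add.commute)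
  then show ?thesis by (metis Reals_cnj_iff)
qed

lemma mob_diagonal_fixed_imp_id:
  assumes "unimodular a 0" "cmod p \<le> 1" "p \<noteq> 0" "mob a 0 p = p"
  shows "mob a 0 = G0_id"
proof -
  have "a = cnj a" using assms by (simp add: mob_fixed_iff mob_num_def mob_den_def)
  moreover have "a \<noteq> 0" using assms(1) by (auto simp: unimodular_def)
  ultimately show ?thesis by (auto simp: G0_id_def mob_def fun_eq_iff)
qed

text \<open>For \<open>b = 0\<close> the map is a rotation, and fixing \<open>p\<close> makes it the
  identity. Otherwise \<open>mob_den\<close> is injective, and the relation
  \<open>mob_den a b p * mob_den a b r = 1\<close> leaves one choice for a further fixed point
  \<open>r\<close>. The factor 1 at \<open>p\<close> would mean a real eigenvalue of square 1, equal
  to its inverse, hence \<open>q = p\<close>; an interior \<open>q\<close> would have factor 1 and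
  pass it on to \<open>p\<close>.\<close>

lemma ideal_fixed_other:
  assumes unimodular: "unimodular a b" and p: "cmod p = 1" "mob a b p = p" and q: "cmod q \<le> 1" "mob a b q = q" "p \<noteq> q"
    and n: "mob a b \<noteq> G0_id"
  shows "conf_factor (mob a b) p \<noteq> 1" "cmod q = 1" "fixset (mob a b) = {p, q}"
proof -
  have maps_in_G0: "mob a b \<in> G0" using unimodular by (auto simp: G0_mob)
  have b0: "b \<noteq> 0"
  proof
    assume b: "b = 0"
    have "mob a 0 = G0_id"
    proof (rule mob_diagonal_fixed_imp_id)
      show "unimodular a 0" using unimodular b by simp
      show "cmod p \<le> 1" "p \<noteq> 0" using p(1) by auto
      show "mob a 0 p = p" using p(2) b by simp
    qed
    then show False using n b by simp
  qed
  have pl: "cmod p \<le> 1" using p by simp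
  have ne: "mob_den a b r = mob_den a b s \<longleftrightarrow> r = s" for r s using b0 by (simp add: mob_den_def)
  have m: "mob_den a b p * mob_den a b q = 1" using mob_den_fixed_mult[OF unimodular pl q(1) p(2) q(2,3)] .
  show c: "conf_factor (mob a b) p \<noteq> 1"
  proof
    assume "conf_factor (mob a b) p = 1"
    then have "(cmod (mob_den a b p))\<^sup>2 = 1" using conf_factor_mob[OF unimodular pl] by simp
    moreover obtain d where d: "mob_den a b p = of_real d" using mob_den_fixed_real[OF unimodular p] by (auto elim: Reals_cases)
    ultimately have "d\<^sup>2 = 1" by simp
    then have "mob_den a b p * mob_den a b p = 1" using d by (simp add: power2_eq_square flip: of_real_mult)
    then have "mob_den a b p * mob_den a b p = mob_den a b p * mob_den a b q" using m by simp
    then have "mob_den a b p = mob_den a b q" using mob_den_nz[OF unimodular pl] by simp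
    then show False using ne q by simp
  qed
  show "cmod q = 1"
  proof (rule ccontr)
    assume "cmod q \<noteq> 1"
    then have "conf_factor (mob a b) q = 1" using conf_factor_fixed_interior[OF maps_in_G0] q by simp
    then show False using c conf_factor_fixed_mult[OF maps_in_G0 pl q(1) p(2) q(2,3)] by simp
  qed
  show "fixset (mob a b) = {p, q}"
  proof (intro equalityI subsetI)
    fix r assume "r \<in> fixset (mob a b)"
    then have r: "cmod r \<le> 1" "mob a b r = r" by (simp_all add: fixset_def)
    show "r \<in> {p, q}"
    proof (cases "r = p")
      case False
      then have "mob_den a b p * mob_den a b r = mob_den a b p * mob_den a b q"
        using mob_den_fixed_mult[OF unimodular pl r(1) p(2) r(2)] m by simp
      then show ?thesis using mob_den_nz[OF unimodular pl] ne by simp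
    qed simp
  next
    fix r assume "r \<in> {p, q}"
    then show "r \<in> fixset (mob a b)" using pl p(2) q by (auto simp: fixset_def)
  qed
qed

text \<open>The ratio \<open>|x - p|^2 / |x - q|^2\<close> along an orbit is multiplied by the
  constant \<open>m < 1\<close> at each step, since the conformal factor at the moving point
  cancels. The denominator is at most 4 in the disk, so the numerator tends to 0.\<close>

lemma iterates_attracting:
  assumes h: "h \<in> G0" and p: "cmod p \<le> 1" "h p = p" and q: "cmod q = 1" "h q = q" "p \<noteq> q"
    and c: "conf_factor h p > 1" and z: "cmod z < 1"
  shows "(\<lambda>n. (h ^^ n) z) \<longlonglongrightarrow> p"
proof -
  define x where "x n = (h ^^ n) z" for n
  have xs: "x (Suc n) = h (x n)" for n by (simp add: x_def)
  have x1: "cmod (x n) < 1" for n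
  proof (induction n)
    case 0
    show ?case using z by (simp add: x_def)
  next
    case (Suc n)
    then show ?case unfolding xs by (rule G0_norm_less[OF h])
  qed
  define X where "X n = (cmod (x n - p))\<^sup>2" for n
  define Y where "Y n = (cmod (x n - q))\<^sup>2" for n
  define m where "m = conf_factor h q / conf_factor h p"
  have q': "cmod q \<le> 1" using q by simp
  have cq: "conf_factor h q > 0" "conf_factor h q < 1"
  proof -
    show "conf_factor h q > 0" using conf_factor_pos[OF h q'] .
    then have "1 * conf_factor h q < conf_factor h p * conf_factor h q" using c by (rule mult_strict_right_mono[rotated])
    then show "conf_factor h q < 1" using conf_factor_fixed_mult[OF h p(1) q' p(2) q(2,3)] by simp
  qed
  have m: "0 \<le> m" "m < 1" using cq c by (simp_all add: m_def)
  have Yp: "Y n > 0" for n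
  proof -
    have "x n \<noteq> q" using x1[of n] q by auto
    then show ?thesis by (simp add: Y_def)
  qed
  have step: "X (Suc n) / Y (Suc n) = m * (X n / Y n)" for n
  proof -
    have xl: "cmod (x n) \<le> 1" using x1[of n] by simp
    have 1: "X n = X (Suc n) * conf_factor h (x n) * conf_factor h p"
      using G0_dist[OF h xl p(1)] p unfolding X_def xs by simp
    have 2: "Y n = Y (Suc n) * conf_factor h (x n) * conf_factor h q"
      using G0_dist[OF h xl q'] q unfolding Y_def xs by simp
    have "conf_factor h (x n) > 0" using conf_factor_pos[OF h xl] .
    then show ?thesis unfolding m_def 1 2 using cq c Yp[of "Suc n"] by simp
  qed
  have ratio: "X n / Y n = m ^ n * (X 0 / Y 0)" for n
  proof (induction n)
    case (Suc n)
    show ?case unfolding step Suc by simp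
  qed simp
  have Y4: "Y n \<le> 4" for n
  proof -
    have "cmod (x n - q) \<le> 2" using norm_triangle_ineq4[of "x n" q] x1[of n] q by simp
    then have "Y n \<le> 2\<^sup>2" unfolding Y_def by (rule power_mono) simp
    then show ?thesis by simp
  qed
  have le: "X n \<le> 4 * (m ^ n * (X 0 / Y 0))" for n
  proof -
    have "X n = Y n * (X n / Y n)" using Yp[of n] by simp
    also have "\<dots> \<le> 4 * (X n / Y n)"
      using Y4[of n] Yp[of n] by (intro mult_right_mono) (auto simp: X_def)
    finally show ?thesis by (subst (asm) ratio)
  qed
  have "(\<lambda>n. 4 * (m ^ n * (X 0 / Y 0))) \<longlonglongrightarrow> 4 * (0 * (X 0 / Y 0))"
    by (intro tendsto_mult tendsto_const LIMSEQ_realpow_zero m)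
  then have lim: "(\<lambda>n. 4 * (m ^ n * (X 0 / Y 0))) \<longlonglongrightarrow> 0" by simp
  have "X \<longlonglongrightarrow> 0"
  proof (rule tendsto_sandwich[OF _ _ tendsto_const lim])
    show "\<forall>\<^sub>F n in sequentially. 0 \<le> X n" by (simp add: X_def)
    show "\<forall>\<^sub>F n in sequentially. X n \<le> 4 * (m ^ n * (X 0 / Y 0))" using le by (intro always_eventually allI)
  qed
  then have "(\<lambda>n. sqrt (X n)) \<longlonglongrightarrow> sqrt 0" by (rule tendsto_real_sqrt)
  then have "(\<lambda>n. cmod (x n - p)) \<longlonglongrightarrow> 0" by (simp add: X_def)
  then have "(\<lambda>n. x n - p) \<longlonglongrightarrow> 0" by (rule tendsto_norm_zero_cancel)
  then have "x \<longlonglongrightarrow> p" by (rule LIM_zero_cancel)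
  then show ?thesis by (simp add: x_def[abs_def])
qed

text \<open>A single fixed point is a double root of the fixed-point equation, so its eigenvalue
  \<open>d\<close> is half the trace, and determinant 1 gives \<open>d * d = 1\<close>. For
  \<open>b = 0\<close> the factor is \<open>|a|^2 = 1\<close>.\<close>

lemma unique_ideal_fixed_conf_factor:
  assumes unimodular: "unimodular a b" and p: "cmod p = 1" "fixset (mob a b) = {p}"
  shows "conf_factor (mob a b) p = 1"
proof -
  have pl: "cmod p \<le> 1" using p by simp
  have "p \<in> fixset (mob a b)" using p(2) by simp
  then have fp: "mob a b p = p" by (simp add: fixset_def)
  have p0: "p \<noteq> 0" using p(1) by auto
  define d where "d = mob_den a b p"
  show ?thesis
  proof (cases "b = 0")
    case True
    then show ?thesis using unimodular conf_factor_mob[OF unimodular pl] by (simp add: mob_den_def unimodular_def)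
  next
    case False
    have d1: "cnj b * p = d - cnj a" by (simp add: d_def mob_den_def)
    have d2: "a * p + b = p * d" using fp mob_fixed_iff[OF unimodular pl] by (simp add: d_def mob_num_def)
    \<comment> \<open>The fixed points solve \<open>cnj b * z^2 + (cnj a - a) * z - b = 0\<close>,
      whose roots have product \<open>- b / cnj b\<close>, so \<open>q\<close> is the second
      root.\<close>
    define q where "q = - b / (cnj b * p)"
    have q1: "cmod q = 1" using p(1) False by (simp add: q_def norm_divide norm_mult)
    have qb: "q * (cnj b * p) = - b" using False p0 by (simp add: q_def)
    have bp: "b = p * (d - a)" using d2 by (simp add: algebra_simps)
    have "p * (cnj b * q) = q * (cnj b * p)" by (simp only: mult_ac)
    also have "\<dots> = - (p * (d - a))" using qb bp by simp
    also have "\<dots> = p * (a - d)" by (simp add: algebra_simps)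
    finally have "p * (cnj b * q) = p * (a - d)" .
    then have dq: "mob_den a b q = cnj a + a - d" unfolding mob_den_def using p0 by simp
    have "mob_num a b q = q * (a - cnj b * p)" using qb by (simp add: mob_num_def algebra_simps)
    also have "\<dots> = q * mob_den a b q" unfolding d1 dq by (simp add: algebra_simps)
    finally have "mob a b q = q" using mob_fixed_iff[OF unimodular] q1 by simp
    then have "q \<in> fixset (mob a b)" using q1 by (simp add: fixset_def)
    then have "q = p" using p(2) by simp
    then have d3: "a + cnj a = 2 * d" using dq by (simp add: d_def)
    have "b * cnj b = cnj b * (p * (d - a))" by (subst (1) bp) (rule mult.commute)
    also have "\<dots> = (d - cnj a) * (d - a)" by (simp only: mult.assoc[symmetric] d1)
    finally have "b * cnj b = (d - cnj a) * (d - a)" .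
    then have "a * cnj a - b * cnj b = d * (a + cnj a) - d * d" by (simp add: algebra_simps)
    then have "d * d = 1" using unimodular_mult_cnj[OF unimodular] by (simp add: d3)
    then have "cmod (d * d) = 1" by simp
    then show ?thesis using conf_factor_mob[OF unimodular pl] by (simp add: d_def power2_eq_square norm_mult)
  qed
qed

text \<open>This trades the case distinction and the limit in the definition for one inequality. Two
  ideal fixed points have reciprocal factors, so if the factor at \<open>p\<close> were below 1, the
  orbit of 0 would converge to the other one.\<close>

lemma nonrepelling_fixed_iff:
  assumes h: "h \<in> G0" and p: "cmod p \<le> 1"
  shows "nonrepelling_fixed h p \<longleftrightarrow> h p = p \<and> conf_factor h p \<ge> 1"
proof -
  obtain a b where ab: "unimodular a b" "h = mob a b" using h by (auto simp: G0_mob)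
  show ?thesis
  proof
    assume L: "nonrepelling_fixed h p"
    then have fp: "h p = p" by (simp add: nonrepelling_fixed_def fixset_def)
    consider "h = G0_id" | "cmod p < 1" | "cmod p = 1" "fixset h = {p}"
      | "cmod p = 1" "card (fixset h) = 2" "\<forall>z \<in> ball 0 1. (\<lambda>n. (h ^^ n) z) \<longlonglongrightarrow> p"
      using L p unfolding nonrepelling_fixed_def less_eq_real_def by blast
    then have "conf_factor h p \<ge> 1"
    proof cases
      case 1
      then show ?thesis using conf_factor_id[OF p] by simp
    next
      case 2
      then show ?thesis using conf_factor_fixed_interior[OF h _ fp] by simp
    next
      case 3
      then show ?thesis using unique_ideal_fixed_conf_factor[OF ab(1)] ab(2) by simp
    next
      case 4
      obtain u v where uv: "fixset h = {u, v}" "u \<noteq> v" using 4(2) by (auto simp: card_2_iff)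
      define q where "q = (if u = p then v else u)"
      have q: "q \<in> fixset h" "q \<noteq> p" using uv by (auto simp: q_def)
      then have q': "cmod q \<le> 1" "h q = q" by (simp_all add: fixset_def)
      show ?thesis
      proof (rule ccontr)
        assume "\<not> conf_factor h p \<ge> 1"
        then have "conf_factor h q * conf_factor h p < conf_factor h q * 1"
          using conf_factor_pos[OF h q'(1)] by (intro mult_strict_left_mono) auto
        then have "conf_factor h q > 1" using conf_factor_fixed_mult[OF h q'(1) p q'(2) fp q(2)] by simp
        then have "(\<lambda>n. (h ^^ n) 0) \<longlonglongrightarrow> q"
          using iterates_attracting[OF h q' 4(1) fp q(2), of 0] by simp
        moreover have "(\<lambda>n. (h ^^ n) 0) \<longlonglongrightarrow> p" using 4(3) by simp
        ultimately show False using q(2) LIMSEQ_unique by blast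
      qed
    qed
    then show "h p = p \<and> conf_factor h p \<ge> 1" using fp by simp
  next
    assume R: "h p = p \<and> conf_factor h p \<ge> 1"
    then have pairing: "p \<in> fixset h" using p by (simp add: fixset_def)
    show "nonrepelling_fixed h p"
    proof (cases "h = G0_id \<or> cmod p < 1 \<or> fixset h = {p}")
      case True
      then show ?thesis using pairing by (auto simp: nonrepelling_fixed_def)
    next
      case False
      then have p1: "cmod p = 1" using p by simp
      have fp: "mob a b p = p" using R ab by simp
      obtain q where "q \<in> fixset h" "p \<noteq> q" using False pairing by blast
      then have q: "cmod q \<le> 1" "mob a b q = q" "p \<noteq> q" using ab by (simp_all add: fixset_def)
      have n: "mob a b \<noteq> G0_id" using False ab by simp
      note o = ideal_fixed_other[OF ab(1) p1 fp q n]
      have c: "conf_factor h p > 1" using o(1) R ab by simp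
      have hq: "h q = q" using q ab by simp
      have f: "fixset h = {p, q}" using o(3) ab by simp
      have "(\<lambda>n. (h ^^ n) z) \<longlonglongrightarrow> p" if "z \<in> ball 0 1" for z
        using iterates_attracting[OF h p _ o(2) hq q(3) c, of z] R that by simp
      moreover have "card (fixset h) = 2" using f q(3) by simp
      ultimately show ?thesis unfolding nonrepelling_fixed_def using pairing by blast
    qed
  qed
qed

subsection \<open>Crooked sets and spinors\<close>

text \<open>Generalises \<open>Cset\<close> from closures of lines to arbitrary sets of points, so
  that closed half-spaces can be treated like crooked planes.\<close>

definition crooked :: "complex set \<Rightarrow> (complex \<Rightarrow> complex) set" where
  "crooked X = {c \<in> G0. \<exists>p \<in> X. nonrepelling_fixed c p}"

text \<open>Write \<open>h = gmul g c\<close> with \<open>c\<close> fixing \<open>p\<close>. By the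
  chain rule \<open>c\<close> is nonrepelling at \<open>p\<close> exactly when \<open>h\<close>
  agrees with \<open>g\<close> at \<open>p\<close> and contracts there at least as strongly.\<close>

lemma gmul_crooked:
  assumes g: "g \<in> G0" and X: "X \<subseteq> cball 0 1"
  shows "gmul g ` crooked X = {h \<in> G0. \<exists>p \<in> X. h p = g p \<and> conf_factor h p \<ge> conf_factor g p}"
proof (intro equalityI subsetI)
  fix h assume "h \<in> gmul g ` crooked X"
  then obtain c p where c: "c \<in> G0" "p \<in> X" "nonrepelling_fixed c p" "h = gmul g c" by (auto simp: crooked_def)
  have p: "cmod p \<le> 1" using c X by auto
  have cp: "c p = p" "conf_factor c p \<ge> 1" using c(3) nonrepelling_fixed_iff[OF c(1) p] by simp_all
  have "conf_factor h p = conf_factor g p * conf_factor c p" using conf_factor_gmul[OF g c(1) p] c(4) cp by simp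
  then have "conf_factor h p \<ge> conf_factor g p" using cp conf_factor_pos[OF g p] by simp
  moreover have "h p = g p" using c(4) cp p by (simp add: gmul_apply)
  ultimately show "h \<in> {h \<in> G0. \<exists>p \<in> X. h p = g p \<and> conf_factor h p \<ge> conf_factor g p}"
    using c gmul_G0[OF g c(1)] by blast
next
  fix h assume "h \<in> {h \<in> G0. \<exists>p \<in> X. h p = g p \<and> conf_factor h p \<ge> conf_factor g p}"
  then obtain p where h: "h \<in> G0" "p \<in> X" "h p = g p" "conf_factor h p \<ge> conf_factor g p" by blast
  have p: "cmod p \<le> 1" using h X by auto
  obtain g1 where g1: "g1 \<in> G0" "gmul g g1 = G0_id" "gmul g1 g = G0_id" using G0_inverse[OF g] .
  define c where "c = gmul g1 h"
  have c: "c \<in> G0" unfolding c_def by (rule gmul_G0[OF g1(1) h(1)])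
  have "gmul g c = gmul (gmul g g1) h" unfolding c_def using gmul_assoc[OF h(1)] by simp
  then have gc: "gmul g c = h" using g1 gmul_id[OF h(1)] by simp
  have "c p = gmul g1 g p" unfolding c_def using h p by (simp add: gmul_apply)
  then have cp: "c p = p" using g1 G0_id_apply[OF p] by simp
  have "conf_factor g1 (g p) * conf_factor g p = 1" using conf_factor_gmul[OF g1(1) g p] g1 conf_factor_id p by simp
  moreover have "conf_factor c p = conf_factor g1 (g p) * conf_factor h p" unfolding c_def using conf_factor_gmul[OF g1(1) h(1) p] h by simp
  moreover have "conf_factor g1 (g p) > 0" using conf_factor_pos[OF g1(1) G0_norm_le[OF g p]] .
  ultimately have "conf_factor c p \<ge> 1" using h(4) by (metis mult_le_cancel_left_pos)
  then have "c \<in> crooked X" using c cp h(2) nonrepelling_fixed_iff[OF c p] by (auto simp: crooked_def)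
  then show "h \<in> gmul g ` crooked X" using gc by blast
qed

text \<open>The Minkowski product of the images of the vectors of \<open>x\<close> and
  \<open>y\<close> under the linear maps belonging to \<open>h\<close> and \<open>h'\<close>. The
  conformal factors undo the normalisation of the image vectors and so keep the expression
  bilinear.\<close>

definition pairing :: "(complex \<Rightarrow> complex) \<Rightarrow> (complex \<Rightarrow> complex) \<Rightarrow> complex \<Rightarrow> complex \<Rightarrow> real" where
  "pairing h h' x y = conf_factor h x * conf_factor h' y * minkowski (h x) (h' y)"

lemma crooked_disjoint:
  assumes g: "g \<in> G0" "g' \<in> G0" and X: "X \<subseteq> cball 0 1" "X' \<subseteq> cball 0 1"
    and lt: "\<And>p p'. p \<in> X \<Longrightarrow> p' \<in> X' \<Longrightarrow> pairing g g' p p' > minkowski p p'"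
  shows "gmul g ` crooked X \<inter> gmul g' ` crooked X' = {}"
proof (rule ccontr)
  assume "\<not> ?thesis"
  then obtain h p p' where h: "h \<in> G0" "p \<in> X" "h p = g p" "conf_factor h p \<ge> conf_factor g p"
      "p' \<in> X'" "h p' = g' p'" "conf_factor h p' \<ge> conf_factor g' p'"
    unfolding gmul_crooked[OF g(1) X(1)] gmul_crooked[OF g(2) X(2)] by blast
  have p: "cmod p \<le> 1" "cmod p' \<le> 1" using h X by auto
  have "pairing g g' p p' \<le> conf_factor h p * conf_factor h p' * minkowski (h p) (h p')"
    unfolding pairing_def h(3)[symmetric] h(6)[symmetric]
    using conf_factor_pos[OF g(1) p(1)] conf_factor_pos[OF g(2) p(2)] h
    by (intro mult_right_mono mult_mono minkowski_nonneg G0_norm_le[OF h(1)] p) auto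
  also have "\<dots> = minkowski p p'" using G0_minkowski[OF h(1) p] by (simp add: mult_ac)
  finally show False using lt[OF h(2) h(5)] by simp
qed

lemma crooked_meet:
  assumes g: "g \<in> G0" "g' \<in> G0" and X: "X \<subseteq> cball 0 1" "X' \<subseteq> cball 0 1"
    and h: "h \<in> G0" "p \<in> X" "h p = g p" "conf_factor h p \<ge> conf_factor g p" "p' \<in> X'" "h p' = g' p'" "conf_factor h p' \<ge> conf_factor g' p'"
  shows "gmul g ` crooked X \<inter> gmul g' ` crooked X' \<noteq> {}"
  unfolding gmul_crooked[OF g(1) X(1)] gmul_crooked[OF g(2) X(2)] using h by blast

lemma pairing_gmul:
  assumes "g \<in> G0" "g' \<in> G0" "k \<in> G0" "k' \<in> G0" "cmod x \<le> 1" "cmod y \<le> 1"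
  shows "pairing (gmul g k) (gmul g' k') x y = conf_factor k x * conf_factor k' y * pairing g g' (k x) (k' y)"
  using assms by (simp add: pairing_def conf_factor_gmul gmul_apply)

lemma pairing_continuous:
  assumes "g \<in> G0" "g' \<in> G0"
  shows "continuous_on (cball 0 1 \<times> cball 0 1) (\<lambda>(x, y). pairing g g' x y)"
proof -
  note c = continuous_on_compose2[OF G0_continuous[OF assms(1)] continuous_on_fst[OF continuous_on_id]]
    continuous_on_compose2[OF G0_continuous[OF assms(2)] continuous_on_snd[OF continuous_on_id]]
    continuous_on_compose2[OF conf_factor_continuous[OF assms(1)] continuous_on_fst[OF continuous_on_id]]
    continuous_on_compose2[OF conf_factor_continuous[OF assms(2)] continuous_on_snd[OF continuous_on_id]]
  show ?thesis
    unfolding pairing_def minkowski_def split_def by (intro continuous_intros c) auto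
qed

lemma cosh_hdist_pairing:
  assumes "g \<in> G0" "g' \<in> G0" "cmod p < 1" "cmod p' < 1"
  shows "cosh (hdist (g p) (g' p')) = pairing g g' p p' / ((1 - (cmod p)\<^sup>2) * (1 - (cmod p')\<^sup>2))"
proof -
  note le = less_imp_le[OF assms(3)] less_imp_le[OF assms(4)]
  have "conf_factor g p > 0" "conf_factor g' p' > 0" using conf_factor_pos assms(1,2) le by auto
  then show ?thesis
    unfolding cosh_hdist(1)[OF G0_norm_less[OF assms(1,3)] G0_norm_less[OF assms(2,4)]] pairing_def
      G0_norm[OF assms(1) le(1), symmetric] G0_norm[OF assms(2) le(2), symmetric]
    by simp
qed

lemma to_origin:
  assumes "cmod p < 1" "cmod q < 1"
  obtains u r where "u \<in> G0" "u p = 0" "u q = of_real r" "r \<ge> 0"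
proof -
  \<comment> \<open>\<open>s\<close> normalises the matrix with rows \<open>(1, -p)\<close> and
    \<open>(- cnj p, 1)\<close> to determinant 1.\<close>
  define s where "s = 1 / sqrt (1 - (cmod p)\<^sup>2)"
  have p2: "(cmod p)\<^sup>2 < 1" using assms(1) by (simp add: abs_square_less_1)
  have "s\<^sup>2 = 1 / (1 - (cmod p)\<^sup>2)" using p2 by (simp add: s_def power_divide)
  then have s2: "s\<^sup>2 * (1 - (cmod p)\<^sup>2) = 1" using p2 by simp
  have unimodular: "unimodular (of_real s) (- (of_real s * p))"
    using s2 by (simp add: unimodular_def norm_mult power_mult_distrib algebra_simps)
  define v where "v = mob (of_real s) (- (of_real s * p))"
  have v: "v \<in> G0" "v p = 0" using unimodular assms by (auto simp: v_def G0_mob mob_def)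
  \<comment> \<open>Half the angle, because \<open>mob w 0\<close> multiplies by
    \<open>w / cnj w\<close>, the square of the unit number \<open>w\<close>.\<close>
  define w where "w = cis (- Arg (v q) / 2)"
  have sw: "unimodular w 0" by (simp add: w_def unimodular_def)
  then have w: "mob w 0 \<in> G0" by (auto simp: G0_mob)
  have vq: "cmod (v q) \<le> 1" using G0_norm_less[OF v(1) assms(2)] by simp
  have "mob w 0 (v q) = (w / cnj w) * v q" using vq by (simp add: mob_def)
  also have "w / cnj w = cis (- Arg (v q))"
  proof -
    have "cnj w = cis (Arg (v q) / 2)" by (simp add: w_def cis_cnj)
    then show ?thesis by (simp add: w_def cis_divide)
  qed
  also have "cis (- Arg (v q)) * v q = cis (- Arg (v q)) * rcis (cmod (v q)) (Arg (v q))"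
    by (simp add: rcis_cmod_Arg)
  also have "\<dots> = of_real (cmod (v q))" by (simp add: rcis_def cis_mult mult.left_commute)
  finally have 1: "gmul (mob w 0) v q = of_real (cmod (v q))" using assms by (simp add: gmul_apply)
  have "gmul (mob w 0) v p = 0" using assms v by (simp add: gmul_apply mob_def)
  then show thesis using that[OF gmul_G0[OF w v(1)] _ 1] by simp
qed

text \<open>Both pairs can be moved to 0 and a point of the nonnegative real axis, and this point is
  determined by its distance from 0.\<close>

lemma transitive_pairs:
  assumes pq: "cmod p < 1" "cmod p' < 1" "cmod q < 1" "cmod q' < 1" and d: "hdist p p' = hdist q q'"
  obtains h where "h \<in> G0" "h p = q" "h p' = q'"
proof -
  obtain u r where u: "u \<in> G0" "u p = 0" "u p' = of_real r" "r \<ge> 0" using to_origin[OF pq(1,2)] .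
  obtain v s where v: "v \<in> G0" "v q = 0" "v q' = of_real s" "s \<ge> 0" using to_origin[OF pq(3,4)] .
  have r1: "r < 1" using G0_norm_less[OF u(1) pq(2)] u by simp
  have s1: "s < 1" using G0_norm_less[OF v(1) pq(4)] v by simp
  have e: "hdist 0 (of_real r) = hdist 0 (of_real s)"
    using hdist_isometry[OF u(1) pq(1,2)] hdist_isometry[OF v(1) pq(3,4)] u v d by simp
  have "r\<^sup>2 < 1" "s\<^sup>2 < 1" using r1 s1 u v by (simp_all add: abs_square_less_1)
  moreover have "(1 + r\<^sup>2) / (1 - r\<^sup>2) = (1 + s\<^sup>2) / (1 - s\<^sup>2)"
    using cosh_hdist(1)[of 0 "of_real r"] cosh_hdist(1)[of 0 "of_real s"] e r1 s1 u(4) v(4)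
    by (simp add: minkowski_def)
  ultimately have "r\<^sup>2 = s\<^sup>2" by (simp add: field_simps)
  then have rs: "r = s" using u v by simp
  obtain v1 where v1: "v1 \<in> G0" "\<And>z. cmod z \<le> 1 \<Longrightarrow> v (v1 z) = z" "\<And>z. cmod z \<le> 1 \<Longrightarrow> v1 (v z) = z"
    using G0_inverse_apply[OF v(1)] by blast
  have "gmul v1 u p = q" "gmul v1 u p' = q'"
    using v1(3)[of q] v1(3)[of q'] u v rs pq by (simp_all add: gmul_apply)
  then show thesis using that[OF gmul_G0[OF v1(1) u(1)]] by blast
qed

section \<open>Spinors, their determinants and null vectors\<close>

definition spinor_map :: "complex \<Rightarrow> complex \<Rightarrow> complex \<Rightarrow> complex" where
  "spinor_map a b z = a * z + b * cnj z"

definition det2 :: "complex \<Rightarrow> complex \<Rightarrow> real" where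
  "det2 z w = Im (cnj z * w)"

definition ideal_pt :: "complex \<Rightarrow> complex" where
  "ideal_pt z = z / cnj z"

lemma det2_spinor_map:
  assumes "unimodular a b" shows "det2 (spinor_map a b z) (spinor_map a b w) = det2 z w"
proof -
  have "det2 (spinor_map a b z) (spinor_map a b w) = ((cmod a)\<^sup>2 - (cmod b)\<^sup>2) * det2 z w"
    unfolding det2_def spinor_map_def cmod_power2 by (simp add: algebra_simps power2_eq_square)
  then show ?thesis using assms by (simp add: unimodular_def)
qed

text \<open>\<open>T\<close> is the real-linear map sending \<open>v\<close> to \<open>v'\<close>
  and \<open>w\<close> to \<open>w'\<close>, given by Cramer's rule; \<open>a\<close> and
  \<open>b\<close> are its complex-linear and antilinear parts. Its determinant is
  \<open>|a|^2 - |b|^2\<close>, which is 1 because the two bases span equal areas.\<close>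

lemma spinor_map_exists:
  assumes d: "det2 v w = det2 v' w'" "det2 v w \<noteq> 0"
  obtains a b where "unimodular a b" "spinor_map a b v = v'" "spinor_map a b w = w'"
proof -
  define T where "T u = (of_real (det2 u w) * v' + of_real (det2 v u) * w') / of_real (det2 v w)" for u
  define a where "a = (T 1 - \<i> * T \<i>) / 2"
  define b where "b = (T 1 + \<i> * T \<i>) / 2"
  have ab: "spinor_map a b u = of_real (Re u) * T 1 + of_real (Im u) * T \<i>" for u
    unfolding spinor_map_def a_def b_def by (simp add: complex_eq_iff field_simps)
  have lin: "of_real (Re u) * T 1 + of_real (Im u) * T \<i> = T u" for u
  proof -
    have "det2 u w = Re u * det2 1 w + Im u * det2 \<i> w" "det2 v u = Re u * det2 v 1 + Im u * det2 v \<i>"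
      by (simp_all add: det2_def algebra_simps)
    then show ?thesis by (simp add: T_def add_divide_distrib algebra_simps)
  qed
  have s: "spinor_map a b u = T u" for u using ab[of u] lin[of u] by simp
  have z: "det2 u u = 0" for u by (simp add: det2_def)
  have sv: "spinor_map a b v = v'" "spinor_map a b w = w'" using d by (simp_all add: s T_def z)
  have "det2 (spinor_map a b v) (spinor_map a b w) = ((cmod a)\<^sup>2 - (cmod b)\<^sup>2) * det2 v w"
    unfolding det2_def spinor_map_def cmod_power2 by (simp add: algebra_simps power2_eq_square)
  then have "(cmod a)\<^sup>2 - (cmod b)\<^sup>2 = 1" using d sv by simp
  then show thesis using that sv by (simp add: unimodular_def)
qed

lemma spinor_map_nz:
  assumes "unimodular a b" "z \<noteq> 0" shows "spinor_map a b z \<noteq> 0"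
proof
  assume "spinor_map a b z = 0"
  then have "det2 z (\<i> * z) = 0" using det2_spinor_map[OF assms(1), of z "\<i> * z"] by (simp add: det2_def)
  moreover have "det2 z (\<i> * z) = (cmod z)\<^sup>2" unfolding det2_def cmod_power2 by (simp add: power2_eq_square)
  ultimately show False using assms by simp
qed

lemma ideal_pt_norm: "z \<noteq> 0 \<Longrightarrow> cmod (ideal_pt z) = 1"
  by (simp add: ideal_pt_def norm_divide)

lemma ideal_pt_eq_iff: "z \<noteq> 0 \<Longrightarrow> w \<noteq> 0 \<Longrightarrow> ideal_pt z = ideal_pt w \<longleftrightarrow> det2 z w = 0"
proof -
  assume "z \<noteq> 0" "w \<noteq> 0"
  then have "ideal_pt z = ideal_pt w \<longleftrightarrow> z * cnj w = w * cnj z" by (simp add: ideal_pt_def frac_eq_eq)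
  also have "\<dots> \<longleftrightarrow> det2 z w = 0" by (auto simp: complex_eq_iff det2_def algebra_simps)
  finally show ?thesis .
qed

lemma ideal_pt_surj:
  assumes "cmod x = 1" obtains z where "z \<noteq> 0" "ideal_pt z = x"
proof -
  have z0: "csqrt x \<noteq> 0" using assms by auto
  have "cmod (csqrt x) = 1" using assms by (simp add: norm_csqrt)
  then have "csqrt x * cnj (csqrt x) = 1" by (simp flip: complex_norm_square)
  then have "cnj (csqrt x) = 1 / csqrt x" using z0 by (simp add: field_simps)
  then have "ideal_pt (csqrt x) = (csqrt x)\<^sup>2" unfolding ideal_pt_def by (simp add: power2_eq_square)
  then show thesis using that[OF z0] by simp
qed

lemma mob_num_den_ideal_pt:
  assumes "z \<noteq> 0"
  shows "mob_num a b (ideal_pt z) = spinor_map a b z / cnj z" "mob_den a b (ideal_pt z) = cnj (spinor_map a b z) / cnj z"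
  using assms by (simp_all add: mob_num_def mob_den_def ideal_pt_def spinor_map_def field_simps)

lemma mob_ideal_pt:
  assumes "unimodular a b" "z \<noteq> 0"
  shows "mob a b (ideal_pt z) = ideal_pt (spinor_map a b z)" "conf_factor (mob a b) (ideal_pt z) = (cmod (spinor_map a b z) / cmod z)\<^sup>2"
proof -
  have 1: "cmod (ideal_pt z) \<le> 1" using ideal_pt_norm[OF assms(2)] by simp
  show "mob a b (ideal_pt z) = ideal_pt (spinor_map a b z)"
    using assms spinor_map_nz[OF assms] by (simp add: mob_eq[OF 1] mob_num_den_ideal_pt) (simp add: ideal_pt_def)
  show "conf_factor (mob a b) (ideal_pt z) = (cmod (spinor_map a b z) / cmod z)\<^sup>2"
    using assms by (simp add: conf_factor_mob[OF assms(1) 1] mob_num_den_ideal_pt norm_divide)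
qed

text \<open>\<open>mob_num\<close> and \<open>mob_den\<close> are homogeneous coordinates of the
  image. The conformal factors clear the denominators, and what remains is the product of the
  vectors \<open>(|N|^2 + |D|^2, 2 N cnj D)\<close>.\<close>

lemma pairing_mob:
  assumes "unimodular a b" "unimodular a' b'" "cmod x \<le> 1" "cmod y \<le> 1"
  shows "pairing (mob a b) (mob a' b') x y
    = ((cmod (mob_num a b x))\<^sup>2 + (cmod (mob_den a b x))\<^sup>2) * ((cmod (mob_num a' b' y))\<^sup>2 + (cmod (mob_den a' b' y))\<^sup>2)
     - Re ((2 * mob_num a b x * cnj (mob_den a b x)) * cnj (2 * mob_num a' b' y * cnj (mob_den a' b' y)))"
proof -
  define N D N' D' where [simp]: "N = mob_num a b x" "D = mob_den a b x" "N' = mob_num a' b' y" "D' = mob_den a' b' y"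
  have nz: "D \<noteq> 0" "D' \<noteq> 0" using mob_den_nz assms by simp_all
  have "(N / D) * cnj (N' / D') = (N * cnj D) * cnj (N' * cnj D') / of_real ((cmod D)\<^sup>2 * (cmod D')\<^sup>2)"
    unfolding of_real_mult complex_norm_square using nz by (simp add: field_simps)
  then have r: "Re ((N / D) * cnj (N' / D')) = Re ((N * cnj D) * cnj (N' * cnj D')) / ((cmod D)\<^sup>2 * (cmod D')\<^sup>2)"
    by (metis Re_divide_of_real)
  have "pairing (mob a b) (mob a' b') x y = (cmod D)\<^sup>2 * (cmod D')\<^sup>2 * minkowski (N / D) (N' / D')"
    using assms by (simp add: pairing_def conf_factor_mob mob_eq)
  also have "\<dots> = ((cmod D)\<^sup>2 * (1 + (cmod (N / D))\<^sup>2)) * ((cmod D')\<^sup>2 * (1 + (cmod (N' / D'))\<^sup>2)) -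
      4 * ((cmod D)\<^sup>2 * (cmod D')\<^sup>2 * Re ((N / D) * cnj (N' / D')))"
    by (simp add: minkowski_def algebra_simps)
  also have "(cmod D)\<^sup>2 * (cmod D')\<^sup>2 * Re ((N / D) * cnj (N' / D')) = Re ((N * cnj D) * cnj (N' * cnj D'))"
    unfolding r using nz by simp
  also have "(cmod D)\<^sup>2 * (1 + (cmod (N / D))\<^sup>2) = (cmod N)\<^sup>2 + (cmod D)\<^sup>2"
    using nz by (simp add: norm_divide power_divide distrib_left)
  also have "(cmod D')\<^sup>2 * (1 + (cmod (N' / D'))\<^sup>2) = (cmod N')\<^sup>2 + (cmod D')\<^sup>2"
    using nz by (simp add: norm_divide power_divide distrib_left)
  also have "4 * Re ((N * cnj D) * cnj (N' * cnj D')) = Re ((2 * N * cnj D) * cnj (2 * N' * cnj D'))"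
    by (simp add: algebra_simps)
  finally show ?thesis by simp
qed

text \<open>Both left sides are real-linear in \<open>(1 + |x|^2, 2 x)\<close>, and the same linear
  maps send the null vector \<open>(|z|^2, z^2)\<close> of a spinor to the null vector of
  \<open>spinor_map a b z\<close>. A decomposition into null vectors is thus carried along with its
  weights.\<close>

lemma mob_num_den_tensor:
  assumes "1 + (cmod x)\<^sup>2 = c * (cmod z)\<^sup>2 + d * (cmod w)\<^sup>2"
    and "2 * x = of_real c * z\<^sup>2 + of_real d * w\<^sup>2"
  shows "(cmod (mob_num a b x))\<^sup>2 + (cmod (mob_den a b x))\<^sup>2 = c * (cmod (spinor_map a b z))\<^sup>2 + d * (cmod (spinor_map a b w))\<^sup>2"
    and "2 * mob_num a b x * cnj (mob_den a b x) = of_real c * (spinor_map a b z)\<^sup>2 + of_real d * (spinor_map a b w)\<^sup>2"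
proof -
  have 1: "(cmod (mob_num a b x))\<^sup>2 + (cmod (mob_den a b x))\<^sup>2
      = ((cmod a)\<^sup>2 + (cmod b)\<^sup>2) * (1 + (cmod x)\<^sup>2) + 2 * Re (a * cnj b * (2 * x))"
    unfolding mob_num_def mob_den_def cmod_power2 by (simp add: algebra_simps power2_eq_square)
  have 2: "(cmod (spinor_map a b z))\<^sup>2 = ((cmod a)\<^sup>2 + (cmod b)\<^sup>2) * (cmod z)\<^sup>2 + 2 * Re (a * cnj b * z\<^sup>2)" for z
    unfolding spinor_map_def cmod_power2 by (simp add: algebra_simps power2_eq_square)
  show "(cmod (mob_num a b x))\<^sup>2 + (cmod (mob_den a b x))\<^sup>2 = c * (cmod (spinor_map a b z))\<^sup>2 + d * (cmod (spinor_map a b w))\<^sup>2"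
  proof -
    have "Re (a * cnj b * (of_real c * z\<^sup>2 + of_real d * w\<^sup>2)) = c * Re (a * cnj b * z\<^sup>2) + d * Re (a * cnj b * w\<^sup>2)"
      by (simp add: algebra_simps)
    then show ?thesis unfolding 1 2 assms by (simp add: algebra_simps)
  qed
  have n: "of_real ((cmod z)\<^sup>2) = z * cnj z" for z by (rule complex_norm_square)
  have 3: "2 * mob_num a b x * cnj (mob_den a b x) = 2 * a * b * of_real (1 + (cmod x)\<^sup>2) + a\<^sup>2 * (2 * x) + b\<^sup>2 * cnj (2 * x)"
    unfolding mob_num_def mob_den_def of_real_add n by (simp add: algebra_simps power2_eq_square)
  have 4: "(spinor_map a b z)\<^sup>2 = 2 * a * b * of_real ((cmod z)\<^sup>2) + a\<^sup>2 * z\<^sup>2 + b\<^sup>2 * cnj (z\<^sup>2)" for z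
    unfolding spinor_map_def n by (simp add: algebra_simps power2_eq_square)
  show "2 * mob_num a b x * cnj (mob_den a b x) = of_real c * (spinor_map a b z)\<^sup>2 + of_real d * (spinor_map a b w)\<^sup>2"
    unfolding 3 4 assms by (simp add: algebra_simps)
qed

lemma det2_power2: "(cmod s)\<^sup>2 * (cmod t)\<^sup>2 - Re (s\<^sup>2 * cnj (t\<^sup>2)) = 2 * (det2 s t)\<^sup>2"
  unfolding det2_def cmod_power2 by (simp add: algebra_simps power2_eq_square)

lemma pairing_spinor_map:
  assumes "unimodular a b" "unimodular a' b'" "cmod x \<le> 1" "cmod y \<le> 1"
    and "1 + (cmod x)\<^sup>2 = c * (cmod z)\<^sup>2 + d * (cmod w)\<^sup>2" "2 * x = of_real c * z\<^sup>2 + of_real d * w\<^sup>2"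
    and "1 + (cmod y)\<^sup>2 = c' * (cmod z')\<^sup>2 + d' * (cmod w')\<^sup>2" "2 * y = of_real c' * z'\<^sup>2 + of_real d' * w'\<^sup>2"
  shows "pairing (mob a b) (mob a' b') x y =
      c * c' * (2 * (det2 (spinor_map a b z) (spinor_map a' b' z'))\<^sup>2) + c * d' * (2 * (det2 (spinor_map a b z) (spinor_map a' b' w'))\<^sup>2)
    + d * c' * (2 * (det2 (spinor_map a b w) (spinor_map a' b' z'))\<^sup>2) + d * d' * (2 * (det2 (spinor_map a b w) (spinor_map a' b' w'))\<^sup>2)"
  unfolding pairing_mob[OF assms(1-4)] mob_num_den_tensor[OF assms(5,6)] mob_num_den_tensor[OF assms(7,8)] det2_power2[symmetric]
  by (simp add: algebra_simps)

subsection \<open>Lines and their sides\<close>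

definition open_diam :: "complex set" where "open_diam = of_real ` {-1<..<1}"
definition closed_diam :: "complex set" where "closed_diam = of_real ` {-1..1}"
definition upper_side :: "complex set" where "upper_side = {z \<in> cball 0 1. Im z > 0}"
definition lower_side :: "complex set" where "lower_side = {z \<in> cball 0 1. Im z < 0}"
text \<open>Keeps the diameter and exchanges its sides, so that a positive side can always be
  parametrised by \<open>upper_side\<close>.\<close>

definition half_turn :: "complex \<Rightarrow> complex" where "half_turn = mob \<i> 0"

lemma closed_diam_alt: "closed_diam = {z \<in> cball 0 1. Im z = 0}"
proof (intro equalityI subsetI)
  fix z assume "z \<in> {z \<in> cball 0 1. Im z = 0}"
  then have "cmod z \<le> 1" "z = of_real (Re z)" by (auto simp: complex_eq_iff)
  moreover have "\<bar>Re z\<bar> \<le> cmod z" by (rule abs_Re_le_cmod)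
  ultimately show "z \<in> closed_diam" unfolding closed_diam_def by (intro image_eqI[of _ _ "Re z"]) auto
qed (auto simp: closed_diam_def)

lemma open_diam_alt: "open_diam = {z \<in> ball 0 1. Im z = 0}"
proof (intro equalityI subsetI)
  fix z assume "z \<in> {z \<in> ball 0 1. Im z = 0}"
  then have "cmod z < 1" "z = of_real (Re z)" by (auto simp: complex_eq_iff)
  moreover have "\<bar>Re z\<bar> \<le> cmod z" by (rule abs_Re_le_cmod)
  ultimately show "z \<in> open_diam" unfolding open_diam_def by (intro image_eqI[of _ _ "Re z"]) auto
qed (auto simp: open_diam_def)

lemma closed_diam_sub: "closed_diam \<subseteq> cball 0 1" by (auto simp: closed_diam_alt)
lemma open_diam_sub: "open_diam \<subseteq> ball 0 1" by (auto simp: open_diam_alt)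
lemma upper_side_sub: "upper_side \<subseteq> cball 0 1" by (auto simp: upper_side_def)

lemma closure_open_diam: "closure open_diam = closed_diam"
proof
  have "closed (cball (0 :: complex) 1 \<inter> {z. Im z = 0})"
    by (intro closed_Int closed_cball closed_Collect_eq continuous_intros)
  then have "closed closed_diam" by (simp add: closed_diam_alt Int_def mem_cball conj_commute)
  moreover have "open_diam \<subseteq> closed_diam" by (auto simp: open_diam_def closed_diam_def)
  ultimately show "closure open_diam \<subseteq> closed_diam" by (rule closure_minimal[rotated])
  have "continuous_on (closure {-1<..<1}) (of_real :: real \<Rightarrow> complex)" by (intro continuous_intros)
  from image_closure_subset[OF this closed_closure closure_subset[of open_diam, unfolded open_diam_def]]
  show "closed_diam \<subseteq> closure open_diam" by (simp add: closed_diam_def open_diam_def)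
qed

lemma closure_G0_image:
  assumes "k \<in> G0" "S \<subseteq> cball 0 1"
  shows "closure (k ` S) = k ` closure S"
proof
  have cS: "closure S \<subseteq> cball 0 1" using assms(2) by (simp add: closure_minimal)
  have c: "continuous_on (closure S) k" using G0_continuous[OF assms(1)] cS continuous_on_subset by blast
  have "compact (closure S)" using cS by (meson bounded_cball bounded_subset closed_closure compact_eq_bounded_closed)
  then have "compact (k ` closure S)" using c compact_continuous_image by blast
  then show "closure (k ` S) \<subseteq> k ` closure S"
    by (intro closure_minimal image_mono closure_subset compact_imp_closed)
  show "k ` closure S \<subseteq> closure (k ` S)" by (rule image_closure_subset[OF c closed_closure closure_subset])
qed

lemma closure_line: "k \<in> G0 \<Longrightarrow> closure (k ` open_diam) = k ` closed_diam"
  using closure_G0_image[of k open_diam] open_diam_sub closure_open_diam by force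

lemma endpoints_line:
  assumes "k \<in> G0" shows "endpoints (k ` open_diam) = {k 1, k (-1)}"
proof -
  have "k x \<in> sphere 0 1 \<longleftrightarrow> x = 1 \<or> x = -1" if "x \<in> closed_diam" for x
  proof -
    obtain r where r: "x = of_real r" "-1 \<le> r" "r \<le> 1" using \<open>x \<in> closed_diam\<close> by (auto simp: closed_diam_def)
    have "cmod (k x) = 1 \<longleftrightarrow> cmod x = 1" using G0_norm_eq_1[OF assms] r by simp
    also have "\<dots> \<longleftrightarrow> r = 1 \<or> r = -1" using r by auto
    also have "\<dots> \<longleftrightarrow> x = 1 \<or> x = -1" using r by (metis of_real_1 of_real_eq_iff of_real_minus)
    finally show ?thesis by simp
  qed
  moreover have "1 \<in> closed_diam" "-1 \<in> closed_diam" by (auto simp: closed_diam_alt)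
  ultimately show ?thesis unfolding endpoints_def closure_line[OF assms] by blast
qed

text \<open>\<open>2 * x / (1 - x^2)\<close> is the hyperbolic sine of the signed distance from 0 to
  the real point \<open>x\<close>. Clearing denominators leaves
  \<open>(x - y) * (1 + x * y) = 0\<close>.\<close>

lemma sinh_param_inj:
  fixes x y :: real
  assumes "\<bar>x\<bar> < 1" "\<bar>y\<bar> < 1" "2 * x / (1 - x\<^sup>2) = 2 * y / (1 - y\<^sup>2)"
  shows "x = y"
proof -
  have "x\<^sup>2 < 1" "y\<^sup>2 < 1" using assms by (simp_all add: abs_square_less_1)
  then have "x * (1 - y\<^sup>2) = y * (1 - x\<^sup>2)" using assms(3) by (simp add: field_simps)
  then have "(x - y) * (1 + x * y) = 0" by (simp add: algebra_simps power2_eq_square)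
  moreover have "\<bar>x * y\<bar> < 1" using abs_mult_less[OF assms(1,2)] by (simp add: abs_mult)
  ultimately show ?thesis by auto
qed

text \<open>Move the points at times 0 and 1 to 0 and to \<open>r >= 0\<close>. The distance to 0
  then determines the modulus of each point, and the distance to \<open>r\<close>, by the addition
  formula for \<open>cosh (t - 1)\<close>, its real part. Comparing the two shows that the imaginary
  part vanishes, and surjectivity of \<open>sinh\<close> fills the diameter.\<close>

lemma geodesic_line_param:
  assumes "geodesic_line l"
  obtains k where "k \<in> G0" "l = k ` open_diam"
proof -
  obtain \<gamma> where \<gamma>: "\<And>t. cmod (\<gamma> t) < 1" "\<And>s t. hdist (\<gamma> s) (\<gamma> t) = \<bar>s - t\<bar>" "l = range \<gamma>"
    using assms unfolding geodesic_line_def by blast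
  obtain u r where u: "u \<in> G0" "u (\<gamma> 0) = 0" "u (\<gamma> 1) = of_real r" "r \<ge> 0" using to_origin[OF \<gamma>(1) \<gamma>(1)] .
  define \<delta> where "\<delta> t = u (\<gamma> t)" for t
  have d1: "cmod (\<delta> t) < 1" for t unfolding \<delta>_def using G0_norm_less[OF u(1) \<gamma>(1)] .
  have d2: "hdist (\<delta> s) (\<delta> t) = \<bar>s - t\<bar>" for s t
    unfolding \<delta>_def using hdist_isometry[OF u(1) \<gamma>(1) \<gamma>(1)] \<gamma>(2) by simp
  have d0: "\<delta> 0 = 0" "\<delta> 1 = of_real r" by (simp_all add: \<delta>_def u)
  have c: "cosh (s - t) = minkowski (\<delta> s) (\<delta> t) / ((1 - (cmod (\<delta> s))\<^sup>2) * (1 - (cmod (\<delta> t))\<^sup>2))" for s t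
    using cosh_hdist(1)[OF d1 d1, of s t] d2[of s t] by (simp add: cosh_real_abs)
  have m: "1 - (cmod (\<delta> t))\<^sup>2 > 0" for t using d1[of t] by (simp add: abs_square_less_1)
  have ct: "cosh t = (1 + (cmod (\<delta> t))\<^sup>2) / (1 - (cmod (\<delta> t))\<^sup>2)" for t
    using c[of t 0] by (simp add: d0 minkowski_def)
  have sq: "(sinh t)\<^sup>2 = (2 * cmod (\<delta> t) / (1 - (cmod (\<delta> t))\<^sup>2))\<^sup>2" for t
  proof -
    define q where "q = (cmod (\<delta> t))\<^sup>2"
    have "(sinh t)\<^sup>2 = ((1 + q) / (1 - q))\<^sup>2 - 1"
      using cosh_square_eq[of t] unfolding ct q_def by simp
    also have "\<dots> = 4 * q / (1 - q)\<^sup>2"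
    proof -
      have "1 - q \<noteq> 0" using m[of t] unfolding q_def[symmetric] by simp
      then have "((1 + q) / (1 - q))\<^sup>2 - 1 = ((1 + q)\<^sup>2 - (1 - q)\<^sup>2) / (1 - q)\<^sup>2"
        by (simp add: power_divide diff_divide_distrib)
      also have "(1 + q)\<^sup>2 - (1 - q)\<^sup>2 = 4 * q" by (simp add: power2_eq_square algebra_simps)
      finally show ?thesis .
    qed
    finally show ?thesis by (simp add: q_def power_divide power_mult_distrib)
  qed
  define n where "n = 1 - r\<^sup>2"
  have n: "n > 0" using m[of 1] by (simp add: d0 n_def)
  have r1: "sinh 1 = 2 * r / n"
  proof -
    have "(sinh 1)\<^sup>2 = (2 * r / n)\<^sup>2" using sq[of 1] u(4) by (simp add: d0 n_def)
    then show ?thesis using u(4) n by (simp add: power2_eq_iff_nonneg)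
  qed
  have re: "sinh t = 2 * Re (\<delta> t) / (1 - (cmod (\<delta> t))\<^sup>2)" for t
  proof -
    have "cosh (t - 1) = (1 + (cmod (\<delta> t))\<^sup>2) / (1 - (cmod (\<delta> t))\<^sup>2) * ((1 + r\<^sup>2) / n)
       - 2 * Re (\<delta> t) / (1 - (cmod (\<delta> t))\<^sup>2) * (2 * r / n)"
      unfolding c by (simp add: d0 minkowski_def n_def diff_divide_distrib)
    also have "(1 + r\<^sup>2) / n = cosh 1" using ct[of 1] by (simp add: d0 n_def)
    finally have "cosh t * cosh 1 - sinh t * sinh 1
        = cosh t * cosh 1 - 2 * Re (\<delta> t) / (1 - (cmod (\<delta> t))\<^sup>2) * sinh 1"
      by (simp add: cosh_diff ct[symmetric] r1[symmetric])
    then have "sinh t * sinh 1 = 2 * Re (\<delta> t) / (1 - (cmod (\<delta> t))\<^sup>2) * sinh 1" by linarith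
    moreover have "sinh (1 :: real) \<noteq> 0" by simp
    ultimately show ?thesis by (metis mult_right_cancel)
  qed
  have im: "Im (\<delta> t) = 0" for t
  proof -
    have "(2 * cmod (\<delta> t) / (1 - (cmod (\<delta> t))\<^sup>2))\<^sup>2 = (2 * Re (\<delta> t) / (1 - (cmod (\<delta> t))\<^sup>2))\<^sup>2"
      using re[of t] sq[of t] by simp
    then have "(cmod (\<delta> t))\<^sup>2 = (Re (\<delta> t))\<^sup>2" using m[of t] by (simp add: power_divide power_mult_distrib)
    then show ?thesis by (simp add: cmod_power2)
  qed
  have "range \<delta> = open_diam"
  proof (intro equalityI subsetI)
    fix x assume "x \<in> range \<delta>" then show "x \<in> open_diam" using d1 im by (auto simp: open_diam_alt)
  next
    fix x assume x: "x \<in> open_diam"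
    define t where "t = arsinh (2 * Re x / (1 - (Re x)\<^sup>2))"
    have xr: "\<bar>Re x\<bar> < 1" using x abs_Re_le_cmod[of x] by (simp add: open_diam_alt)
    have dr: "cmod (\<delta> t) = \<bar>Re (\<delta> t)\<bar>" using im[of t] by (simp add: cmod_def)
    then have dr1: "\<bar>Re (\<delta> t)\<bar> < 1" using d1[of t] by simp
    have "2 * Re x / (1 - (Re x)\<^sup>2) = 2 * Re (\<delta> t) / (1 - (Re (\<delta> t))\<^sup>2)"
      using re[of t] dr by (simp add: t_def)
    then have "Re x = Re (\<delta> t)" by (rule sinh_param_inj[OF xr dr1])
    then have "x = \<delta> t" using im[of t] x by (simp add: complex_eq_iff open_diam_alt)
    then show "x \<in> range \<delta>" by simp
  qed
  moreover obtain k where k: "k \<in> G0" "\<And>z. cmod z \<le> 1 \<Longrightarrow> u (k z) = z"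
      "\<And>z. cmod z \<le> 1 \<Longrightarrow> k (u z) = z" using G0_inverse_apply[OF u(1)] by blast
  have "k ` range \<delta> = l"
  proof -
    have "k (\<delta> t) = \<gamma> t" for t unfolding \<delta>_def by (rule k(3)[OF less_imp_le[OF \<gamma>(1)]])
    then show ?thesis unfolding \<gamma>(3) image_image by simp
  qed
  ultimately show thesis using that[OF k(1)] by simp
qed

lemma half_turn_apply: "cmod z \<le> 1 \<Longrightarrow> half_turn z = - z"
  by (simp add: half_turn_def mob_def)

lemma half_turn_G0: "half_turn \<in> G0"
  unfolding half_turn_def G0_mob by (intro exI[of _ \<i>] exI[of _ 0]) (simp add: unimodular_def)

lemma gmul_image: "S \<subseteq> cball 0 1 \<Longrightarrow> gmul g k ` S = g ` k ` S"
  unfolding image_image by (intro image_cong refl) (auto simp: gmul_apply)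

lemma half_turn_image: "half_turn ` open_diam = open_diam" "half_turn ` closed_diam = closed_diam" "half_turn ` upper_side = lower_side"
proof -
  have *: "half_turn ` S = T" if "S \<subseteq> cball 0 1" "\<And>z. z \<in> S \<Longrightarrow> - z \<in> T" "\<And>z. z \<in> T \<Longrightarrow> - z \<in> S" for S T
  proof (intro equalityI subsetI)
    fix z assume "z \<in> half_turn ` S"
    then show "z \<in> T" using that(1,2) half_turn_apply by fastforce
  next
    fix z assume z: "z \<in> T"
    then have "cmod (- z) \<le> 1" using that(1,3) by fastforce
    then have "z = half_turn (- z)" using half_turn_apply by simp
    then show "z \<in> half_turn ` S" using that(3)[OF z] by (rule image_eqI)
  qed
  show "half_turn ` open_diam = open_diam" "half_turn ` closed_diam = closed_diam" "half_turn ` upper_side = lower_side"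
    by (rule *; auto simp: open_diam_alt closed_diam_alt upper_side_def lower_side_def)+
qed

lemma convex_upper_side: "convex upper_side"
  and convex_lower_side: "convex lower_side"
proof -
  have 1: "upper_side = cball 0 1 \<inter> {z. inner \<i> z > 0}" "lower_side = cball 0 1 \<inter> {z. inner \<i> z < 0}"
    by (auto simp: upper_side_def lower_side_def)
  show "convex upper_side" "convex lower_side"
    unfolding 1 by (intro convex_Int convex_cball convex_halfspace_gt convex_halfspace_lt)+
qed

text \<open>The two half-disks have connected images that cover the complement of the line. A
  component cannot meet both, since the imaginary part pulled back by \<open>k\<close> would vanish
  somewhere on it; by maximality it equals one of the images.\<close>

lemma transverse_orientation_param:
  assumes k: "k \<in> G0" and P: "transverse_orientation (k ` open_diam) P"
  obtains r where "r = G0_id \<or> r = half_turn" "P = gmul k r ` upper_side"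
proof -
  have P': "P \<in> components (cball 0 1 - k ` closed_diam)"
    using P by (simp add: transverse_orientation_def closure_line[OF k])
  obtain k1 where k1: "k1 \<in> G0" "\<And>z. cmod z \<le> 1 \<Longrightarrow> k (k1 z) = z" "\<And>z. cmod z \<le> 1 \<Longrightarrow> k1 (k z) = z"
    using G0_inverse_apply[OF k] by blast
  have inj: "inj_on k (cball 0 1)" using G0_inj[OF k] .
  have sub: "closed_diam \<subseteq> cball 0 1" "upper_side \<subseteq> cball 0 1" "lower_side \<subseteq> cball 0 1" by (auto simp: closed_diam_alt upper_side_def lower_side_def)
  have disj: "upper_side \<inter> closed_diam = {}" "lower_side \<inter> closed_diam = {}" by (auto simp: closed_diam_alt upper_side_def lower_side_def)
  have kc: "k ` cball 0 1 \<subseteq> cball 0 1" using G0_norm_le[OF k] by auto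
  have con: "connected (k ` S)" "k ` S \<subseteq> cball 0 1 - k ` closed_diam"
    if "convex S" "S \<subseteq> cball 0 1" "S \<inter> closed_diam = {}" for S
  proof -
    show "connected (k ` S)" using that G0_continuous[OF k]
      by (intro connected_continuous_image convex_connected) (auto intro: continuous_on_subset)
    have "k ` S \<inter> k ` closed_diam = {}" using inj_on_image_Int[OF inj that(2) sub(1)] that(3) by simp
    then show "k ` S \<subseteq> cball 0 1 - k ` closed_diam" using that kc by blast
  qed
  have Pne: "P \<noteq> {}" "P \<subseteq> cball 0 1 - k ` closed_diam" "connected P"
    using P' in_components_nonempty in_components_subset in_components_connected by blast+
  have cov: "x \<in> k ` upper_side \<union> k ` lower_side" if "x \<in> P" for x
  proof -
    have x: "cmod x \<le> 1" "x \<notin> k ` closed_diam" using that Pne by auto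
    have "k1 x \<in> cball 0 1" using G0_norm_le[OF k1(1) x(1)] by simp
    moreover have "k1 x \<notin> closed_diam"
    proof
      assume "k1 x \<in> closed_diam"
      then have "k (k1 x) \<in> k ` closed_diam" by blast
      then show False using x(2) by (simp only: k1(2)[OF x(1)])
    qed
    ultimately have "k1 x \<in> upper_side \<union> lower_side" by (auto simp: closed_diam_alt upper_side_def lower_side_def)
    then have "k (k1 x) \<in> k ` upper_side \<union> k ` lower_side" by blast
    then show ?thesis by (simp only: k1(2)[OF x(1)])
  qed
  have not_both: "P \<inter> k ` upper_side = {} \<or> P \<inter> k ` lower_side = {}"
  proof (rule ccontr)
    assume "\<not> ?thesis"
    then obtain x y where xy: "x \<in> upper_side" "k x \<in> P" "y \<in> lower_side" "k y \<in> P" by blast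
    have "continuous_on P k1" using G0_continuous[OF k1(1)] Pne(2) by (auto intro: continuous_on_subset)
    then have "connected ((\<lambda>z. Im (k1 z)) ` P)" by (intro connected_continuous_image Pne(3) continuous_intros)
    moreover have xy': "cmod x \<le> 1" "cmod y \<le> 1" "Im y \<le> 0" "0 \<le> Im x" using xy by (auto simp: upper_side_def lower_side_def)
    moreover have "Im x \<in> (\<lambda>z. Im (k1 z)) ` P" "Im y \<in> (\<lambda>z. Im (k1 z)) ` P"
      using imageI[OF xy(2), of "\<lambda>z. Im (k1 z)"] imageI[OF xy(4), of "\<lambda>z. Im (k1 z)"]
        k1(3)[OF xy'(1)] k1(3)[OF xy'(2)] by simp_all
    ultimately have "0 \<in> (\<lambda>z. Im (k1 z)) ` P" by (blast intro: connectedD_interval)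
    then obtain z where z: "z \<in> P" "Im (k1 z) = 0" by auto
    then have zc: "cmod z \<le> 1" "z \<notin> k ` closed_diam" using Pne(2) by auto
    then have "k1 z \<in> closed_diam" using z G0_norm_le[OF k1(1)] by (simp add: closed_diam_alt)
    then have "k (k1 z) \<in> k ` closed_diam" by blast
    then show False using zc(2) by (simp only: k1(2)[OF zc(1)])
  qed
  have max: "k ` S \<subseteq> P" if "P \<inter> k ` S \<noteq> {}" "convex S" "S \<subseteq> cball 0 1" "S \<inter> closed_diam = {}" for S
    using components_maximal[OF P' con[OF that(2-4)]] that(1) by blast
  have "P = k ` upper_side \<or> P = k ` lower_side"
  proof (cases "P \<inter> k ` lower_side = {}")
    case True
    then have "P \<subseteq> k ` upper_side" using cov by blast
    then have "P = k ` upper_side" using max[OF _ convex_upper_side sub(2) disj(1)] Pne(1) by blast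
    then show ?thesis ..
  next
    case False
    then have "P \<inter> k ` upper_side = {}" using not_both by blast
    then have "P \<subseteq> k ` lower_side" using cov by blast
    then have "P = k ` lower_side" using max[OF False convex_lower_side sub(3) disj(2)] by blast
    then show ?thesis ..
  qed
  moreover have "gmul k G0_id ` upper_side = k ` upper_side" unfolding gmul_image[OF sub(2)]
  proof -
    have "G0_id ` upper_side = (\<lambda>z. z) ` upper_side" using sub(2) by (intro image_cong refl) (auto simp: G0_id_apply)
    then show "k ` G0_id ` upper_side = k ` upper_side" by simp
  qed
  moreover have "gmul k half_turn ` upper_side = k ` lower_side" unfolding gmul_image[OF sub(2)] half_turn_image ..
  ultimately show thesis using that[of G0_id] that[of half_turn] by blast
qed

text \<open>The vector of a real point is a combination of the null vectors of the endpoints 1 and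
  -1, that is, of the spinors 1 and \<i>.\<close>

lemma tensor_closed_diam:
  assumes "Im x = 0"
  shows "1 + (cmod x)\<^sup>2 = ((1 + Re x)\<^sup>2 / 2) * (cmod 1)\<^sup>2 + ((1 - Re x)\<^sup>2 / 2) * (cmod \<i>)\<^sup>2"
    "2 * x = of_real ((1 + Re x)\<^sup>2 / 2) * 1\<^sup>2 + of_real ((1 - Re x)\<^sup>2 / 2) * \<i>\<^sup>2"
proof -
  have "x = of_real (Re x)" using assms by (simp add: complex_eq_iff)
  then obtain r where r: "x = of_real r" ..
  show "1 + (cmod x)\<^sup>2 = ((1 + Re x)\<^sup>2 / 2) * (cmod 1)\<^sup>2 + ((1 - Re x)\<^sup>2 / 2) * (cmod \<i>)\<^sup>2"
    "2 * x = of_real ((1 + Re x)\<^sup>2 / 2) * 1\<^sup>2 + of_real ((1 - Re x)\<^sup>2 / 2) * \<i>\<^sup>2"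
    unfolding r by (simp_all add: power2_eq_square field_simps)
qed

text \<open>The tensor of \<open>x\<close> lies on a horizontal chord of the disk of its height; the ends of the chord are
null and have square roots in the closed first quadrant.\<close>

lemma tensor_upper_side:
  assumes x: "cmod x \<le> 1" "Im x \<ge> 0"
  obtains c d z w where "c \<ge> 0" "d \<ge> 0" "Re z \<ge> 0" "Im z \<ge> 0" "z \<noteq> 0" "Re w \<ge> 0" "Im w \<ge> 0" "w \<noteq> 0"
    "c + d = 1"
    "1 + (cmod x)\<^sup>2 = c * (cmod z)\<^sup>2 + d * (cmod w)\<^sup>2" "2 * x = of_real c * z\<^sup>2 + of_real d * w\<^sup>2"
proof -
  define t where "t = 1 + (cmod x)\<^sup>2"
  define y where "y = 2 * Im x"
  define s where "s = sqrt (t\<^sup>2 - y\<^sup>2)"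
  have t: "t > 0" by (simp add: t_def add_pos_nonneg)
  have y: "y \<ge> 0" using x by (simp add: y_def)
  \<comment> \<open>The vector of \<open>x\<close> is timelike or null: \<open>t^2 - |2 x|^2\<close>
    is a square.\<close>
  have "0 \<le> (1 - (cmod x)\<^sup>2)\<^sup>2" by simp
  also have "\<dots> = t\<^sup>2 - (2 * cmod x)\<^sup>2" by (simp add: t_def power2_eq_square algebra_simps)
  also have "(2 * cmod x)\<^sup>2 = (2 * Re x)\<^sup>2 + y\<^sup>2" by (simp add: y_def power_mult_distrib cmod_power2)
  finally have le: "(2 * Re x)\<^sup>2 \<le> t\<^sup>2 - y\<^sup>2" by simp
  then have "0 \<le> t\<^sup>2 - y\<^sup>2" using zero_le_power2[of "2 * Re x"] by linarith
  then have s2: "s\<^sup>2 = t\<^sup>2 - y\<^sup>2" "s \<ge> 0" by (simp_all add: s_def)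
  have "s\<^sup>2 \<le> t\<^sup>2" using s2(1) zero_le_power2[of y] by linarith
  then have st: "s \<le> t" by (rule power2_le_imp_le[OF _ less_imp_le[OF t]])
  have "\<bar>2 * Re x\<bar>\<^sup>2 \<le> s\<^sup>2" using le s2(1) unfolding power2_abs by linarith
  then have res: "\<bar>2 * Re x\<bar> \<le> s" by (rule power2_le_imp_le[OF _ s2(2)])
  define z w where "z = csqrt (Complex s y)" and "w = csqrt (Complex (-s) y)"
  have n: "cmod (Complex s y) = t" "cmod (Complex (-s) y) = t" using s2 t by (simp_all add: cmod_def)
  have zw2: "(cmod z)\<^sup>2 = t" "(cmod w)\<^sup>2 = t" using n using t by (simp_all add: z_def w_def norm_csqrt)
  \<comment> \<open>For \<open>s = 0\<close> the chord is a single point and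
    \<open>Re x = 0\<close>; division by zero then gives \<open>v = 0\<close> and equal weights,
    which fits.\<close>
  define v where "v = 2 * Re x / s"
  define c d where "c = (1 + v) / 2" and "d = (1 - v) / 2"
  have "\<bar>v\<bar> \<le> 1" unfolding v_def using res s2(2) by (cases "s = 0") (simp_all add: abs_divide divide_le_eq_1)
  then have cd: "c \<ge> 0" "d \<ge> 0" unfolding c_def d_def by auto
  have cd1: "c + d = 1" "c - d = v" by (simp_all add: c_def d_def field_simps)
  have vs: "(c - d) * s = 2 * Re x" unfolding cd1 v_def using res by (cases "s = 0") simp_all
  have "(c + d) * y = 2 * Im x" unfolding cd1 by (simp add: y_def)
  then have "2 * x = of_real c * z\<^sup>2 + of_real d * w\<^sup>2"
    using vs by (simp add: z_def w_def complex_eq_iff algebra_simps)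
  moreover have "1 + (cmod x)\<^sup>2 = c * (cmod z)\<^sup>2 + d * (cmod w)\<^sup>2"
    unfolding zw2 t_def[symmetric] using cd1(1) by (metis distrib_right mult_1)
  moreover have "z \<noteq> 0" "w \<noteq> 0" using zw2 t by auto
  moreover have "Re z \<ge> 0" "Re w \<ge> 0" "Im z \<ge> 0" "Im w \<ge> 0"
    using y st s2(2) t by (simp_all add: z_def w_def n sgn_if)
  ultimately show thesis using that[OF cd] cd1(1) by blast
qed

subsection \<open>Horoballs\<close>

text \<open>The parameter is normalised so that isometries scale it by the conformal factor; it is
related to the Euclidean radius \<open>r\<close> by \<open>\<rho> = r / (1 - r)\<close>.\<close>

definition horodisk :: "complex \<Rightarrow> real \<Rightarrow> complex set" where
  "horodisk \<xi> \<rho> = {z. (cmod (z - \<xi>))\<^sup>2 < \<rho> * (1 - (cmod z)\<^sup>2)}"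

lemma horoball_horodisk:
  assumes "cmod \<xi> = 1" "0 < r" "r < 1"
  shows "horoball \<xi> r = horodisk \<xi> (r / (1 - r))"
proof -
  have "z \<in> horoball \<xi> r \<longleftrightarrow> z \<in> horodisk \<xi> (r / (1 - r))" for z
  proof -
    have x: "(Re \<xi>)\<^sup>2 + (Im \<xi>)\<^sup>2 = 1" using assms(1) by (simp add: cmod_power2[symmetric])
    have "z \<in> horoball \<xi> r \<longleftrightarrow> (cmod (z - of_real (1 - r) * \<xi>))\<^sup>2 < r\<^sup>2"
      unfolding horoball_def using assms(2)
      by (auto intro: power_strict_mono power2_less_imp_less)
    also have "(cmod (z - of_real (1 - r) * \<xi>))\<^sup>2 = (1 - r) * (cmod (z - \<xi>))\<^sup>2 + r * (cmod z)\<^sup>2 - r * (1 - r) * ((Re \<xi>)\<^sup>2 + (Im \<xi>)\<^sup>2)"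
      unfolding cmod_power2 by (simp add: power2_eq_square algebra_simps)
    also have "\<dots> < r\<^sup>2 \<longleftrightarrow> (1 - r) * (cmod (z - \<xi>))\<^sup>2 < r * (1 - (cmod z)\<^sup>2)"
      unfolding x by (simp add: power2_eq_square algebra_simps)
    also have "\<dots> \<longleftrightarrow> z \<in> horodisk \<xi> (r / (1 - r))"
      unfolding horodisk_def using assms(3) by (simp add: field_simps)
    finally show ?thesis .
  qed
  then show ?thesis by blast
qed

lemma horodisk_sub:
  assumes "\<rho> > 0" "z \<in> horodisk \<xi> \<rho>" shows "cmod z < 1"
proof -
  have "0 < \<rho> * (1 - (cmod z)\<^sup>2)" using assms(2) unfolding horodisk_def
    by (smt (verit) mem_Collect_eq zero_le_power2)
  then have "(cmod z)\<^sup>2 < 1" using assms(1) by (simp add: zero_less_mult_iff)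
  then show ?thesis by (simp add: abs_square_less_1)
qed

lemma horodisk_iff:
  assumes "g \<in> G0" "cmod \<xi> = 1" "\<rho> > 0" "cmod z \<le> 1"
  shows "g z \<in> horodisk (g \<xi>) (\<rho> / conf_factor g \<xi>) \<longleftrightarrow> z \<in> horodisk \<xi> \<rho>"
proof -
  have x: "cmod \<xi> \<le> 1" using assms by simp
  note pos = conf_factor_pos[OF assms(1) x] conf_factor_pos[OF assms(1) assms(4)]
  have "z \<in> horodisk \<xi> \<rho> \<longleftrightarrow> (cmod (g z - g \<xi>))\<^sup>2 * conf_factor g \<xi> * conf_factor g z < \<rho> * (1 - (cmod (g z))\<^sup>2) * conf_factor g z"
    unfolding horodisk_def mem_Collect_eq G0_dist[OF assms(1,4) x, symmetric] G0_norm[OF assms(1,4), symmetric]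
    by (simp add: mult_ac)
  also have "\<dots> \<longleftrightarrow> (cmod (g z - g \<xi>))\<^sup>2 * conf_factor g \<xi> < \<rho> * (1 - (cmod (g z))\<^sup>2)"
    using pos by simp
  also have "\<dots> \<longleftrightarrow> g z \<in> horodisk (g \<xi>) (\<rho> / conf_factor g \<xi>)"
    unfolding horodisk_def using pos by (simp add: field_simps)
  finally show ?thesis ..
qed

lemma horodisk_image:
  assumes "g \<in> G0" "cmod \<xi> = 1" "\<rho> > 0"
  shows "g ` horodisk \<xi> \<rho> = horodisk (g \<xi>) (\<rho> / conf_factor g \<xi>)"
proof (intro equalityI subsetI)
  fix w assume "w \<in> g ` horodisk \<xi> \<rho>"
  then obtain z where z: "w = g z" "z \<in> horodisk \<xi> \<rho>" by blast
  then have "cmod z \<le> 1" using horodisk_sub[OF assms(3)] by (simp add: less_imp_le)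
  then show "w \<in> horodisk (g \<xi>) (\<rho> / conf_factor g \<xi>)" using z horodisk_iff[OF assms] by simp
next
  fix w assume w: "w \<in> horodisk (g \<xi>) (\<rho> / conf_factor g \<xi>)"
  have "conf_factor g \<xi> > 0" using conf_factor_pos[OF assms(1)] assms(2) by simp
  then have "cmod w < 1" using horodisk_sub[OF _ w] assms(3) by simp
  then have w1: "cmod w \<le> 1" by simp
  obtain g1 where g1: "g1 \<in> G0" "\<And>z. cmod z \<le> 1 \<Longrightarrow> g (g1 z) = z"
    "\<And>z. cmod z \<le> 1 \<Longrightarrow> g1 (g z) = z" using G0_inverse_apply[OF assms(1)] by blast
  have "g1 w \<in> horodisk \<xi> \<rho>" using horodisk_iff[OF assms G0_norm_le[OF g1(1) w1]] w g1(2)[OF w1] by simp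
  then have "g (g1 w) \<in> g ` horodisk \<xi> \<rho>" by (rule imageI)
  then show "w \<in> g ` horodisk \<xi> \<rho>" by (simp only: g1(2)[OF w1])
qed

lemma horodisk_is_horoball:
  assumes "cmod \<xi> = 1" "\<rho> > 0"
  shows "horodisk \<xi> \<rho> = horoball \<xi> (\<rho> / (1 + \<rho>))" "is_horoball_at \<xi> (horodisk \<xi> \<rho>)"
proof -
  have r: "0 < \<rho> / (1 + \<rho>)" "\<rho> / (1 + \<rho>) < 1" using assms(2) by simp_all
  have "1 - \<rho> / (1 + \<rho>) = 1 / (1 + \<rho>)" using assms(2) by (simp add: field_simps)
  then have "\<rho> / (1 + \<rho>) / (1 - \<rho> / (1 + \<rho>)) = \<rho>" using assms(2) by simp
  then show 1: "horodisk \<xi> \<rho> = horoball \<xi> (\<rho> / (1 + \<rho>))" using horoball_horodisk[OF assms(1) r] by simp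
  show "is_horoball_at \<xi> (horodisk \<xi> \<rho>)" unfolding is_horoball_at_def using 1 r assms(1) by blast
qed

text \<open>Settles the case distinction in \<open>hsetdist\<close>: horodisks at different ideal
  points are never concentric.\<close>

lemma horoball_center_unique:
  assumes "is_horoball_at \<xi> A" "is_horoball_at \<eta> A" shows "\<xi> = \<eta>"
proof -
  obtain r s where rs: "0 < r" "r < 1" "A = horoball \<xi> r" "0 < s" "s < 1" "A = horoball \<eta> s" "cmod \<xi> = 1" "cmod \<eta> = 1"
    using assms by (auto simp: is_horoball_at_def)
  have "horoball x t = ball (of_real (1 - t) * x) t" for x t
    by (auto simp: horoball_def dist_norm norm_minus_commute)
  then have "ball (of_real (1 - r) * \<xi>) r = ball (of_real (1 - s) * \<eta>) s" using rs by metis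
  then have "of_real (1 - r) * \<xi> = of_real (1 - s) * \<eta>" "r = s" using rs by (auto simp: ball_eq_ball_iff)
  then show ?thesis using rs by simp
qed

text \<open>In the light-cone coordinates \<open>a/m, c/m\<close> and \<open>b/n, d/n\<close> of the two points, \<open>cosh d\<close> equals
\<open>(P + 1/P)/2\<close> plus a term that is nonnegative as long as \<open>P \<le> 1\<close>.\<close>

lemma horodisk_dist_lower:
  assumes z: "z \<in> horodisk 1 \<rho>" and w: "w \<in> horodisk (-1) \<rho>'" and r: "\<rho> > 0" "\<rho>' > 0" "\<rho> * \<rho>' \<le> 1"
  shows "ln (1 / (\<rho> * \<rho>')) \<le> hdist z w"
proof -
  have zw: "cmod z < 1" "cmod w < 1" using horodisk_sub z w r by auto
  define m n where "m = 1 - (cmod z)\<^sup>2" and "n = 1 - (cmod w)\<^sup>2"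
  have mn: "m > 0" "n > 0" using zw by (simp_all add: m_def n_def abs_square_less_1)
  define a b c d where "a = (cmod (z - 1))\<^sup>2" and "b = (cmod (w + 1))\<^sup>2" and "c = (cmod (z + 1))\<^sup>2" and "d = (cmod (w - 1))\<^sup>2"
  define P where "P = (a / m) * (b / n)"
  have "z \<noteq> 1" "w \<noteq> -1" using zw by auto
  then have ab: "a > 0" "b > 0" by (simp_all add: a_def b_def eq_neg_iff_add_eq_0)
  have P0: "P > 0" using ab mn by (simp add: P_def)
  have "a / m < \<rho>" "b / n < \<rho>'" using z w mn by (simp_all add: horodisk_def a_def b_def m_def n_def divide_less_eq)
  then have Pr: "P \<le> \<rho> * \<rho>'" unfolding P_def using ab mn r by (intro mult_mono) auto
  then have P1: "P \<le> 1" using r(3) by simp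
  define u v where "u = 2 * Im z / m" and "v = 2 * Im w / n"
  have bq2: "2 * minkowski z w = a * b + c * d - 8 * (Im z * Im w)"
    unfolding minkowski_def a_def b_def c_def d_def cmod_power2 by (simp add: power2_eq_square algebra_simps)
  have ac: "a * c = m\<^sup>2 + 4 * (Im z)\<^sup>2"
    unfolding a_def c_def m_def cmod_power2 by (simp add: power2_eq_square algebra_simps)
  have bd: "b * d = n\<^sup>2 + 4 * (Im w)\<^sup>2"
    unfolding b_def d_def n_def cmod_power2 by (simp add: power2_eq_square algebra_simps)
  have ac': "c / m = (1 + u\<^sup>2) / (a / m)"
  proof -
    have "(1 + u\<^sup>2) * m\<^sup>2 = a * c" unfolding ac u_def using mn by (simp add: power_divide power_mult_distrib distrib_right)
    then show ?thesis using mn ab by (simp add: field_simps power2_eq_square)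
  qed
  have bd': "d / n = (1 + v\<^sup>2) / (b / n)"
  proof -
    have "(1 + v\<^sup>2) * n\<^sup>2 = b * d" unfolding bd v_def using mn by (simp add: power_divide power_mult_distrib distrib_right)
    then show ?thesis using mn ab by (simp add: field_simps power2_eq_square)
  qed
  have "2 * cosh (hdist z w) = (2 * minkowski z w) / (m * n)" by (simp add: cosh_hdist(1)[OF zw] m_def n_def)
  also have "\<dots> = P + (c / m) * (d / n) - 2 * (u * v)"
    unfolding bq2 P_def u_def v_def by (simp add: add_divide_distrib diff_divide_distrib)
  also have "(c / m) * (d / n) = (1 + u\<^sup>2) * (1 + v\<^sup>2) / P"
    unfolding ac' bd' P_def by simp
  finally have ch: "2 * cosh (hdist z w) = P + (1 + u\<^sup>2) * (1 + v\<^sup>2) / P - 2 * (u * v)" .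
  have "2 * (u * v) \<le> (u\<^sup>2 + v\<^sup>2 + u\<^sup>2 * v\<^sup>2) / P"
  proof -
    have "2 * (u * v) \<le> u\<^sup>2 + v\<^sup>2" using zero_le_power2[of "u - v"] by (simp add: power2_diff)
    also have "\<dots> \<le> u\<^sup>2 + v\<^sup>2 + u\<^sup>2 * v\<^sup>2" by simp
    also have "\<dots> \<le> (u\<^sup>2 + v\<^sup>2 + u\<^sup>2 * v\<^sup>2) / P"
      using P0 P1 by (simp add: le_divide_eq mult_left_le)
    finally show ?thesis .
  qed
  moreover have "(1 + u\<^sup>2) * (1 + v\<^sup>2) / P = 1 / P + (u\<^sup>2 + v\<^sup>2 + u\<^sup>2 * v\<^sup>2) / P"
    by (simp add: add_divide_distrib[symmetric] algebra_simps)
  ultimately have "P + 1 / P \<le> 2 * cosh (hdist z w)" using ch by linarith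
  moreover have "cosh (ln (1 / P)) = (1 / P + P) / 2" using P0 by (simp add: cosh_ln_real inverse_eq_divide)
  ultimately have "cosh (ln (1 / P)) \<le> cosh (hdist z w)" by simp
  then have "ln (1 / P) \<le> hdist z w" using cosh_hdist(2)[OF zw] P0 P1
    by (subst (asm) cosh_real_nonneg_le_iff) (auto intro: ln_ge_zero)
  moreover have "ln (1 / (\<rho> * \<rho>')) \<le> ln (1 / P)" using Pr P0 r by (simp add: ln_div)
  ultimately show ?thesis by simp
qed

text \<open>\<open>x\<close> is the point of the diameter on the horocycle of parameter
  \<open>\<sigma>\<close> at 1: it solves \<open>(1 - x)^2 = \<sigma> * (1 - x^2)\<close>.\<close>

lemma horodisk_real_point:
  fixes \<sigma> :: real
  assumes "\<sigma> > 0"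
  defines "x \<equiv> (1 - \<sigma>) / (1 + \<sigma>)"
  shows "1 - x\<^sup>2 = 4 * \<sigma> / (1 + \<sigma>)\<^sup>2" "1 - x = 2 * \<sigma> / (1 + \<sigma>)" "\<bar>x\<bar> < 1"
proof -
  show 1: "1 - x = 2 * \<sigma> / (1 + \<sigma>)" using assms by (simp add: field_simps)
  have 2: "1 + x = 2 / (1 + \<sigma>)" using assms by (simp add: field_simps)
  have "1 - x\<^sup>2 = (1 - x) * (1 + x)" by (simp add: power2_eq_square algebra_simps)
  then show "1 - x\<^sup>2 = 4 * \<sigma> / (1 + \<sigma>)\<^sup>2" unfolding 1 2 by (simp add: power2_eq_square)
  have "1 - x > 0" "1 + x > 0" unfolding 1 2 using assms by simp_all
  then show "\<bar>x\<bar> < 1" by (simp add: abs_less_iff)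
qed

text \<open>The diameter is perpendicular to both horocycles, so its points realise the extremal
  distance. Horodisks are open, which is why the parameters are strictly smaller.\<close>

lemma horodisk_dist_attained:
  assumes s: "0 < \<sigma>" "\<sigma> < \<rho>" "0 < \<sigma>'" "\<sigma>' < \<rho>'" and p: "\<sigma> * \<sigma>' \<le> 1"
  obtains z w where "z \<in> horodisk 1 \<rho>" "w \<in> horodisk (-1) \<rho>'" "hdist z w = ln (1 / (\<sigma> * \<sigma>'))"
proof -
  define x where "x = (1 - \<sigma>) / (1 + \<sigma>)"
  define y where "y = (1 - \<sigma>') / (1 + \<sigma>')"
  note X = horodisk_real_point[OF s(1), folded x_def] and Y = horodisk_real_point[OF s(3), folded y_def]
  have "(1 - x)\<^sup>2 = \<sigma> * (1 - x\<^sup>2)" "(1 - y)\<^sup>2 = \<sigma>' * (1 - y\<^sup>2)" unfolding X Y using s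
    by (simp_all add: power_divide power2_eq_square)
  moreover have "1 - x\<^sup>2 > 0" "1 - y\<^sup>2 > 0" using X(3) Y(3) by (simp_all add: abs_square_less_1)
  ultimately have xy: "(1 - x)\<^sup>2 < \<rho> * (1 - x\<^sup>2)" "(1 - y)\<^sup>2 < \<rho>' * (1 - y\<^sup>2)"
    using s by simp_all
  have e1: "cmod (of_real x - 1) = \<bar>1 - x\<bar>" by (metis abs_minus_commute norm_of_real of_real_1 of_real_diff)
  have e2: "cmod (of_real (- y) - (- 1)) = \<bar>1 - y\<bar>"
    by (metis abs_minus_commute norm_of_real of_real_1 of_real_diff of_real_minus diff_minus_eq_add uminus_add_conv_diff)
  have z: "of_real x \<in> horodisk 1 \<rho>" unfolding horodisk_def mem_Collect_eq e1 using xy by simp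
  have w: "of_real (- y) \<in> horodisk (-1) \<rho>'" unfolding horodisk_def mem_Collect_eq e2 using xy by simp
  define P where "P = \<sigma> * \<sigma>'"
  have P: "P > 0" using s by (simp add: P_def)
  define Q where "Q = 1 - P"
  have "x + y = 2 * Q / ((1 + \<sigma>) * (1 + \<sigma>'))"
    unfolding x_def y_def Q_def P_def using s by (simp add: add_frac_eq) (simp add: algebra_simps)
  then have "(x + y)\<^sup>2 / ((1 - x\<^sup>2) * (1 - y\<^sup>2)) = Q\<^sup>2 / (4 * P)"
    unfolding X Y P_def[symmetric] using s by (simp add: power_divide power_mult_distrib P_def)
  then have "1 + 2 * (x + y)\<^sup>2 / ((1 - x\<^sup>2) * (1 - y\<^sup>2)) = 1 + Q\<^sup>2 / (2 * P)"
    by (simp add: field_simps)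
  also have "\<dots> = (1 / P + P) / 2" unfolding Q_def using P by (simp add: field_simps power2_eq_square)
  also have "\<dots> = cosh (ln (1 / P))" using P by (simp add: cosh_ln_real inverse_eq_divide)
  finally have "hdist (of_real x) (of_real (- y)) = arcosh (cosh (ln (1 / P)))"
    unfolding hdist_def of_real_diff[symmetric] norm_of_real by simp
  also have "\<dots> = ln (1 / P)" using P p by (intro arcosh_cosh_real ln_ge_zero) (simp add: P_def)
  finally show thesis using that[OF z w] by (simp add: P_def)
qed

lemma horodisk_Inf_std:
  assumes r: "\<rho> > 0" "\<rho>' > 0" "\<rho> * \<rho>' \<le> 1"
  shows "Inf {hdist z w | z w. z \<in> horodisk 1 \<rho> \<and> w \<in> horodisk (-1) \<rho>'} = ln (1 / (\<rho> * \<rho>'))"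
proof (rule cInf_eq)
  fix x assume "x \<in> {hdist z w | z w. z \<in> horodisk 1 \<rho> \<and> w \<in> horodisk (-1) \<rho>'}"
  then show "ln (1 / (\<rho> * \<rho>')) \<le> x" using horodisk_dist_lower r by blast
next
  fix y assume y: "\<And>x. x \<in> {hdist z w | z w. z \<in> horodisk 1 \<rho> \<and> w \<in> horodisk (-1) \<rho>'} \<Longrightarrow> y \<le> x"
  show "y \<le> ln (1 / (\<rho> * \<rho>'))"
  proof (rule field_le_epsilon)
    fix e :: real assume e: "e > 0"
    \<comment> \<open>Shrinking each of the two parameters by this factor lengthens the distance by
      exactly \<open>e\<close>.\<close>
    define k where "k = exp (- (e / 2))"
    have k: "0 < k" "k < 1" using e by (simp_all add: k_def)
    have "(\<rho> * k) * (\<rho>' * k) = (\<rho> * \<rho>') * (k * k)" by simp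
    also have "\<dots> \<le> 1 * 1" using r k by (intro mult_mono) (auto simp: mult_le_one)
    finally have kk: "(\<rho> * k) * (\<rho>' * k) \<le> 1" by simp
    obtain z w where "z \<in> horodisk 1 \<rho>" "w \<in> horodisk (-1) \<rho>'" "hdist z w = ln (1 / ((\<rho> * k) * (\<rho>' * k)))"
      by (rule horodisk_dist_attained[of "\<rho> * k" \<rho> "\<rho>' * k" \<rho>']) (use r k kk in auto)
    then have "y \<le> ln (1 / ((\<rho> * k) * (\<rho>' * k)))" using y by (metis (mono_tags, lifting) mem_Collect_eq)
    also have "\<dots> = ln (1 / (\<rho> * \<rho>')) + e"
      using r k by (simp add: ln_div ln_mult) (simp add: k_def)
    finally show "y \<le> ln (1 / (\<rho> * \<rho>')) + e" .
  qed
qed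

text \<open>A real factor does not move the ideal point of a spinor, so the second spinor can be
  rescaled until the determinant is 1, that of the pair 1, \<i>.\<close>

lemma ideal_pair_standard:
  assumes "cmod \<xi> = 1" "cmod \<xi>' = 1" "\<xi> \<noteq> \<xi>'"
  obtains k where "k \<in> G0" "k 1 = \<xi>" "k (-1) = \<xi>'"
proof -
  obtain v w where v: "v \<noteq> 0" "ideal_pt v = \<xi>" and w: "w \<noteq> 0" "ideal_pt w = \<xi>'" using ideal_pt_surj assms by metis
  have d: "det2 v w \<noteq> 0" using ideal_pt_eq_iff[OF v(1) w(1)] v w assms by simp
  define w' where "w' = w / of_real (det2 v w)"
  have w': "w' \<noteq> 0" "ideal_pt w' = \<xi>'" using w d by (simp_all add: w'_def ideal_pt_def)
  have "det2 v w' = 1" using d by (simp add: w'_def det2_def)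
  moreover have "det2 1 \<i> = 1" by (simp add: det2_def)
  ultimately obtain a b where ab: "unimodular a b" "spinor_map a b 1 = v" "spinor_map a b \<i> = w'"
    using spinor_map_exists[of 1 \<i> v w'] by auto
  have "mob a b (ideal_pt 1) = ideal_pt v" "mob a b (ideal_pt \<i>) = ideal_pt w'"
    using mob_ideal_pt(1)[OF ab(1), of 1] mob_ideal_pt(1)[OF ab(1), of \<i>] ab(2,3) by simp_all
  moreover have "ideal_pt 1 = 1" "ideal_pt \<i> = -1" by (simp_all add: ideal_pt_def)
  ultimately show thesis using that[of "mob a b"] ab(1) v w' by (auto simp: G0_mob)
qed

text \<open>Transported from the ideal points 1 and -1, whose squared distance is the 4 in the
  formula. The bound on \<open>\<rho> * \<rho>'\<close> keeps the horodisks disjoint.\<close>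

lemma horodisk_Inf:
  assumes "cmod \<xi> = 1" "cmod \<xi>' = 1" "\<xi> \<noteq> \<xi>'" and r: "\<rho> > 0" "\<rho>' > 0" "4 * (\<rho> * \<rho>') \<le> (cmod (\<xi> - \<xi>'))\<^sup>2"
  shows "Inf {hdist z w | z w. z \<in> horodisk \<xi> \<rho> \<and> w \<in> horodisk \<xi>' \<rho>'} = ln ((cmod (\<xi> - \<xi>'))\<^sup>2 / (4 * (\<rho> * \<rho>')))"
proof -
  obtain k where k: "k \<in> G0" "k 1 = \<xi>" "k (-1) = \<xi>'" using ideal_pair_standard[OF assms(1-3)] .
  define a b where "a = conf_factor k 1" and "b = conf_factor k (-1)"
  have ab: "a > 0" "b > 0" using conf_factor_pos[OF k(1)] by (simp_all add: a_def b_def)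
  have dab: "(cmod (\<xi> - \<xi>'))\<^sup>2 * (a * b) = 4"
    using G0_dist[OF k(1), of 1 "-1"] k by (simp add: a_def b_def mult.assoc)
  have i1: "horodisk \<xi> \<rho> = k ` horodisk 1 (\<rho> * a)"
    using horodisk_image[OF k(1), of 1 "\<rho> * a"] ab r by (simp add: k a_def[symmetric])
  have i2: "horodisk \<xi>' \<rho>' = k ` horodisk (-1) (\<rho>' * b)"
    using horodisk_image[OF k(1), of "-1" "\<rho>' * b"] ab r by (simp add: k b_def[symmetric])
  have iso: "hdist (k z) (k w) = hdist z w" if "z \<in> horodisk 1 (\<rho> * a)" "w \<in> horodisk (-1) (\<rho>' * b)" for z w
    using hdist_isometry[OF k(1)] horodisk_sub that r ab by (metis mult_pos_pos)
  have eq: "{hdist z w | z w. z \<in> horodisk \<xi> \<rho> \<and> w \<in> horodisk \<xi>' \<rho>'} = {hdist z w | z w. z \<in> horodisk 1 (\<rho> * a) \<and> w \<in> horodisk (-1) (\<rho>' * b)}"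
    unfolding i1 i2 using iso by (auto simp: image_iff) metis+
  have abr: "\<rho> * a * (\<rho>' * b) = 4 * (\<rho> * \<rho>') / (cmod (\<xi> - \<xi>'))\<^sup>2"
    using dab assms(3) by (simp add: field_simps)
  also have "\<dots> \<le> 1" using r assms(3) by (simp add: divide_le_eq_1)
  finally have "Inf {hdist z w | z w. z \<in> horodisk 1 (\<rho> * a) \<and> w \<in> horodisk (-1) (\<rho>' * b)} = ln (1 / (\<rho> * a * (\<rho>' * b)))"
    using r ab by (intro horodisk_Inf_std) auto
  then show ?thesis unfolding eq abr by simp
qed

lemma hsetdist_horodisk:
  assumes "cmod \<xi> = 1" "cmod \<xi>' = 1" "\<xi> \<noteq> \<xi>'" and r: "\<rho> > 0" "\<rho>' > 0" "4 * (\<rho> * \<rho>') \<le> (cmod (\<xi> - \<xi>'))\<^sup>2"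
  shows "hsetdist (horodisk \<xi> \<rho>) (horodisk \<xi>' \<rho>') = ereal (ln ((cmod (\<xi> - \<xi>'))\<^sup>2 / (4 * (\<rho> * \<rho>'))))"
proof -
  have "\<not> (\<exists>\<eta>. is_horoball_at \<eta> (horodisk \<xi> \<rho>) \<and> is_horoball_at \<eta> (horodisk \<xi>' \<rho>'))"
    using horodisk_is_horoball(2) horoball_center_unique assms by blast
  then show ?thesis unfolding hsetdist_def using horodisk_Inf[OF assms] by simp
qed

lemma hsetdist_horodisk_same:
  assumes "cmod \<xi> = 1" "\<rho> > 0" "\<rho>' > 0"
  shows "hsetdist (horodisk \<xi> \<rho>) (horodisk \<xi> \<rho>') = - \<infinity>"
  unfolding hsetdist_def using horodisk_is_horoball(2) assms by auto

section \<open>The function F at pairs of ideal points\<close>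

lemma F_ideal_eqI:
  assumes "r0 > 0" and "\<And>r r'. 0 < r \<Longrightarrow> r < r0 \<Longrightarrow> 0 < r' \<Longrightarrow> r' < r0 \<Longrightarrow>
      hsetdist (g ` horoball \<xi> r) (g' ` horoball \<xi>' r') - hsetdist (horoball \<xi> r) (horoball \<xi>' r') = v"
  shows "F_ideal g g' \<xi> \<xi>' = v"
  unfolding F_ideal_def
proof (rule the_equality)
  show "\<exists>r0>0. \<forall>r r'. 0 < r \<and> r < r0 \<and> 0 < r' \<and> r' < r0 \<longrightarrow>
      hsetdist (g ` horoball \<xi> r) (g' ` horoball \<xi>' r') - hsetdist (horoball \<xi> r) (horoball \<xi>' r') = v"
    using assms by blast
next
  fix v' assume "\<exists>r0>0. \<forall>r r'. 0 < r \<and> r < r0 \<and> 0 < r' \<and> r' < r0 \<longrightarrow>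
      hsetdist (g ` horoball \<xi> r) (g' ` horoball \<xi>' r') - hsetdist (horoball \<xi> r) (horoball \<xi>' r') = v'"
  then obtain r1 where r1: "r1 > 0" "\<And>r r'. 0 < r \<and> r < r1 \<and> 0 < r' \<and> r' < r1 \<longrightarrow>
      hsetdist (g ` horoball \<xi> r) (g' ` horoball \<xi>' r') - hsetdist (horoball \<xi> r) (horoball \<xi>' r') = v'" by blast
  define r where "r = min r0 r1 / 2"
  have "0 < r" "r < r0" "r < r1" using assms(1) r1(1) by (auto simp: r_def)
  then show "v' = v" using r1(2)[of r r] assms(2)[of r r] by simp
qed

text \<open>Below 1/2 one has \<open>r / (1 - r) <= 2 * r\<close>; this makes the first parameter at
  most \<open>e\<close> and the second at most 1.\<close>

lemma small_radius:
  fixes e :: real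
  assumes "e > 0" "e \<le> 1" "0 < r" "r < min (1/2) (e/2)" "0 < r'" "r' < min (1/2) (e/2)"
  shows "0 < r / (1 - r)" "0 < r' / (1 - r')" "r / (1 - r) * (r' / (1 - r')) \<le> e" "r < 1" "r' < 1"
proof -
  show "0 < r / (1 - r)" "0 < r' / (1 - r')" "r < 1" "r' < 1" using assms by auto
  have "r / (1 - r) \<le> 2 * r" "r' / (1 - r') \<le> 2 * r'" using assms by (simp_all add: divide_le_eq)
  then have "r / (1 - r) \<le> e" "r' / (1 - r') \<le> 1" using assms by auto
  then have "r / (1 - r) * (r' / (1 - r')) \<le> e * 1" using assms by (intro mult_mono) auto
  then show "r / (1 - r) * (r' / (1 - r')) \<le> e" by simp
qed

text \<open>The product of the horodisk parameters occurs in both logarithms and cancels in their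
  difference, which is therefore independent of the radii.\<close>

lemma F_ideal_finite:
  assumes g: "g \<in> G0" "g' \<in> G0" and x: "cmod \<xi> = 1" "cmod \<xi>' = 1" "\<xi> \<noteq> \<xi>'" "g \<xi> \<noteq> g' \<xi>'"
  shows "F_ideal g g' \<xi> \<xi>' = ereal (ln (pairing g g' \<xi> \<xi>' / minkowski \<xi> \<xi>'))"
proof -
  define A where "A = (cmod (\<xi> - \<xi>'))\<^sup>2"
  define B where "B = (cmod (g \<xi> - g' \<xi>'))\<^sup>2"
  define c c' where "c = conf_factor g \<xi>" and "c' = conf_factor g' \<xi>'"
  have x1: "cmod (g \<xi>) = 1" "cmod (g' \<xi>') = 1" using G0_norm_eq_1 g x by simp_all
  have pos: "A > 0" "B > 0" "c > 0" "c' > 0" using x conf_factor_pos g by (simp_all add: A_def B_def c_def c'_def)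
  \<comment> \<open>The bound \<open>A / 4\<close> keeps the original horodisks disjoint, and
    \<open>B * c * c' / 4\<close> their images.\<close>
  define e where "e = min 1 (min (A / 4) (B * c * c' / 4))"
  have e: "e > 0" "e \<le> 1" "e \<le> A / 4" "e \<le> B * c * c' / 4" using pos by (auto simp: e_def)
  show ?thesis
  proof (rule F_ideal_eqI)
    show "min (1/2) (e/2) > 0" using e by simp
    fix r r' assume r: "0 < r" "r < min (1/2) (e/2)" "0 < r'" "r' < min (1/2) (e/2)"
    define \<rho> \<rho>' where "\<rho> = r / (1 - r)" and "\<rho>' = r' / (1 - r')"
    note s = small_radius[OF e(1,2) r, folded \<rho>_def \<rho>'_def]
    have h: "horoball \<xi> r = horodisk \<xi> \<rho>" "horoball \<xi>' r' = horodisk \<xi>' \<rho>'"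
      using horoball_horodisk x r s by (simp_all add: \<rho>_def \<rho>'_def)
    have 1: "hsetdist (horodisk \<xi> \<rho>) (horodisk \<xi>' \<rho>') = ereal (ln (A / (4 * (\<rho> * \<rho>'))))"
      unfolding A_def using s e(3) by (intro hsetdist_horodisk x) (auto simp: A_def)
    have "4 * (\<rho> / c * (\<rho>' / c')) \<le> B" using s e(4) pos by (simp add: field_simps)
    then have 2: "hsetdist (g ` horodisk \<xi> \<rho>) (g' ` horodisk \<xi>' \<rho>') = ereal (ln (B / (4 * (\<rho> / c * (\<rho>' / c')))))"
      unfolding horodisk_image[OF g(1) x(1) s(1)] horodisk_image[OF g(2) x(2) s(2)] c_def[symmetric] c'_def[symmetric] B_def
      using s pos by (intro hsetdist_horodisk x x1) (auto simp: B_def)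
    have "ln (B / (4 * (\<rho> / c * (\<rho>' / c')))) - ln (A / (4 * (\<rho> * \<rho>')))
       = ln ((B / (4 * (\<rho> / c * (\<rho>' / c')))) / (A / (4 * (\<rho> * \<rho>'))))"
      using pos s by (subst ln_divide_pos) auto
    also have "(B / (4 * (\<rho> / c * (\<rho>' / c')))) / (A / (4 * (\<rho> * \<rho>'))) = pairing g g' \<xi> \<xi>' / minkowski \<xi> \<xi>'"
      unfolding pairing_def minkowski_sphere[OF x(1)] minkowski_sphere[OF x1(1)] A_def[symmetric] B_def[symmetric] c_def[symmetric] c'_def[symmetric]
      using s pos by (simp add: field_simps)
    finally show "hsetdist (g ` horoball \<xi> r) (g' ` horoball \<xi>' r') - hsetdist (horoball \<xi> r) (horoball \<xi>' r')
        = ereal (ln (pairing g g' \<xi> \<xi>' / minkowski \<xi> \<xi>'))"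
      unfolding h 1 2 by simp
  qed
qed

text \<open>The concentric horoballs at \<open>\<xi>\<close> have distance minus infinity, while
  their images are centred at different points and have finite distance.\<close>

lemma F_ideal_infinite:
  assumes g: "g \<in> G0" "g' \<in> G0" and x: "cmod \<xi> = 1" "g \<xi> \<noteq> g' \<xi>"
  shows "F_ideal g g' \<xi> \<xi> = \<infinity>"
proof -
  define B where "B = (cmod (g \<xi> - g' \<xi>))\<^sup>2"
  define c c' where "c = conf_factor g \<xi>" and "c' = conf_factor g' \<xi>"
  have x1: "cmod (g \<xi>) = 1" "cmod (g' \<xi>) = 1" using G0_norm_eq_1 g x by simp_all
  have pos: "B > 0" "c > 0" "c' > 0" using x conf_factor_pos g by (simp_all add: B_def c_def c'_def)
  define e where "e = min 1 (B * c * c' / 4)"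
  have e: "e > 0" "e \<le> 1" "e \<le> B * c * c' / 4" using pos by (auto simp: e_def)
  show ?thesis
  proof (rule F_ideal_eqI)
    show "min (1/2) (e/2) > 0" using e by simp
    fix r r' assume r: "0 < r" "r < min (1/2) (e/2)" "0 < r'" "r' < min (1/2) (e/2)"
    define \<rho> \<rho>' where "\<rho> = r / (1 - r)" and "\<rho>' = r' / (1 - r')"
    note s = small_radius[OF e(1,2) r, folded \<rho>_def \<rho>'_def]
    have h: "horoball \<xi> r = horodisk \<xi> \<rho>" "horoball \<xi> r' = horodisk \<xi> \<rho>'"
      using horoball_horodisk x r s by (simp_all add: \<rho>_def \<rho>'_def)
    have "4 * (\<rho> / c * (\<rho>' / c')) \<le> B" using s e(3) pos by (simp add: field_simps)
    then have 2: "hsetdist (g ` horodisk \<xi> \<rho>) (g' ` horodisk \<xi> \<rho>') = ereal (ln (B / (4 * (\<rho> / c * (\<rho>' / c')))))"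
      unfolding horodisk_image[OF g(1) x(1) s(1)] horodisk_image[OF g(2) x(1) s(2)] c_def[symmetric] c'_def[symmetric] B_def
      using s pos by (intro hsetdist_horodisk x x1) (auto simp: B_def)
    show "hsetdist (g ` horoball \<xi> r) (g' ` horoball \<xi> r') - hsetdist (horoball \<xi> r) (horoball \<xi> r') = \<infinity>"
      unfolding h 2 hsetdist_horodisk_same[OF x(1) s(1,2)] by simp
  qed
qed

subsection \<open>Pairs of lines\<close>

lemma Cset_line: "k \<in> G0 \<Longrightarrow> Cset (k ` open_diam) = crooked (k ` closed_diam)"
  by (simp add: Cset_def crooked_def closure_line)

lemma minkowski_ge:
  "minkowski p q \<ge> (1 - (cmod p)\<^sup>2) * (1 - (cmod q)\<^sup>2)"
  unfolding minkowski_alt by simp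

text \<open>Isometries preserve the Minkowski norm \<open>1 - |p|^2\<close> of the vector of
  \<open>p\<close>. For image vectors on a common ray the pairing is the product of the two norms,
  and the original pairing is never below that product.\<close>

lemma pairing_meet:
  assumes "g \<in> G0" "g' \<in> G0" "cmod p \<le> 1" "cmod p' \<le> 1" "g p = g' p'"
  shows "pairing g g' p p' \<le> minkowski p p'"
proof -
  have "pairing g g' p p' = ((1 - (cmod (g p))\<^sup>2) * conf_factor g p) * ((1 - (cmod (g' p'))\<^sup>2) * conf_factor g' p')"
    unfolding pairing_def assms(5) minkowski_self by (simp add: power2_eq_square mult_ac)
  also have "\<dots> = (1 - (cmod p)\<^sup>2) * (1 - (cmod p')\<^sup>2)"
    unfolding G0_norm[OF assms(1,3)] G0_norm[OF assms(2,4)] ..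
  also have "\<dots> \<le> minkowski p p'" by (rule minkowski_ge)
  finally show ?thesis .
qed

text \<open>By connectedness some pair of points keeps its distance, so an isometry \<open>h\<close>
  agrees with \<open>g\<close> at one point and with \<open>g'\<close> at the other. Interior points
  are essential: there the conformal factor is determined by the point and its image, so
  \<open>h\<close> has the same factors as \<open>g\<close> and \<open>g'\<close>.\<close>

lemma crossing:
  assumes g: "g \<in> G0" "g' \<in> G0"
    and C: "connected C" "C \<subseteq> ball 0 1" "connected C'" "C' \<subseteq> ball 0 1"
    and le: "p1 \<in> C" "p1' \<in> C'" "pairing g g' p1 p1' \<le> minkowski p1 p1'"
    and ge: "p2 \<in> C" "p2' \<in> C'" "minkowski p2 p2' \<le> pairing g g' p2 p2'"
    and X: "C \<subseteq> X" "X \<subseteq> cball 0 1" "C' \<subseteq> X'" "X' \<subseteq> cball 0 1"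
  shows "gmul g ` crooked X \<inter> gmul g' ` crooked X' \<noteq> {}"
proof -
  define D where "D = (\<lambda>(x, y). pairing g g' x y - minkowski x y)"
  have sub: "C \<times> C' \<subseteq> cball 0 1 \<times> cball 0 1" using X by blast
  have "continuous_on (C \<times> C') (\<lambda>z. (case z of (x, y) \<Rightarrow> pairing g g' x y) - minkowski (fst z) (snd z))"
    using continuous_on_subset[OF pairing_continuous[OF g] sub]
    unfolding minkowski_def by (intro continuous_intros)
  then have "continuous_on (C \<times> C') D" by (simp add: D_def split_def)
  then have "connected (D ` (C \<times> C'))" by (intro connected_continuous_image connected_Times C)
  moreover have "D (p1, p1') \<in> D ` (C \<times> C')" "D (p2, p2') \<in> D ` (C \<times> C')" using le ge by blast+
  moreover have "D (p1, p1') \<le> 0" "0 \<le> D (p2, p2')" using le ge by (simp_all add: D_def)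
  ultimately have "0 \<in> D ` (C \<times> C')" by (blast intro: connectedD_interval)
  then obtain p p' where p: "p \<in> C" "p' \<in> C'" "pairing g g' p p' = minkowski p p'" by (auto simp: D_def)
  have p1: "cmod p < 1" "cmod p' < 1" using p C by auto
  have "cosh (hdist p p') = cosh (hdist (g p) (g' p'))"
    using cosh_hdist_pairing[OF g p1] cosh_hdist(1)[OF p1] p(3) by simp
  moreover have n: "cmod (g p) < 1" "cmod (g' p') < 1" using G0_norm_less g p1 by blast+
  ultimately have "hdist p p' = hdist (g p) (g' p')"
    using cosh_hdist(2)[OF p1] cosh_hdist(2)[OF n] by (metis arcosh_cosh_real)
  then obtain h where h: "h \<in> G0" "h p = g p" "h p' = g' p'" using transitive_pairs[OF p1 n] by blast
  have conf_factor: "conf_factor h q = conf_factor f q" if "f \<in> G0" "h q = f q" "cmod q < 1" for f q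
  proof -
    have q: "cmod q \<le> 1" using that by simp
    have "(cmod (f q))\<^sup>2 < 1" using G0_norm_less[OF that(1,3)] by (simp add: abs_square_less_1)
    moreover have "(1 - (cmod (f q))\<^sup>2) * conf_factor h q = (1 - (cmod (f q))\<^sup>2) * conf_factor f q"
      using G0_norm[OF h(1) q] G0_norm[OF that(1) q] that(2) by simp
    ultimately show ?thesis by simp
  qed
  have e: "conf_factor h p = conf_factor g p" "conf_factor h p' = conf_factor g' p'"
    using conf_factor[OF g(1) h(2) p1(1)] conf_factor[OF g(2) h(3) p1(2)] by simp_all
  show ?thesis
    by (rule crooked_meet[OF g X(2,4) h(1) _ h(2) _ _ h(3)]) (use p X e in auto)
qed

text \<open>The strict inequality absorbs both degenerate cases: it fails by
  \<open>pairing_meet\<close> when the images coincide, and when only \<open>\<xi> = \<xi>'\<close>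
  it reads \<open>pairing > 0\<close>, matching an infinite value of F.\<close>

lemma F_ideal_pos_iff:
  assumes g: "g \<in> G0" "g' \<in> G0" and x: "cmod \<xi> = 1" "cmod \<xi>' = 1"
  shows "g \<xi> \<noteq> g' \<xi>' \<and> F_ideal g g' \<xi> \<xi>' > 0 \<longleftrightarrow> pairing g g' \<xi> \<xi>' > minkowski \<xi> \<xi>'"
proof (cases "g \<xi> = g' \<xi>'")
  case True
  then show ?thesis using pairing_meet[OF g, of \<xi> \<xi>'] x by simp
next
  case False
  have x1: "cmod (g \<xi>) = 1" using G0_norm_eq_1[OF g(1)] x by simp
  have pairing: "pairing g g' \<xi> \<xi>' > 0" unfolding pairing_def minkowski_sphere[OF x1] using False conf_factor_pos g x by simp
  show ?thesis
  proof (cases "\<xi> = \<xi>'")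
    case True
    then have "F_ideal g g' \<xi> \<xi>' = \<infinity>" using F_ideal_infinite[OF g x(1)] False by simp
    moreover have "minkowski \<xi> \<xi>' = 0" using True x by (simp add: minkowski_self)
    ultimately show ?thesis using False pairing by simp
  next
    case ne: False
    have "minkowski \<xi> \<xi>' > 0" unfolding minkowski_sphere[OF x(1)] using ne by simp
    then show ?thesis using F_ideal_finite[OF g x ne False] False pairing by (simp add: ln_gt_zero_iff)
  qed
qed

text \<open>Individual weights may vanish, but their total \<open>(c + d) * (c' + d')\<close> is
  positive, so the smallest gap \<open>e\<close> keeps the inequality strict.\<close>

lemma weighted_less:
  fixes c d c' d' :: real
  assumes "c \<ge> 0" "d \<ge> 0" "c + d > 0" "c' \<ge> 0" "d' \<ge> 0" "c' + d' > 0"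
    and "q1 < p1" "q2 < p2" "q3 < p3" "q4 < p4"
  shows "c * c' * q1 + c * d' * q2 + d * c' * q3 + d * d' * q4 < c * c' * p1 + c * d' * p2 + d * c' * p3 + d * d' * p4"
proof -
  define e where "e = min (min (p1 - q1) (p2 - q2)) (min (p3 - q3) (p4 - q4))"
  have e: "e > 0" "e \<le> p1 - q1" "e \<le> p2 - q2" "e \<le> p3 - q3" "e \<le> p4 - q4" using assms by (auto simp: e_def)
  have "0 < (c + d) * (c' + d') * e" using assms e by simp
  also have "\<dots> = c * c' * e + c * d' * e + d * c' * e + d * d' * e" by (simp add: algebra_simps)
  also have "\<dots> \<le> c * c' * (p1 - q1) + c * d' * (p2 - q2) + d * c' * (p3 - q3) + d * d' * (p4 - q4)"
    using assms e by (intro add_mono mult_left_mono) auto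
  finally show ?thesis by (simp add: algebra_simps)
qed

lemma weighted_le:
  fixes c d c' d' :: real
  assumes "c \<ge> 0" "d \<ge> 0" "c' \<ge> 0" "d' \<ge> 0"
    and "m * q1 \<le> p1" "m * q2 \<le> p2" "m * q3 \<le> p3" "m * q4 \<le> p4"
  shows "m * (c * c' * q1 + c * d' * q2 + d * c' * q3 + d * d' * q4) \<le> c * c' * p1 + c * d' * p2 + d * c' * p3 + d * d' * p4"
proof -
  have "m * (c * c' * q1 + c * d' * q2 + d * c' * q3 + d * d' * q4)
      = c * c' * (m * q1) + c * d' * (m * q2) + d * c' * (m * q3) + d * d' * (m * q4)" by (simp add: algebra_simps)
  also have "\<dots> \<le> c * c' * p1 + c * d' * p2 + d * c' * p3 + d * d' * p4"
    using assms by (intro add_mono mult_left_mono) auto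
  finally show ?thesis .
qed

lemma det2_pluecker: "det2 a c * det2 b d - det2 a d * det2 b c = det2 a b * det2 c d"
  by (simp add: det2_def algebra_simps)

lemma det2_antisym: "det2 a b = - det2 b a"
  by (simp add: det2_def algebra_simps)

text \<open>Applied to two opposite corners: both products are 1 or -1, yet one should exceed the
  other by the factor \<open>M\<close>.\<close>

lemma no_scaled_pair:
  fixes M :: real
  assumes "M > 1" "M * q1\<^sup>2 \<le> p1\<^sup>2" "M * q2\<^sup>2 \<le> p2\<^sup>2" "(q1 * q2)\<^sup>2 = 1" "(p1 * p2)\<^sup>2 = 1"
  shows False
proof -
  have "(M * q1\<^sup>2) * (M * q2\<^sup>2) \<le> p1\<^sup>2 * p2\<^sup>2" using assms by (intro mult_mono) auto
  then have "M * M * (q1 * q2)\<^sup>2 \<le> (p1 * p2)\<^sup>2" by (simp add: power_mult_distrib mult_ac)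
  then have "M * M \<le> 1" using assms by simp
  moreover have "1 * 1 < M * M" using assms by (intro mult_strict_mono) auto
  ultimately show False by simp
qed

text \<open>Converts a ratio of hyperbolic cosines into a difference of distances.\<close>

lemma cosh_add_ln_le:
  fixes d m :: real
  assumes "m \<ge> 1" shows "cosh (d + ln m) \<le> m * cosh d"
proof -
  have "sinh d * sinh (ln m) \<le> cosh d * sinh (ln m)"
    using assms sinh_le_cosh_real[of d] by (intro mult_right_mono) auto
  then have "cosh (d + ln m) \<le> cosh d * (cosh (ln m) + sinh (ln m))"
    by (simp add: cosh_add distrib_left)
  also have "cosh (ln m) + sinh (ln m) = m" using assms by (simp add: cosh_plus_sinh)
  finally show ?thesis by (simp add: mult.commute)
qed

lemma spinor_map_lin: "spinor_map a b z = of_real (Re z) * spinor_map a b 1 + of_real (Im z) * spinor_map a b \<i>"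
proof -
  have "spinor_map a b (of_real (Re z) + \<i> * of_real (Im z))
      = of_real (Re z) * spinor_map a b 1 + of_real (Im z) * spinor_map a b \<i>"
    by (simp add: spinor_map_def algebra_simps)
  then show ?thesis by (simp flip: complex_eq)
qed

lemma det2_bilinear:
  "det2 (spinor_map a b z) (spinor_map a' b' w) = Re z * Re w * det2 (spinor_map a b 1) (spinor_map a' b' 1) + Re z * Im w * det2 (spinor_map a b 1) (spinor_map a' b' \<i>)
    + Im z * Re w * det2 (spinor_map a b \<i>) (spinor_map a' b' 1) + Im z * Im w * det2 (spinor_map a b \<i>) (spinor_map a' b' \<i>)"
  by (subst spinor_map_lin[of a b z], subst spinor_map_lin[of a' b' w]) (simp add: det2_def algebra_simps)

text \<open>The ideal point of \<open>s\<close> is \<open>s^2 / |s|^2\<close>, which lies in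
  \<open>upper_side\<close> when \<open>Re s * Im s > 0\<close>. By Cramer's rule the coordinates
  \<open>s\<close> of \<open>v\<close> in the basis of images of 1 and \<i> are, up to sign, the two
  determinants, and a negative product of these would put the point on the excluded side.\<close>

lemma sides_sign:
  assumes "unimodular e f" "unimodular e' f'" "w \<noteq> 0" "mob e' f' (ideal_pt w) \<notin> mob e f ` upper_side"
  shows "det2 (spinor_map e f 1) (spinor_map e' f' w) * det2 (spinor_map e f \<i>) (spinor_map e' f' w) \<ge> 0"
proof (rule ccontr)
  assume neg: "\<not> ?thesis"
  define v where "v = spinor_map e' f' w"
  define s where "s = Complex (- det2 (spinor_map e f \<i>) v) (det2 (spinor_map e f 1) v)"
  have d1: "det2 (spinor_map e f 1) (spinor_map e f \<i>) = 1" using det2_spinor_map[OF assms(1)] by (simp add: det2_def)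
  have "v * of_real (det2 x y) = of_real (det2 v y) * x + of_real (det2 x v) * y" for x y
    by (simp add: complex_eq_iff det2_def algebra_simps)
  from this[of "spinor_map e f 1" "spinor_map e f \<i>"] have "spinor_map e f s = v"
    unfolding d1 by (subst spinor_map_lin) (simp add: s_def det2_antisym[of v])
  moreover have im: "Im (s * s) > 0" using neg by (simp add: s_def v_def mult.commute)
  then have s0: "s \<noteq> 0" by auto
  ultimately have "mob e f (ideal_pt s) = mob e' f' (ideal_pt w)" using mob_ideal_pt(1)[OF assms(1) s0] mob_ideal_pt(1)[OF assms(2,3)] by (simp add: v_def)
  moreover have "ideal_pt s \<in> upper_side"
  proof -
    have "ideal_pt s = s * s / of_real ((cmod s)\<^sup>2)" using s0 unfolding ideal_pt_def complex_norm_square by simp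
    then have "Im (ideal_pt s) = Im (s * s) / (cmod s)\<^sup>2" by (metis Im_divide_of_real)
    then have "Im (ideal_pt s) > 0" using im s0 by simp
    then show ?thesis using ideal_pt_norm[OF s0] by (simp add: upper_side_def)
  qed
  ultimately show False using assms(4) by (metis image_eqI)
qed

text \<open>Turns an equation between spinors into the membership criterion of
  \<open>gmul_crooked\<close>: the real factor \<open>\<kappa>\<close> does not change the ideal
  point, and it multiplies the conformal factor by \<open>\<kappa>^2\<close>.\<close>

lemma spinor_map_lift:
  assumes unimodular: "unimodular a b" "unimodular e f" and g: "g \<in> G0" "mob e f = gmul g (mob a b)" and z: "z \<noteq> 0"
    and h: "unimodular h1 h2" "spinor_map h1 h2 (spinor_map a b z) = of_real \<kappa> * spinor_map e f z" "\<bar>\<kappa>\<bar> \<ge> 1"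
  shows "mob h1 h2 (mob a b (ideal_pt z)) = g (mob a b (ideal_pt z))"
    and "conf_factor (mob h1 h2) (mob a b (ideal_pt z)) \<ge> conf_factor g (mob a b (ideal_pt z))"
proof -
  define s where "s = spinor_map a b z"
  define t where "t = spinor_map e f z"
  have n: "s \<noteq> 0" "t \<noteq> 0" using spinor_map_nz unimodular z by (simp_all add: s_def t_def)
  have l0: "\<kappa> \<noteq> 0" using h by auto
  have i: "cmod (ideal_pt z) \<le> 1" using ideal_pt_norm[OF z] by simp
  have k: "mob a b \<in> G0" using unimodular by (auto simp: G0_mob)
  have ki: "mob a b (ideal_pt z) = ideal_pt s" using mob_ideal_pt(1)[OF unimodular(1) z] by (simp add: s_def)
  have "g (ideal_pt s) = mob e f (ideal_pt z)" unfolding g(2) using i ki by (simp add: gmul_apply)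
  then have gi: "g (ideal_pt s) = ideal_pt t" using mob_ideal_pt(1)[OF unimodular(2) z] by (simp add: t_def)
  have hs: "spinor_map h1 h2 s = of_real \<kappa> * t" using h by (simp add: s_def t_def)
  show "mob h1 h2 (mob a b (ideal_pt z)) = g (mob a b (ideal_pt z))"
    unfolding ki gi mob_ideal_pt(1)[OF h(1) n(1)] hs using l0 by (simp add: ideal_pt_def)
  have "conf_factor (mob e f) (ideal_pt z) = conf_factor g (ideal_pt s) * conf_factor (mob a b) (ideal_pt z)" unfolding g(2) conf_factor_gmul[OF g(1) k i] ki ..
  then have "(cmod t / cmod z)\<^sup>2 = conf_factor g (ideal_pt s) * (cmod s / cmod z)\<^sup>2"
    using mob_ideal_pt(2)[OF unimodular(1) z] mob_ideal_pt(2)[OF unimodular(2) z] by (simp add: s_def t_def)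
  then have cg: "conf_factor g (ideal_pt s) = (cmod t / cmod s)\<^sup>2" using z n by (simp add: power_divide field_simps)
  have "(cmod t / cmod s)\<^sup>2 \<le> (\<bar>\<kappa>\<bar> * cmod t / cmod s)\<^sup>2" using n h(3)
    by (intro power_mono divide_right_mono) auto
  then show "conf_factor (mob h1 h2) (mob a b (ideal_pt z)) \<ge> conf_factor g (mob a b (ideal_pt z))"
    unfolding ki cg mob_ideal_pt(2)[OF h(1) n(1)] hs by (simp add: norm_mult)
qed

lemma parallel_spinor_map:
  assumes "det2 v w = 0" "v \<noteq> 0" "w \<noteq> 0"
  obtains \<mu> where "\<mu> \<noteq> 0" "w = of_real \<mu> * v"
proof -
  have "of_real ((cmod v)\<^sup>2) * w = of_real (Re (cnj v * w)) * v"
  proof -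
    have "cnj v * w = of_real (Re (cnj v * w))" using assms(1) by (simp add: complex_eq_iff det2_def)
    then have "(cnj v * w) * v = of_real (Re (cnj v * w)) * v" by simp
    then show ?thesis unfolding complex_norm_square by (simp only: mult_ac)
  qed
  then have "w = of_real (Re (cnj v * w) / (cmod v)\<^sup>2) * v" using assms(2) by (simp add: field_simps)
  then show thesis using that assms(3) by (metis mult_zero_left of_real_0)
qed

lemma spinor_map_exists_single:
  assumes "v \<noteq> 0" "v' \<noteq> 0" obtains a b where "unimodular a b" "spinor_map a b v = v'"
proof -
  have d: "det2 x (\<i> * x) = (cmod x)\<^sup>2" for x unfolding det2_def cmod_power2 by (simp add: power2_eq_square)
  \<comment> \<open>The scaling makes \<open>det2 v' w'\<close> equal to
    \<open>det2 v (\<i> * v)\<close>, as \<open>spinor_map_exists\<close> requires.\<close>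
  define w' where "w' = of_real ((cmod v)\<^sup>2 / (cmod v')\<^sup>2) * (\<i> * v')"
  have lin: "det2 v' (of_real r * x) = r * det2 v' x" for r x by (simp add: det2_def algebra_simps)
  have "det2 v' w' = (cmod v)\<^sup>2" unfolding w'_def lin d using assms by simp
  moreover have "det2 v (\<i> * v) \<noteq> 0" using assms by (simp add: d)
  ultimately show thesis using spinor_map_exists[of v "\<i> * v" v' w'] that by (auto simp: d)
qed

section \<open>Two lines and their four pairs of endpoints\<close>

text \<open>The maps \<open>mob a b\<close> and \<open>mob a' b'\<close> carry the real diameter to the lines \<open>l\<close> and \<open>l'\<close>. The endpoints of
the diameter are represented by the spinors \<open>1\<close> and \<open>\<i>\<close>.\<close>

locale line_pair =
  fixes g g' :: "complex \<Rightarrow> complex" and a b a' b' e f e' f' :: complex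
  assumes g: "g \<in> G0" and g': "g' \<in> G0"
    and unimodular: "unimodular a b" "unimodular a' b'" "unimodular e f" "unimodular e' f'"
    and gk: "mob e f = gmul g (mob a b)" and gk': "mob e' f' = gmul g' (mob a' b')"
begin

text \<open>On the spinors 1 and \<i>, \<open>\<alpha>\<close> compares endpoints of the given lines
  and \<open>\<beta>\<close> the endpoints of their images under \<open>g\<close> and
  \<open>g'\<close>.\<close>

definition \<alpha> where "\<alpha> z w = det2 (spinor_map a b z) (spinor_map a' b' w)"
definition \<beta> where "\<beta> z w = det2 (spinor_map e f z) (spinor_map e' f' w)"

text \<open>The hub of the equivalence: each of (1), (2) and (3) is compared with this
  condition.\<close>

definition dominated where
  "dominated \<longleftrightarrow> (\<forall>z \<in> {1, \<i>}. \<forall>w \<in> {1, \<i>}. \<bar>\<alpha> z w\<bar> < \<bar>\<beta> z w\<bar>)"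

lemma maps_in_G0: "mob a b \<in> G0" "mob a' b' \<in> G0" "mob e f \<in> G0" "mob e' f' \<in> G0"
  using unimodular by (auto simp: G0_mob)

text \<open>Pulled back to the diameter, both products acquire the same positive factor, that of the
  parametrisations. Comparing \<open>\<beta>\<close> with \<open>\<alpha>\<close> thus compares
  positions after and before applying \<open>g\<close> and \<open>g'\<close>.\<close>

lemma pairing_less_iff:
  assumes "cmod x \<le> 1" "cmod y \<le> 1"
  shows "pairing (mob a b) (mob a' b') x y < pairing (mob e f) (mob e' f') x y
    \<longleftrightarrow> minkowski (mob a b x) (mob a' b' y) < pairing g g' (mob a b x) (mob a' b' y)"
  unfolding gk gk' pairing_gmul[OF g g' maps_in_G0(1,2) assms] unfolding pairing_def[of "mob a b"]
  using conf_factor_pos[OF maps_in_G0(1) assms(1)] conf_factor_pos[OF maps_in_G0(2) assms(2)] by simp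

lemma pairing_closed_diam:
  assumes "x \<in> closed_diam" "y \<in> closed_diam"
  shows "pairing (mob a b) (mob a' b') x y = (1 + Re x)\<^sup>2 / 2 * ((1 + Re y)\<^sup>2 / 2) * (2 * (\<alpha> 1 1)\<^sup>2)
      + (1 + Re x)\<^sup>2 / 2 * ((1 - Re y)\<^sup>2 / 2) * (2 * (\<alpha> 1 \<i>)\<^sup>2) + (1 - Re x)\<^sup>2 / 2 * ((1 + Re y)\<^sup>2 / 2) * (2 * (\<alpha> \<i> 1)\<^sup>2)
      + (1 - Re x)\<^sup>2 / 2 * ((1 - Re y)\<^sup>2 / 2) * (2 * (\<alpha> \<i> \<i>)\<^sup>2)"
    and "pairing (mob e f) (mob e' f') x y = (1 + Re x)\<^sup>2 / 2 * ((1 + Re y)\<^sup>2 / 2) * (2 * (\<beta> 1 1)\<^sup>2)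
      + (1 + Re x)\<^sup>2 / 2 * ((1 - Re y)\<^sup>2 / 2) * (2 * (\<beta> 1 \<i>)\<^sup>2) + (1 - Re x)\<^sup>2 / 2 * ((1 + Re y)\<^sup>2 / 2) * (2 * (\<beta> \<i> 1)\<^sup>2)
      + (1 - Re x)\<^sup>2 / 2 * ((1 - Re y)\<^sup>2 / 2) * (2 * (\<beta> \<i> \<i>)\<^sup>2)"
proof -
  have xy: "cmod x \<le> 1" "Im x = 0" "cmod y \<le> 1" "Im y = 0" using assms by (auto simp: closed_diam_alt)
  note t = tensor_closed_diam[OF xy(2)] tensor_closed_diam[OF xy(4)]
  show "pairing (mob a b) (mob a' b') x y = (1 + Re x)\<^sup>2 / 2 * ((1 + Re y)\<^sup>2 / 2) * (2 * (\<alpha> 1 1)\<^sup>2)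
      + (1 + Re x)\<^sup>2 / 2 * ((1 - Re y)\<^sup>2 / 2) * (2 * (\<alpha> 1 \<i>)\<^sup>2) + (1 - Re x)\<^sup>2 / 2 * ((1 + Re y)\<^sup>2 / 2) * (2 * (\<alpha> \<i> 1)\<^sup>2)
      + (1 - Re x)\<^sup>2 / 2 * ((1 - Re y)\<^sup>2 / 2) * (2 * (\<alpha> \<i> \<i>)\<^sup>2)"
    unfolding \<alpha>_def by (rule pairing_spinor_map[OF unimodular(1,2) xy(1,3) t])
  show "pairing (mob e f) (mob e' f') x y = (1 + Re x)\<^sup>2 / 2 * ((1 + Re y)\<^sup>2 / 2) * (2 * (\<beta> 1 1)\<^sup>2)
      + (1 + Re x)\<^sup>2 / 2 * ((1 - Re y)\<^sup>2 / 2) * (2 * (\<beta> 1 \<i>)\<^sup>2) + (1 - Re x)\<^sup>2 / 2 * ((1 + Re y)\<^sup>2 / 2) * (2 * (\<beta> \<i> 1)\<^sup>2)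
      + (1 - Re x)\<^sup>2 / 2 * ((1 - Re y)\<^sup>2 / 2) * (2 * (\<beta> \<i> \<i>)\<^sup>2)"
    unfolding \<beta>_def by (rule pairing_spinor_map[OF unimodular(3,4) xy(1,3) t])
qed

text \<open>At an end of the diameter one weight is 2 and the other 0, whence the factor
  \<open>2 * 2 * 2\<close>.\<close>

lemma pairing_corner:
  assumes "z \<in> {1, \<i>}" "w \<in> {1, \<i>}"
  shows "pairing (mob a b) (mob a' b') (ideal_pt z) (ideal_pt w) = 8 * (\<alpha> z w)\<^sup>2"
    "pairing (mob e f) (mob e' f') (ideal_pt z) (ideal_pt w) = 8 * (\<beta> z w)\<^sup>2"
proof -
  have 1: "1 \<in> closed_diam" "-1 \<in> closed_diam" by (auto simp: closed_diam_alt)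
  have 2: "ideal_pt 1 = 1" "ideal_pt \<i> = -1" by (simp_all add: ideal_pt_def)
  show "pairing (mob a b) (mob a' b') (ideal_pt z) (ideal_pt w) = 8 * (\<alpha> z w)\<^sup>2"
    using assms by (elim insertE emptyE) (simp_all add: 2 pairing_closed_diam 1)
  show "pairing (mob e f) (mob e' f') (ideal_pt z) (ideal_pt w) = 8 * (\<beta> z w)\<^sup>2"
    using assms by (elim insertE emptyE) (simp_all add: 2 pairing_closed_diam 1)
qed

text \<open>Ties opposite corners together; it prevents too many determinants from vanishing at
  once.\<close>

lemma pluecker: "\<alpha> 1 1 * \<alpha> \<i> \<i> - \<alpha> 1 \<i> * \<alpha> \<i> 1 = 1" "\<beta> 1 1 * \<beta> \<i> \<i> - \<beta> 1 \<i> * \<beta> \<i> 1 = 1"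
  unfolding \<alpha>_def \<beta>_def det2_pluecker by (simp_all add: det2_spinor_map unimodular) (simp_all add: det2_def)

lemma closed_diam_weights:
  "(1 + r)\<^sup>2 / 2 \<ge> 0" "(1 - r)\<^sup>2 / 2 \<ge> 0" "(1 + r)\<^sup>2 / 2 + (1 - r)\<^sup>2 / 2 > 0" for r :: real
proof -
  have "(1 + r)\<^sup>2 / 2 + (1 - r)\<^sup>2 / 2 = 1 + r\<^sup>2" by (simp add: power2_eq_square field_simps)
  then show "(1 + r)\<^sup>2 / 2 + (1 - r)\<^sup>2 / 2 > 0" by (simp add: add_pos_nonneg)
qed simp_all

lemma dominated_pairing_less:
  assumes "dominated" "x \<in> closed_diam" "y \<in> closed_diam"
  shows "pairing (mob a b) (mob a' b') x y < pairing (mob e f) (mob e' f') x y"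
proof -
  have "2 * (\<alpha> z w)\<^sup>2 < 2 * (\<beta> z w)\<^sup>2" if "z \<in> {1, \<i>}" "w \<in> {1, \<i>}" for z w
  proof -
    have "\<bar>\<alpha> z w\<bar> < \<bar>\<beta> z w\<bar>" using assms(1) that unfolding dominated_def by blast
    then show ?thesis using power2_strict_mono by simp
  qed
  then show ?thesis unfolding pairing_closed_diam[OF assms(2,3)] by (intro weighted_less closed_diam_weights) auto
qed

section \<open>Uniform expansion along the lines: condition (2)\<close>

lemma dominated_scale:
  assumes "dominated"
  obtains m where "m > 1" "\<And>x y. x \<in> closed_diam \<Longrightarrow> y \<in> closed_diam \<Longrightarrow> m * pairing (mob a b) (mob a' b') x y \<le> pairing (mob e f) (mob e' f') x y"
proof -
  \<comment> \<open>Stated for every \<open>n\<close> up to \<open>m\<close>, so that the least of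
    the four constants serves all corners. For \<open>q = 0\<close> any bound will do, and 2 is
    taken.\<close>
  have ex: "\<exists>m > 1. \<forall>n \<le> m. n * (2 * q\<^sup>2) \<le> 2 * p\<^sup>2" if lt: "\<bar>q\<bar> < \<bar>p\<bar>" for p q :: real
  proof (cases "q = 0")
    case True
    then show ?thesis by (intro exI[of _ 2]) simp
  next
    case False
    have "q\<^sup>2 < p\<^sup>2" using lt by (rule power2_strict_mono)
    then have "p\<^sup>2 / q\<^sup>2 > 1" using False by simp
    moreover have "n * (2 * q\<^sup>2) \<le> 2 * p\<^sup>2" if "n \<le> p\<^sup>2 / q\<^sup>2" for n
      using that False by (simp add: pos_le_divide_eq)
    ultimately show ?thesis by blast
  qed
  have d: "\<bar>\<alpha> 1 1\<bar> < \<bar>\<beta> 1 1\<bar>" "\<bar>\<alpha> 1 \<i>\<bar> < \<bar>\<beta> 1 \<i>\<bar>" "\<bar>\<alpha> \<i> 1\<bar> < \<bar>\<beta> \<i> 1\<bar>" "\<bar>\<alpha> \<i> \<i>\<bar> < \<bar>\<beta> \<i> \<i>\<bar>"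
    using assms by (auto simp: dominated_def)
  obtain m1 m2 m3 m4 where m: "m1 > 1" "\<forall>n \<le> m1. n * (2 * (\<alpha> 1 1)\<^sup>2) \<le> 2 * (\<beta> 1 1)\<^sup>2"
    "m2 > 1" "\<forall>n \<le> m2. n * (2 * (\<alpha> 1 \<i>)\<^sup>2) \<le> 2 * (\<beta> 1 \<i>)\<^sup>2"
    "m3 > 1" "\<forall>n \<le> m3. n * (2 * (\<alpha> \<i> 1)\<^sup>2) \<le> 2 * (\<beta> \<i> 1)\<^sup>2"
    "m4 > 1" "\<forall>n \<le> m4. n * (2 * (\<alpha> \<i> \<i>)\<^sup>2) \<le> 2 * (\<beta> \<i> \<i>)\<^sup>2"
    using ex[OF d(1)] ex[OF d(2)] ex[OF d(3)] ex[OF d(4)] by blast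
  define n where "n = min (min m1 m2) (min m3 m4)"
  have n: "n > 1" "n \<le> m1" "n \<le> m2" "n \<le> m3" "n \<le> m4" using m by (auto simp: n_def)
  show thesis
  proof (rule that[OF n(1)])
    fix x y assume "x \<in> closed_diam" "y \<in> closed_diam"
    then show "n * pairing (mob a b) (mob a' b') x y \<le> pairing (mob e f) (mob e' f') x y"
      unfolding pairing_closed_diam[OF \<open>x \<in> closed_diam\<close> \<open>y \<in> closed_diam\<close>] by (intro weighted_le closed_diam_weights) (use m n in blast)+
  qed
qed

text \<open>The free factors cover a scaled inequality and, with \<open>M = N = -1\<close>, the
  reverse one.\<close>

lemma pairing_le_closure:
  assumes "\<And>x y. x \<in> open_diam \<Longrightarrow> y \<in> open_diam \<Longrightarrow> M * pairing (mob a b) (mob a' b') x y \<le> N * pairing (mob e f) (mob e' f') x y"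
    and "x \<in> closed_diam" "y \<in> closed_diam"
  shows "M * pairing (mob a b) (mob a' b') x y \<le> N * pairing (mob e f) (mob e' f') x y"
proof -
  have cl: "closure (open_diam \<times> open_diam) = closed_diam \<times> closed_diam" by (simp add: closure_Times closure_open_diam)
  have sub: "closed_diam \<times> closed_diam \<subseteq> cball 0 1 \<times> cball 0 1" using closed_diam_sub by blast
  note c = continuous_on_subset[OF pairing_continuous[OF maps_in_G0(1,2)] sub] continuous_on_subset[OF pairing_continuous[OF maps_in_G0(3,4)] sub]
  have "continuous_on (closed_diam \<times> closed_diam) (\<lambda>z. N * (case z of (x, y) \<Rightarrow> pairing (mob e f) (mob e' f') x y) -
      M * (case z of (x, y) \<Rightarrow> pairing (mob a b) (mob a' b') x y))"
    by (intro continuous_intros c)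
  from continuous_ge_on_closure[OF this[folded cl], of "(x, y)" 0] assms(2,3)
  show ?thesis using assms(1) by (force simp: cl)
qed

text \<open>The constant is \<open>ln m\<close>: a uniform ratio of pairings is a uniform ratio of
  hyperbolic cosines, and \<open>cosh_add_ln_le\<close> converts it.\<close>

lemma dominated_imp_expanding:
  assumes "dominated"
  shows "\<exists>K > 0. \<forall>x \<in> mob a b ` open_diam. \<forall>x' \<in> mob a' b' ` open_diam. hdist (g x) (g' x') - hdist x x' \<ge> K"
proof -
  obtain m where m: "m > 1" "\<And>x y. x \<in> closed_diam \<Longrightarrow> y \<in> closed_diam \<Longrightarrow> m * pairing (mob a b) (mob a' b') x y \<le> pairing (mob e f) (mob e' f') x y"
    using dominated_scale[OF assms] by blast
  have "hdist (g (mob a b x)) (g' (mob a' b' y)) - hdist (mob a b x) (mob a' b' y) \<ge> ln m"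
    if xy: "x \<in> open_diam" "y \<in> open_diam" for x y
  proof -
    have x1: "cmod x < 1" "cmod y < 1" using xy open_diam_sub by auto
    have xl: "cmod x \<le> 1" "cmod y \<le> 1" using x1 by auto
    have s: "x \<in> closed_diam" "y \<in> closed_diam" using xy by (auto simp: closed_diam_alt open_diam_alt)
    have c0: "conf_factor (mob a b) x * conf_factor (mob a' b') y > 0" using conf_factor_pos[OF maps_in_G0(1) xl(1)] conf_factor_pos[OF maps_in_G0(2) xl(2)] by simp
    define p q where "p = mob a b x" and "q = mob a' b' y"
    have p1: "cmod p < 1" "cmod q < 1" unfolding p_def q_def using G0_norm_less maps_in_G0 x1 by blast+
    have "(conf_factor (mob a b) x * conf_factor (mob a' b') y) * (m * minkowski p q) \<le> (conf_factor (mob a b) x * conf_factor (mob a' b') y) * pairing g g' p q"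
      using m(2)[OF s] unfolding gk gk' pairing_gmul[OF g g' maps_in_G0(1,2) xl] p_def[symmetric] q_def[symmetric]
      unfolding pairing_def[of "mob a b"] p_def[symmetric] q_def[symmetric] by (simp only: mult_ac)
    then have le: "m * minkowski p q \<le> pairing g g' p q" using c0 by (rule mult_left_le_imp_le)
    have "0 < (1 - (cmod p)\<^sup>2) * (1 - (cmod q)\<^sup>2)" using p1 by (simp add: abs_square_less_1)
    then have "m * cosh (hdist p q) \<le> cosh (hdist (g p) (g' q))"
      unfolding cosh_hdist_pairing[OF g g' p1] cosh_hdist(1)[OF p1] using divide_right_mono[OF le] by simp
    then have "cosh (hdist p q + ln m) \<le> cosh (hdist (g p) (g' q))"
      using cosh_add_ln_le[of m "hdist p q"] m(1) by simp
    moreover have "hdist p q + ln m \<ge> 0" "hdist (g p) (g' q) \<ge> 0"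
      using cosh_hdist(2)[OF p1] cosh_hdist(2) G0_norm_less g g' p1 m(1) by (simp_all add: add_nonneg_nonneg)
    ultimately show ?thesis unfolding p_def q_def by (simp add: cosh_real_nonneg_le_iff)
  qed
  moreover have "ln m > 0" using m by simp
  ultimately show ?thesis by blast
qed

text \<open>With \<open>M = cosh K\<close>, \<open>cosh (d + K) >= cosh d * cosh K\<close> gives a
  uniform ratio of pairings, which continuity carries to the corners. There
  \<open>M * \<alpha>^2 <= \<beta>^2\<close> is strict domination unless both numbers
  vanish.\<close>

lemma expanding_imp_dominated:
  assumes K: "K > 0" "\<forall>x \<in> mob a b ` open_diam. \<forall>x' \<in> mob a' b' ` open_diam. hdist (g x) (g' x') - hdist x x' \<ge> K"
  shows "dominated"
proof -
  define M where "M = cosh K"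
  have M: "M > 1" using K(1) cosh_real_strict_mono[of 0 K] by (simp add: M_def)
  have step: "M * pairing (mob a b) (mob a' b') x y \<le> 1 * pairing (mob e f) (mob e' f') x y"
    if xy: "x \<in> open_diam" "y \<in> open_diam" for x y
  proof -
    have x1: "cmod x < 1" "cmod y < 1" using xy open_diam_sub by auto
    have xl: "cmod x \<le> 1" "cmod y \<le> 1" using x1 by auto
    have c0: "conf_factor (mob a b) x * conf_factor (mob a' b') y > 0" using conf_factor_pos[OF maps_in_G0(1) xl(1)] conf_factor_pos[OF maps_in_G0(2) xl(2)] by simp
    define p q where "p = mob a b x" and "q = mob a' b' y"
    have p1: "cmod p < 1" "cmod q < 1" unfolding p_def q_def using G0_norm_less maps_in_G0 x1 by blast+
    have "hdist (g p) (g' q) \<ge> hdist p q + K" using K(2) xy by (auto simp: p_def q_def algebra_simps)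
    then have "cosh (hdist p q + K) \<le> cosh (hdist (g p) (g' q))"
      using K(1) cosh_hdist(2)[OF p1] by (subst cosh_real_nonneg_le_iff) auto
    moreover have "cosh (hdist p q) * M \<le> cosh (hdist p q + K)"
      using K(1) cosh_hdist(2)[OF p1] by (simp add: cosh_add M_def)
    ultimately have le: "M * cosh (hdist p q) \<le> cosh (hdist (g p) (g' q))" by (simp add: mult.commute)
    have "0 < (1 - (cmod p)\<^sup>2) * (1 - (cmod q)\<^sup>2)" using p1 by (simp add: abs_square_less_1)
    then have "M * minkowski p q \<le> pairing g g' p q"
      using le unfolding cosh_hdist_pairing[OF g g' p1] cosh_hdist(1)[OF p1] by (simp add: divide_le_cancel)
    then have "(conf_factor (mob a b) x * conf_factor (mob a' b') y) * (M * minkowski p q) \<le> (conf_factor (mob a b) x * conf_factor (mob a' b') y) * pairing g g' p q"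
      by (rule mult_left_mono) (use c0 in simp)
    then show ?thesis unfolding gk gk' pairing_gmul[OF g g' maps_in_G0(1,2) xl] p_def[symmetric] q_def[symmetric]
      unfolding pairing_def[of "mob a b"] p_def[symmetric] q_def[symmetric] by (simp only: mult_ac mult_1)
  qed
  have all: "M * pairing (mob a b) (mob a' b') x y \<le> 1 * pairing (mob e f) (mob e' f') x y" if "x \<in> closed_diam" "y \<in> closed_diam" for x y
    by (rule pairing_le_closure[OF _ that]) (rule step)
  have sq: "M * (\<alpha> z w)\<^sup>2 \<le> (\<beta> z w)\<^sup>2" if zw: "z \<in> {1, \<i>}" "w \<in> {1, \<i>}" for z w
  proof -
    have "ideal_pt z \<in> closed_diam" "ideal_pt w \<in> closed_diam" using zw by (auto simp: ideal_pt_def closed_diam_alt)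
    from all[OF this] show ?thesis unfolding pairing_corner[OF zw] by simp
  qed
  \<comment> \<open>If both vanish at a corner, \<open>pluecker\<close> gives the products on the
    other diagonal the same value 1 or -1, against growth by \<open>M > 1\<close>.\<close>
  have nz: "\<beta> z w \<noteq> 0" if zw: "z \<in> {1, \<i>}" "w \<in> {1, \<i>}" for z w
  proof
    assume b0: "\<beta> z w = 0"
    then have "M * (\<alpha> z w)\<^sup>2 \<le> 0" using sq[OF zw] by simp
    then have a0: "\<alpha> z w = 0" using M by (simp add: mult_le_0_iff)
    consider "\<beta> 1 1 * \<beta> \<i> \<i> = 0" "\<alpha> 1 1 * \<alpha> \<i> \<i> = 0" | "\<beta> 1 \<i> * \<beta> \<i> 1 = 0" "\<alpha> 1 \<i> * \<alpha> \<i> 1 = 0"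
      using zw a0 b0 by fastforce
    then show False
    proof cases
      case 1
      then have "\<alpha> 1 \<i> * \<alpha> \<i> 1 = -1" "\<beta> 1 \<i> * \<beta> \<i> 1 = -1" using pluecker by linarith+
      then show False using no_scaled_pair[OF M sq sq, of 1 \<i> \<i> 1] by simp
    next
      case 2
      then have "\<alpha> 1 1 * \<alpha> \<i> \<i> = 1" "\<beta> 1 1 * \<beta> \<i> \<i> = 1" using pluecker by linarith+
      then show False using no_scaled_pair[OF M sq sq, of 1 1 \<i> \<i>] by simp
    qed
  qed
  show ?thesis unfolding dominated_def
  proof (intro ballI)
    fix z w assume zw: "z \<in> {1, \<i>}" "w \<in> {1, \<i>}"
    have "(\<alpha> z w)\<^sup>2 < (\<beta> z w)\<^sup>2"
    proof (cases "\<alpha> z w = 0")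
      case True
      then show ?thesis using nz[OF zw] by simp
    next
      case False
      then have "1 * (\<alpha> z w)\<^sup>2 < M * (\<alpha> z w)\<^sup>2" using M by (intro mult_strict_right_mono) auto
      then show ?thesis using sq[OF zw] by simp
    qed
    then show "\<bar>\<alpha> z w\<bar> < \<bar>\<beta> z w\<bar>" by (metis abs_ge_zero power2_abs power2_less_imp_less)
  qed
qed

section \<open>The endpoint inequalities: condition (3)\<close>

lemma ideal_pt_corners: "ideal_pt 1 = 1" "ideal_pt \<i> = -1" by (simp_all add: ideal_pt_def)

lemma corner_dominated_iff:
  assumes zw: "z \<in> {1, \<i>}" "w \<in> {1, \<i>}"
  shows "\<bar>\<alpha> z w\<bar> < \<bar>\<beta> z w\<bar> \<longleftrightarrow>
    minkowski (mob a b (ideal_pt z)) (mob a' b' (ideal_pt w)) < pairing g g' (mob a b (ideal_pt z)) (mob a' b' (ideal_pt w))"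
proof -
  have "cmod (ideal_pt z) \<le> 1" "cmod (ideal_pt w) \<le> 1" using zw by (auto simp: ideal_pt_def)
  note i = pairing_less_iff[OF this]
  have "\<bar>\<alpha> z w\<bar> < \<bar>\<beta> z w\<bar> \<longleftrightarrow> 8 * (\<alpha> z w)\<^sup>2 < 8 * (\<beta> z w)\<^sup>2"
    using power2_strict_mono[of "\<alpha> z w" "\<beta> z w"] power2_less_imp_less[of "\<bar>\<alpha> z w\<bar>" "\<bar>\<beta> z w\<bar>"] by auto
  then show ?thesis unfolding i[symmetric] pairing_corner[OF zw] .
qed

lemma dominated_iff_F_ideal:
  "dominated \<longleftrightarrow> (\<forall>\<xi> \<in> endpoints (mob a b ` open_diam). \<forall>\<xi>' \<in> endpoints (mob a' b' ` open_diam).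
     g \<xi> \<noteq> g' \<xi>' \<and> F_ideal g g' \<xi> \<xi>' > 0)"
proof -
  have F: "g \<xi> \<noteq> g' \<xi>' \<and> F_ideal g g' \<xi> \<xi>' > 0 \<longleftrightarrow> pairing g g' \<xi> \<xi>' > minkowski \<xi> \<xi>'"
    if "\<xi> \<in> {mob a b 1, mob a b (-1)}" "\<xi>' \<in> {mob a' b' 1, mob a' b' (-1)}" for \<xi> \<xi>'
  proof -
    have n: "cmod (mob a b 1) = 1" "cmod (mob a b (-1)) = 1" "cmod (mob a' b' 1) = 1" "cmod (mob a' b' (-1)) = 1"
      using G0_norm_eq_1[OF maps_in_G0(1)] G0_norm_eq_1[OF maps_in_G0(2)] by simp_all
    show ?thesis by (rule F_ideal_pos_iff[OF g g']) (use that n in auto)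
  qed
  show ?thesis unfolding endpoints_line[OF maps_in_G0(1)] endpoints_line[OF maps_in_G0(2)]
    using F corner_dominated_iff unfolding dominated_def by (simp add: ideal_pt_corners)
qed

section \<open>Disjoint crooked planes: condition (1)\<close>

lemma line_sub: "mob a b ` closed_diam \<subseteq> cball 0 1" "mob a' b' ` closed_diam \<subseteq> cball 0 1"
  "mob a b ` open_diam \<subseteq> ball 0 1" "mob a' b' ` open_diam \<subseteq> ball 0 1"
  "mob a b ` open_diam \<subseteq> mob a b ` closed_diam" "mob a' b' ` open_diam \<subseteq> mob a' b' ` closed_diam"
proof -
  show "mob a b ` closed_diam \<subseteq> cball 0 1" "mob a' b' ` closed_diam \<subseteq> cball 0 1"
    using G0_norm_le[OF maps_in_G0(1)] G0_norm_le[OF maps_in_G0(2)] closed_diam_sub by auto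
  show "mob a b ` open_diam \<subseteq> ball 0 1" "mob a' b' ` open_diam \<subseteq> ball 0 1"
    using G0_norm_less[OF maps_in_G0(1)] G0_norm_less[OF maps_in_G0(2)] open_diam_sub by auto
  have "open_diam \<subseteq> closed_diam" by (auto simp: closed_diam_alt open_diam_alt)
  then show "mob a b ` open_diam \<subseteq> mob a b ` closed_diam" "mob a' b' ` open_diam \<subseteq> mob a' b' ` closed_diam" by auto
qed

lemma line_connected: "connected (mob a b ` open_diam)" "connected (mob a' b' ` open_diam)"
proof -
  have "connected open_diam" unfolding open_diam_def
    by (intro connected_continuous_image continuous_intros connected_Ioo)
  moreover have "open_diam \<subseteq> cball 0 1" by (auto simp: open_diam_alt)
  ultimately show "connected (mob a b ` open_diam)" "connected (mob a' b' ` open_diam)"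
    by (meson connected_continuous_image continuous_on_subset G0_continuous maps_in_G0)+
qed

lemma dominated_pairing_line:
  assumes "dominated" "p \<in> mob a b ` closed_diam" "p' \<in> mob a' b' ` closed_diam"
  shows "minkowski p p' < pairing g g' p p'"
proof -
  obtain x y where xy: "p = mob a b x" "x \<in> closed_diam" "p' = mob a' b' y" "y \<in> closed_diam" using assms(2,3) by blast
  then have "cmod x \<le> 1" "cmod y \<le> 1" by (auto simp: closed_diam_alt)
  then show ?thesis using pairing_less_iff dominated_pairing_less[OF assms(1) xy(2,4)] xy(1,3) by blast
qed

lemma dominated_disjoint:
  assumes "dominated" shows "gmul g ` crooked (mob a b ` closed_diam) \<inter> gmul g' ` crooked (mob a' b' ` closed_diam) = {}"
  by (rule crooked_disjoint[OF g g' line_sub(1,2) dominated_pairing_line[OF assms]])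

lemma corner_meet:
  assumes zw: "z \<in> {1, \<i>}" "w \<in> {1, \<i>}"
    and h: "unimodular h1 h2" "spinor_map h1 h2 (spinor_map a b z) = of_real \<kappa> * spinor_map e f z" "\<bar>\<kappa>\<bar> \<ge> 1"
      "spinor_map h1 h2 (spinor_map a' b' w) = of_real \<kappa>' * spinor_map e' f' w" "\<bar>\<kappa>'\<bar> \<ge> 1"
  shows "gmul g ` crooked (mob a b ` closed_diam) \<inter> gmul g' ` crooked (mob a' b' ` closed_diam) \<noteq> {}"
proof -
  have z0: "z \<noteq> 0" "w \<noteq> 0" using zw by auto
  have s: "ideal_pt z \<in> closed_diam" "ideal_pt w \<in> closed_diam" using zw by (auto simp: ideal_pt_def closed_diam_alt)
  have "mob h1 h2 \<in> G0" using h by (auto simp: G0_mob)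
  then show ?thesis
    using crooked_meet[OF g g' line_sub(1,2) _ imageI[OF s(1)] spinor_map_lift[OF unimodular(1,3) g gk z0(1) h(1-3)]
      imageI[OF s(2)] spinor_map_lift[OF unimodular(2,4) g' gk' z0(2) h(1,4,5)]] by blast
qed

text \<open>At a failing corner with \<open>\<alpha> = 0\<close> or \<open>\<beta>\<close> nonzero,
  an \<open>h\<close> can be built that sends both endpoint spinors to multiples of their targets by
  factors of absolute value at least 1. A failing corner with \<open>\<beta> = 0\<close> and
  \<open>\<alpha>\<close> nonzero admits no such \<open>h\<close>; but distances shrink near it and
  grow near a corner with \<open>\<beta>\<close> nonzero, so \<open>crossing\<close>
  applies.\<close>

lemma not_dominated_meet:
  assumes "\<not> dominated"
  shows "gmul g ` crooked (mob a b ` closed_diam) \<inter> gmul g' ` crooked (mob a' b' ` closed_diam) \<noteq> {}"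
proof (cases "\<exists>z \<in> {1, \<i>}. \<exists>w \<in> {1, \<i>}. \<bar>\<beta> z w\<bar> \<le> \<bar>\<alpha> z w\<bar> \<and> (\<alpha> z w = 0 \<or> \<beta> z w \<noteq> 0)")
  case True
  then obtain z w where zw: "z \<in> {1, \<i>}" "w \<in> {1, \<i>}" "\<bar>\<beta> z w\<bar> \<le> \<bar>\<alpha> z w\<bar>" "\<alpha> z w = 0 \<or> \<beta> z w \<noteq> 0" by blast
  have z0: "z \<noteq> 0" "w \<noteq> 0" using zw by auto
  note nz = spinor_map_nz[OF unimodular(1) z0(1)] spinor_map_nz[OF unimodular(2) z0(2)] spinor_map_nz[OF unimodular(3) z0(1)] spinor_map_nz[OF unimodular(4) z0(2)]
  show ?thesis
  proof (cases "\<alpha> z w = 0")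
    case a0: True
    then have b0: "\<beta> z w = 0" using zw by simp
    obtain \<mu> where \<mu>: "\<mu> \<noteq> 0" "spinor_map a' b' w = of_real \<mu> * spinor_map a b z"
      using parallel_spinor_map[OF a0[unfolded \<alpha>_def] nz(1,2)] .
    obtain \<nu> where \<nu>: "\<nu> \<noteq> 0" "spinor_map e' f' w = of_real \<nu> * spinor_map e f z"
      using parallel_spinor_map[OF b0[unfolded \<beta>_def] nz(3,4)] .
    \<comment> \<open>Parallel spinors leave one free scale. The map \<open>h\<close> multiplies the
      first target by \<open>\<kappa>\<close> and the second by
      \<open>\<mu> * \<kappa> / \<nu>\<close>, and both factors must reach absolute value 1.\<close>
    define \<kappa> where "\<kappa> = max 1 \<bar>\<nu> / \<mu>\<bar>"
    have k: "\<kappa> \<ge> 1" "\<kappa> \<ge> \<bar>\<nu> / \<mu>\<bar>" by (simp_all add: \<kappa>_def)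
    have "of_real \<kappa> * spinor_map e f z \<noteq> 0" using nz(3) k by simp
    then obtain h1 h2 where h: "unimodular h1 h2" "spinor_map h1 h2 (spinor_map a b z) = of_real \<kappa> * spinor_map e f z"
      using spinor_map_exists_single[OF nz(1)] by blast
    have "spinor_map h1 h2 (spinor_map a' b' w) = of_real \<mu> * spinor_map h1 h2 (spinor_map a b z)"
      unfolding \<mu>(2) by (simp add: spinor_map_def algebra_simps)
    also have "\<dots> = of_real (\<mu> * \<kappa> / \<nu>) * spinor_map e' f' w" unfolding h(2) \<nu>(2) using \<nu>(1) by simp
    finally have h3: "spinor_map h1 h2 (spinor_map a' b' w) = of_real (\<mu> * \<kappa> / \<nu>) * spinor_map e' f' w" .
    have "\<bar>\<nu>\<bar> \<le> \<bar>\<mu>\<bar> * \<kappa>" using k(2) \<mu>(1) by (simp add: abs_divide divide_le_eq mult.commute)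
    then have h4: "\<bar>\<mu> * \<kappa> / \<nu>\<bar> \<ge> 1" using \<nu>(1) k(1) by (simp add: abs_divide abs_mult le_divide_eq)
    have "\<bar>\<kappa>\<bar> \<ge> 1" using k(1) by simp
    from corner_meet[OF zw(1,2) h this h3 h4] show ?thesis .
  next
    case a0: False
    then have b0: "\<beta> z w \<noteq> 0" using zw by simp
    \<comment> \<open>With the first spinor sent exactly to its target, preservation of the
      determinant forces this factor on the second.\<close>
    define \<kappa> where "\<kappa> = \<alpha> z w / \<beta> z w"
    have k: "\<bar>\<kappa>\<bar> \<ge> 1" using zw(3) b0 by (simp add: \<kappa>_def abs_divide le_divide_eq)
    have "det2 (spinor_map e f z) (of_real \<kappa> * spinor_map e' f' w) = \<kappa> * \<beta> z w" by (simp add: \<beta>_def det2_def algebra_simps)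
    then have d: "det2 (spinor_map a b z) (spinor_map a' b' w) = det2 (spinor_map e f z) (of_real \<kappa> * spinor_map e' f' w)"
      using b0 by (simp add: \<kappa>_def \<alpha>_def)
    obtain h1 h2 where h: "unimodular h1 h2" "spinor_map h1 h2 (spinor_map a b z) = spinor_map e f z"
      "spinor_map h1 h2 (spinor_map a' b' w) = of_real \<kappa> * spinor_map e' f' w"
      using spinor_map_exists[OF d a0[unfolded \<alpha>_def]] by blast
    show ?thesis by (rule corner_meet[OF zw(1,2) h(1) _ _ h(3) k, of 1]) (simp_all add: h(2))
  qed
next
  case False
  then have c: "\<bar>\<alpha> z w\<bar> < \<bar>\<beta> z w\<bar> \<or> \<beta> z w = 0 \<and> \<alpha> z w \<noteq> 0" if "z \<in> {1, \<i>}" "w \<in> {1, \<i>}" for z w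
    using that by (meson not_less)
  obtain z w where zw: "z \<in> {1, \<i>}" "w \<in> {1, \<i>}" "\<not> \<bar>\<alpha> z w\<bar> < \<bar>\<beta> z w\<bar>"
    using assms unfolding dominated_def by blast
  then have neg: "\<beta> z w = 0" "\<alpha> z w \<noteq> 0" using c by blast+
  have "\<exists>u \<in> {1, \<i>}. \<exists>v \<in> {1, \<i>}. \<beta> u v \<noteq> 0"
  proof (rule ccontr)
    assume "\<not> ?thesis"
    then have "\<beta> 1 1 = 0" "\<beta> 1 \<i> = 0" by auto
    then show False using pluecker(2) by simp
  qed
  then obtain u v where uv: "u \<in> {1, \<i>}" "v \<in> {1, \<i>}" "\<beta> u v \<noteq> 0" by blast
  then have pos: "\<bar>\<alpha> u v\<bar> < \<bar>\<beta> u v\<bar>" using c by blast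
  have closed_diam: "ideal_pt z \<in> closed_diam" "ideal_pt w \<in> closed_diam" "ideal_pt u \<in> closed_diam" "ideal_pt v \<in> closed_diam" using zw uv by (auto simp: ideal_pt_def closed_diam_alt)
  have "\<exists>x \<in> open_diam. \<exists>y \<in> open_diam. pairing (mob e f) (mob e' f') x y < pairing (mob a b) (mob a' b') x y"
  proof (rule ccontr)
    assume "\<not> ?thesis"
    then have "1 * pairing (mob a b) (mob a' b') x y \<le> 1 * pairing (mob e f) (mob e' f') x y" if "x \<in> open_diam" "y \<in> open_diam" for x y
      using that by (force simp: not_less)
    then have "1 * pairing (mob a b) (mob a' b') (ideal_pt z) (ideal_pt w) \<le> 1 * pairing (mob e f) (mob e' f') (ideal_pt z) (ideal_pt w)"
      by (rule pairing_le_closure[OF _ closed_diam(1,2)])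
    then show False using neg unfolding pairing_corner[OF zw(1,2)] by simp
  qed
  then obtain x y where xy: "x \<in> open_diam" "y \<in> open_diam" "pairing (mob e f) (mob e' f') x y < pairing (mob a b) (mob a' b') x y" by blast
  have "\<exists>x \<in> open_diam. \<exists>y \<in> open_diam. pairing (mob a b) (mob a' b') x y < pairing (mob e f) (mob e' f') x y"
  proof (rule ccontr)
    assume "\<not> ?thesis"
    then have "(-1) * pairing (mob a b) (mob a' b') x y \<le> (-1) * pairing (mob e f) (mob e' f') x y" if "x \<in> open_diam" "y \<in> open_diam" for x y
      using that by (force simp: not_less)
    then have "(-1) * pairing (mob a b) (mob a' b') (ideal_pt u) (ideal_pt v) \<le> (-1) * pairing (mob e f) (mob e' f') (ideal_pt u) (ideal_pt v)"
      by (rule pairing_le_closure[OF _ closed_diam(3,4)])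
    then have "(\<beta> u v)\<^sup>2 \<le> (\<alpha> u v)\<^sup>2" unfolding pairing_corner[OF uv(1,2)] by simp
    then show False using power2_strict_mono[OF pos] by simp
  qed
  then obtain x' y' where xy': "x' \<in> open_diam" "y' \<in> open_diam" "pairing (mob a b) (mob a' b') x' y' < pairing (mob e f) (mob e' f') x' y'" by blast
  have n: "cmod x \<le> 1" "cmod y \<le> 1" "cmod x' \<le> 1" "cmod y' \<le> 1" using xy xy' by (auto simp: open_diam_alt)
  have 1: "pairing g g' (mob a b x) (mob a' b' y) \<le> minkowski (mob a b x) (mob a' b' y)"
    using pairing_less_iff[OF n(1,2)] xy(3) by (meson not_less less_asym)
  have 2: "minkowski (mob a b x') (mob a' b' y') \<le> pairing g g' (mob a b x') (mob a' b' y')"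
    using pairing_less_iff[OF n(3,4)] xy'(3) by (meson less_imp_le)
  show ?thesis
    by (rule crossing[OF g g' line_connected(1) line_sub(3) line_connected(2) line_sub(4)
      imageI[OF xy(1)] imageI[OF xy(2)] 1 imageI[OF xy'(1)] imageI[OF xy'(2)] 2 line_sub(5,1,6,2)])
qed

lemma dominated_closures_disjoint:
  assumes "dominated" shows "mob e f ` closed_diam \<inter> mob e' f' ` closed_diam = {}"
proof (rule ccontr)
  assume "\<not> ?thesis"
  then obtain x y where xy: "x \<in> closed_diam" "y \<in> closed_diam" "mob e f x = mob e' f' y" by force
  have n: "cmod x \<le> 1" "cmod y \<le> 1" using xy by (auto simp: closed_diam_alt)
  have m: "cmod (mob a b x) \<le> 1" "cmod (mob a' b' y) \<le> 1" using G0_norm_le maps_in_G0 n by blast+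
  have "g (mob a b x) = g' (mob a' b' y)" using xy(3) n by (simp add: gk gk' gmul_apply)
  then have "pairing g g' (mob a b x) (mob a' b' y) \<le> minkowski (mob a b x) (mob a' b' y)" by (rule pairing_meet[OF g g' m])
  then show False using dominated_pairing_line[OF assms imageI[OF xy(1)] imageI[OF xy(2)]] by simp
qed

section \<open>Half-spaces and orientation\<close>

lemma half_space_disjoint:
  assumes dom: "dominated" and away: "mob e' f' ` closed_diam \<inter> mob e f ` upper_side = {}" "mob e f ` closed_diam \<inter> mob e' f' ` upper_side = {}"
  shows "gmul g ` crooked (mob a b ` (upper_side \<union> closed_diam)) \<inter> gmul g' ` crooked (mob a' b' ` (upper_side \<union> closed_diam)) = {}"
proof -
  have s: "ideal_pt z \<in> closed_diam" "z \<noteq> 0" if "z \<in> {1, \<i>}" for z using that by (auto simp: ideal_pt_def closed_diam_alt)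
  have r1: "\<beta> 1 w * \<beta> \<i> w \<ge> 0" if "w \<in> {1, \<i>}" for w
    unfolding \<beta>_def by (rule sides_sign[OF unimodular(3,4) s(2)[OF that]]) (use away(1) s(1)[OF that] in blast)
  have r2: "\<beta> z 1 * \<beta> z \<i> \<ge> 0" if "z \<in> {1, \<i>}" for z
  proof -
    have "det2 (spinor_map e' f' 1) (spinor_map e f z) * det2 (spinor_map e' f' \<i>) (spinor_map e f z) \<ge> 0"
      by (rule sides_sign[OF unimodular(4,3) s(2)[OF that]]) (use away(2) s(1)[OF that] in blast)
    then show ?thesis unfolding \<beta>_def by (subst (1 2) det2_antisym) simp
  qed
  have d: "\<bar>\<alpha> 1 1\<bar> < \<bar>\<beta> 1 1\<bar>" "\<bar>\<alpha> 1 \<i>\<bar> < \<bar>\<beta> 1 \<i>\<bar>" "\<bar>\<alpha> \<i> 1\<bar> < \<bar>\<beta> \<i> 1\<bar>" "\<bar>\<alpha> \<i> \<i>\<bar> < \<bar>\<beta> \<i> \<i>\<bar>"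
    using dom by (auto simp: dominated_def)
  \<comment> \<open>Domination keeps \<open>\<beta>\<close> nonzero at every corner, so three weak
    sign relations linking the four corners give them one common sign
    \<open>\<sigma>\<close>.\<close>
  obtain \<sigma> :: real where \<sigma>: "\<bar>\<sigma>\<bar> = 1" "\<bar>\<beta> 1 1\<bar> = \<sigma> * \<beta> 1 1" "\<bar>\<beta> 1 \<i>\<bar> = \<sigma> * \<beta> 1 \<i>" "\<bar>\<beta> \<i> 1\<bar> = \<sigma> * \<beta> \<i> 1" "\<bar>\<beta> \<i> \<i>\<bar> = \<sigma> * \<beta> \<i> \<i>"
  proof -
    have m: "\<beta> 1 1 * \<beta> \<i> 1 \<ge> 0" "\<beta> 1 \<i> * \<beta> \<i> \<i> \<ge> 0" "\<beta> 1 1 * \<beta> 1 \<i> \<ge> 0" using r1 r2 by auto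
    show thesis
    proof (cases "\<beta> 1 1 > 0")
      case True
      then have "\<beta> \<i> 1 \<ge> 0" "\<beta> 1 \<i> > 0" using m d by (auto simp: zero_le_mult_iff)
      then show thesis using True m by (intro that[of 1]) (auto simp: zero_le_mult_iff)
    next
      case False
      then have n: "\<beta> 1 1 < 0" using d by auto
      then have "\<beta> \<i> 1 \<le> 0" "\<beta> 1 \<i> < 0" using m d by (auto simp: zero_le_mult_iff)
      then show thesis using n m by (intro that[of "-1"]) (auto simp: zero_le_mult_iff)
    qed
  qed
  \<comment> \<open>For nonnegative spinors the triangle inequality bounds the
    \<open>\<alpha>\<close> side, while the four \<open>\<beta>\<close> terms share a sign and add
    up without cancellation.\<close>
  have lt: "\<bar>det2 (spinor_map a b z) (spinor_map a' b' w)\<bar> < \<bar>det2 (spinor_map e f z) (spinor_map e' f' w)\<bar>"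
    if zw: "Re z \<ge> 0" "Im z \<ge> 0" "z \<noteq> 0" "Re w \<ge> 0" "Im w \<ge> 0" "w \<noteq> 0" for z w
  proof -
    have p: "Re z + Im z > 0" "Re w + Im w > 0" using zw by (auto simp: complex_eq_iff)
    have "\<bar>det2 (spinor_map a b z) (spinor_map a' b' w)\<bar> \<le>
        \<bar>Re z * Re w * \<alpha> 1 1\<bar> + \<bar>Re z * Im w * \<alpha> 1 \<i>\<bar> + \<bar>Im z * Re w * \<alpha> \<i> 1\<bar> + \<bar>Im z * Im w * \<alpha> \<i> \<i>\<bar>"
      unfolding det2_bilinear[of a b z a' b' w] \<alpha>_def by linarith
    also have "\<dots> = Re z * Re w * \<bar>\<alpha> 1 1\<bar> + Re z * Im w * \<bar>\<alpha> 1 \<i>\<bar> + Im z * Re w * \<bar>\<alpha> \<i> 1\<bar> + Im z * Im w * \<bar>\<alpha> \<i> \<i>\<bar>"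
      using zw by (simp add: abs_mult)
    also have "\<dots> < Re z * Re w * \<bar>\<beta> 1 1\<bar> + Re z * Im w * \<bar>\<beta> 1 \<i>\<bar> + Im z * Re w * \<bar>\<beta> \<i> 1\<bar> + Im z * Im w * \<bar>\<beta> \<i> \<i>\<bar>"
      using weighted_less[OF zw(1,2) p(1) zw(4,5) p(2) d] .
    also have "\<dots> = \<sigma> * det2 (spinor_map e f z) (spinor_map e' f' w)"
      unfolding \<sigma> unfolding det2_bilinear[of e f z e' f' w] \<beta>_def by (simp add: algebra_simps)
    also have "\<dots> \<le> \<bar>\<sigma>\<bar> * \<bar>det2 (spinor_map e f z) (spinor_map e' f' w)\<bar>" by (metis abs_ge_self abs_mult)
    finally show ?thesis unfolding \<sigma>(1) by simp
  qed
  have lt2: "2 * (det2 (spinor_map a b z) (spinor_map a' b' w))\<^sup>2 < 2 * (det2 (spinor_map e f z) (spinor_map e' f' w))\<^sup>2"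
    if "Re z \<ge> 0" "Im z \<ge> 0" "z \<noteq> 0" "Re w \<ge> 0" "Im w \<ge> 0" "w \<noteq> 0" for z w
    using power2_strict_mono[OF lt[OF that]] by simp
  have pairing: "pairing (mob a b) (mob a' b') x y < pairing (mob e f) (mob e' f') x y"
    if xy: "cmod x \<le> 1" "Im x \<ge> 0" "cmod y \<le> 1" "Im y \<ge> 0" for x y
  proof -
    obtain c d z w where X: "c \<ge> 0" "d \<ge> 0" "Re z \<ge> 0" "Im z \<ge> 0" "z \<noteq> 0" "Re w \<ge> 0" "Im w \<ge> 0" "w \<noteq> 0" "c + d = 1"
      "1 + (cmod x)\<^sup>2 = c * (cmod z)\<^sup>2 + d * (cmod w)\<^sup>2" "2 * x = of_real c * z\<^sup>2 + of_real d * w\<^sup>2"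
      using tensor_upper_side[OF xy(1,2)] .
    obtain c' d' z' w' where Y: "c' \<ge> 0" "d' \<ge> 0" "Re z' \<ge> 0" "Im z' \<ge> 0" "z' \<noteq> 0" "Re w' \<ge> 0" "Im w' \<ge> 0" "w' \<noteq> 0" "c' + d' = 1"
      "1 + (cmod y)\<^sup>2 = c' * (cmod z')\<^sup>2 + d' * (cmod w')\<^sup>2" "2 * y = of_real c' * z'\<^sup>2 + of_real d' * w'\<^sup>2"
      using tensor_upper_side[OF xy(3,4)] .
    show ?thesis
      unfolding pairing_spinor_map[OF unimodular(1,2) xy(1,3) X(10,11) Y(10,11)] pairing_spinor_map[OF unimodular(3,4) xy(1,3) X(10,11) Y(10,11)]
      by (intro weighted_less lt2 X Y) (simp_all add: X(9) Y(9))
  qed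
  have sub: "cmod x \<le> 1" "Im x \<ge> 0" if "x \<in> upper_side \<union> closed_diam" for x using that by (auto simp: upper_side_def closed_diam_alt)
  show ?thesis
  proof (rule crooked_disjoint[OF g g'])
    show "mob a b ` (upper_side \<union> closed_diam) \<subseteq> cball 0 1" "mob a' b' ` (upper_side \<union> closed_diam) \<subseteq> cball 0 1"
      using G0_norm_le[OF maps_in_G0(1) sub(1)] G0_norm_le[OF maps_in_G0(2) sub(1)] by auto
    fix p p' assume "p \<in> mob a b ` (upper_side \<union> closed_diam)" "p' \<in> mob a' b' ` (upper_side \<union> closed_diam)"
    then obtain x y where xy: "p = mob a b x" "x \<in> upper_side \<union> closed_diam" "p' = mob a' b' y" "y \<in> upper_side \<union> closed_diam" by blast
    show "minkowski p p' < pairing g g' p p'"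
      using pairing_less_iff[OF sub(1)[OF xy(2)] sub(1)[OF xy(4)]] pairing[OF sub[OF xy(2)] sub[OF xy(4)]] xy(1,3) by blast
  qed
qed

text \<open>A point of the second image line on the positive side of the first yields two points
  with a common image, where \<open>pairing_meet\<close> reverses the inequality that domination
  provides at the images of 0. Then \<open>crossing\<close>, applied to a half-plane and a line,
  finds a common element.\<close>

lemma half_space_disjoint_imp_away:
  assumes dom: "dominated"
    and disj: "gmul g ` crooked (mob a b ` (upper_side \<union> closed_diam)) \<inter> gmul g' ` crooked (mob a' b' ` (upper_side \<union> closed_diam)) = {}"
  shows "mob e' f' ` closed_diam \<inter> mob e f ` upper_side = {}"
proof (rule ccontr)
  assume "\<not> ?thesis"
  then obtain y x where yx: "y \<in> closed_diam" "x \<in> upper_side" "mob e' f' y = mob e f x" by force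
  obtain j where j: "j \<in> G0" "\<And>z. cmod z \<le> 1 \<Longrightarrow> mob e f (j z) = z" "\<And>z. cmod z \<le> 1 \<Longrightarrow> j (mob e f z) = z"
    using G0_inverse_apply[OF maps_in_G0(3)] by blast
  have x1: "cmod x \<le> 1" "Im x > 0" using yx by (auto simp: upper_side_def)
  have i: "gmul j (mob e' f') \<in> G0" using gmul_G0 j maps_in_G0 by blast
  have y1: "cmod z \<le> 1" if "z \<in> closed_diam" for z using that by (auto simp: closed_diam_alt)
  have jy: "Im (gmul j (mob e' f') y) > 0" using yx(3) j(3)[OF x1(1)] x1 y1[OF yx(1)] by (simp add: gmul_apply)
  \<comment> \<open>\<open>y\<close> may be ideal, whereas \<open>crossing\<close> works in the open
    disk; by continuity an interior point also lies on the positive side.\<close>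
  have "\<exists>y0 \<in> open_diam. Im (gmul j (mob e' f') y0) > 0"
  proof (rule ccontr)
    assume "\<not> ?thesis"
    then have le: "\<And>y. y \<in> open_diam \<Longrightarrow> Im (gmul j (mob e' f') y) \<le> 0" by (force simp: not_less)
    have "continuous_on (closure open_diam) (\<lambda>z. Im (gmul j (mob e' f') z))"
      unfolding closure_open_diam using G0_continuous[OF i] closed_diam_sub by (intro continuous_intros) (rule continuous_on_subset)
    from continuous_le_on_closure[OF this, of y 0] le yx(1) have "Im (gmul j (mob e' f') y) \<le> 0"
      by (simp add: closure_open_diam)
    then show False using jy by simp
  qed
  then obtain y0 where y0: "y0 \<in> open_diam" "Im (gmul j (mob e' f') y0) > 0" by blast
  have ny0: "cmod y0 < 1" using y0 by (auto simp: open_diam_alt)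
  define x0 where "x0 = gmul j (mob e' f') y0"
  have nx0: "cmod x0 < 1" unfolding x0_def using G0_norm_less[OF i ny0] .
  have x0u: "x0 \<in> upper_side" using nx0 y0(2) by (simp add: upper_side_def x0_def)
  have "mob e f x0 = mob e' f' y0"
    unfolding x0_def using ny0 j(2)[OF G0_norm_le[OF maps_in_G0(4), of y0]] by (simp add: gmul_apply)
  then have eq: "g (mob a b x0) = g' (mob a' b' y0)" using nx0 ny0 by (simp add: gk gk' gmul_apply)
  have le: "pairing g g' (mob a b x0) (mob a' b' y0) \<le> minkowski (mob a b x0) (mob a' b' y0)"
    by (rule pairing_meet[OF g g' _ _ eq]) (use G0_norm_le maps_in_G0 nx0 ny0 less_imp_le in blast)+
  have z0: "0 \<in> closed_diam" "0 \<in> open_diam" by (auto simp: closed_diam_alt open_diam_alt)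
  have ge: "minkowski (mob a b 0) (mob a' b' 0) \<le> pairing g g' (mob a b 0) (mob a' b' 0)"
    using dominated_pairing_line[OF dom imageI[OF z0(1)] imageI[OF z0(1)]] by simp
  \<comment> \<open>The open diameter is included so that one connected set contains both
    \<open>x0\<close> and 0, where the opposite inequalities hold.\<close>
  define U where "U = {z. cmod z < 1 \<and> Im z \<ge> 0}"
  have U: "U = ball 0 1 \<inter> {z. inner \<i> z \<ge> 0}" by (auto simp: U_def)
  have "convex U" unfolding U by (intro convex_Int convex_ball convex_halfspace_ge)
  moreover have Uc: "U \<subseteq> cball 0 1" by (auto simp: U_def)
  ultimately have conn: "connected (mob a b ` U)"
    by (meson convex_connected connected_continuous_image continuous_on_subset G0_continuous maps_in_G0)
  have U1: "mob a b ` U \<subseteq> ball 0 1" using G0_norm_less[OF maps_in_G0(1)] by (auto simp: U_def)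
  have "U \<subseteq> upper_side \<union> closed_diam" by (auto simp: U_def upper_side_def closed_diam_alt)
  then have U2: "mob a b ` U \<subseteq> mob a b ` (upper_side \<union> closed_diam)" by blast
  have sub: "mob a b ` (upper_side \<union> closed_diam) \<subseteq> cball 0 1" "mob a' b' ` (upper_side \<union> closed_diam) \<subseteq> cball 0 1"
    using G0_norm_le[OF maps_in_G0(1)] G0_norm_le[OF maps_in_G0(2)] upper_side_sub closed_diam_sub by fastforce+
  have L: "mob a' b' ` open_diam \<subseteq> mob a' b' ` (upper_side \<union> closed_diam)" using line_sub(6) by blast
  have xU: "x0 \<in> U" "0 \<in> U" using nx0 x0u by (auto simp: U_def upper_side_def)
  have "gmul g ` crooked (mob a b ` (upper_side \<union> closed_diam)) \<inter> gmul g' ` crooked (mob a' b' ` (upper_side \<union> closed_diam)) \<noteq> {}"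
    by (rule crossing[OF g g' conn U1 line_connected(2) line_sub(4) imageI[OF xU(1)] imageI[OF y0(1)] le
       imageI[OF xU(2)] imageI[OF z0(2)] ge U2 sub(1) L sub(2)])
  then show False using disj by simp
qed

lemma line_pair_swap: "line_pair g' g a' b' a b e' f' e f"
  by (unfold_locales) (use g g' unimodular gk gk' in auto)

lemma dominated_swap: "line_pair.dominated a' b' a b e' f' e f \<longleftrightarrow> dominated"
proof -
  interpret s: line_pair g' g a' b' a b e' f' e f by (rule line_pair_swap)
  have "s.\<alpha> z w = - \<alpha> w z" "s.\<beta> z w = - \<beta> w z" for z w
    by (simp_all add: s.\<alpha>_def s.\<beta>_def \<alpha>_def \<beta>_def det2_antisym[symmetric])
  then show ?thesis unfolding s.dominated_def dominated_def by auto
qed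

lemma crooked_planes_disjoint_iff:
  "gmul g ` Cset (mob a b ` open_diam) \<inter> gmul g' ` Cset (mob a' b' ` open_diam) = {} \<longleftrightarrow> dominated"
  unfolding Cset_line[OF maps_in_G0(1)] Cset_line[OF maps_in_G0(2)] using dominated_disjoint not_dominated_meet by blast

lemma half_spaces_disjoint_iff:
  "gmul g ` crooked (mob a b ` (upper_side \<union> closed_diam)) \<inter> gmul g' ` crooked (mob a' b' ` (upper_side \<union> closed_diam)) = {}
    \<longleftrightarrow> dominated \<and> mob e' f' ` closed_diam \<inter> mob e f ` upper_side = {} \<and> mob e f ` closed_diam \<inter> mob e' f' ` upper_side = {}"
proof
  assume disj: "gmul g ` crooked (mob a b ` (upper_side \<union> closed_diam)) \<inter> gmul g' ` crooked (mob a' b' ` (upper_side \<union> closed_diam)) = {}"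
  have "crooked (mob a b ` closed_diam) \<subseteq> crooked (mob a b ` (upper_side \<union> closed_diam))" "crooked (mob a' b' ` closed_diam) \<subseteq> crooked (mob a' b' ` (upper_side \<union> closed_diam))"
    by (auto simp: crooked_def)
  then have dom: "dominated" using disj not_dominated_meet by blast
  interpret s: line_pair g' g a' b' a b e' f' e f by (rule line_pair_swap)
  have "s.dominated" using dom dominated_swap by blast
  then show "dominated \<and> mob e' f' ` closed_diam \<inter> mob e f ` upper_side = {} \<and> mob e f ` closed_diam \<inter> mob e' f' ` upper_side = {}"
    using dom half_space_disjoint_imp_away[OF dom disj] s.half_space_disjoint_imp_away disj by blast
qed (use half_space_disjoint in blast)

end

section \<open>From parametrised lines to the theorem\<close>

lemma line_pairI:
  assumes "g \<in> G0" "g' \<in> G0" "k \<in> G0" "k' \<in> G0"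
  obtains a b a' b' e f e' f' where "line_pair g g' a b a' b' e f e' f'" "k = mob a b" "k' = mob a' b'"
    "gmul g k = mob e f" "gmul g' k' = mob e' f'"
proof -
  obtain a b where ab: "unimodular a b" "k = mob a b" using assms by (auto simp: G0_mob)
  obtain a' b' where ab': "unimodular a' b'" "k' = mob a' b'" using assms by (auto simp: G0_mob)
  obtain e f where ef: "unimodular e f" "gmul g k = mob e f" using gmul_G0[OF assms(1,3)] by (auto simp: G0_mob)
  obtain e' f' where ef': "unimodular e' f'" "gmul g' k' = mob e' f'" using gmul_G0[OF assms(2,4)] by (auto simp: G0_mob)
  have "line_pair g g' a b a' b' e f e' f'" by unfold_locales (use assms ab ab' ef ef' in auto)
  then show thesis using that ab ab' ef ef' by blast
qed

text \<open>\<open>Hplus\<close> leaves out the identity, but every point is a nonrepelling fixed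
  point of it, so the crooked plane of the bounding line supplies it.\<close>

lemma Hplus_closed_side:
  assumes g: "g \<in> G0" and k: "k \<in> G0"
  shows "Hplus_closed (k ` open_diam) {z \<in> cball 0 1. g z \<in> gmul g k ` upper_side} = crooked (k ` (upper_side \<union> closed_diam))"
proof -
  have kn: "cmod (k z) \<le> 1" if "z \<in> upper_side" for z using G0_norm_le[OF k] that upper_side_sub by auto
  have "{z \<in> cball 0 1. g z \<in> gmul g k ` upper_side} = k ` upper_side"
  proof (intro equalityI subsetI)
    fix z assume "z \<in> {z \<in> cball 0 1. g z \<in> gmul g k ` upper_side}"
    then obtain u where u: "z \<in> cball 0 1" "u \<in> upper_side" "g z = g (k u)"
      using gmul_image[OF upper_side_sub, of g k] by auto
    have "z = k u" by (rule inj_onD[OF G0_inj[OF g] u(3,1)]) (use kn[OF u(2)] in simp)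
    then show "z \<in> k ` upper_side" using u by blast
  next
    fix z assume "z \<in> k ` upper_side"
    then show "z \<in> {z \<in> cball 0 1. g z \<in> gmul g k ` upper_side}"
      using kn gmul_image[OF upper_side_sub, of g k] by auto
  qed
  moreover have "crooked (k ` (upper_side \<union> closed_diam)) = Hplus (k ` open_diam) (k ` upper_side) \<union> crooked (k ` closed_diam)"
  proof (intro equalityI subsetI)
    fix c assume c: "c \<in> crooked (k ` (upper_side \<union> closed_diam))"
    show "c \<in> Hplus (k ` open_diam) (k ` upper_side) \<union> crooked (k ` closed_diam)"
    proof (cases "c = G0_id")
      case True
      have k0: "k 0 \<in> k ` closed_diam" "cmod (k 0) \<le> 1" using G0_norm_le[OF k] by (auto simp: closed_diam_alt)
      have "nonrepelling_fixed G0_id (k 0)"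
        using nonrepelling_fixed_iff[OF G0_id_in k0(2)] k0(2) by (simp add: G0_id_apply conf_factor_id)
      then show ?thesis using True k0 G0_id_in by (auto simp: crooked_def)
    qed (use c in \<open>auto simp: crooked_def Hplus_def\<close>)
  qed (auto simp: crooked_def Hplus_def)
  ultimately show ?thesis by (simp add: Hplus_closed_def Cset_line[OF k])
qed

theorem theorem3p1:
  fixes l l' :: "complex set" and g g' :: "complex \<Rightarrow> complex"
  assumes "geodesic_line l" and "geodesic_line l'" and "g \<in> G0" and "g' \<in> G0"
  defines "c1 \<equiv> (gmul g ` Cset l) \<inter> (gmul g' ` Cset l') = {}"
      and "c2 \<equiv> (\<exists>K > 0. \<forall>x \<in> l. \<forall>x' \<in> l'. hdist (g x) (g' x') - hdist x x' \<ge> K)"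
      and "c3 \<equiv> (\<forall>\<xi> \<in> endpoints l. \<forall>\<xi>' \<in> endpoints l'. g \<xi> \<noteq> g' \<xi>' \<and> F_ideal g g' \<xi> \<xi>' > 0)"
  shows "(c1 \<longleftrightarrow> c2) \<and> (c1 \<longleftrightarrow> c3)
    \<and> (c1 \<longrightarrow> closure (g ` l) \<inter> closure (g' ` l') = {})
    \<and> (\<forall>P P'. transverse_orientation (g ` l) P \<longrightarrow> transverse_orientation (g' ` l') P' \<longrightarrow>
        ((gmul g ` Hplus_closed l {z \<in> cball 0 1. g z \<in> P})
           \<inter> (gmul g' ` Hplus_closed l' {z \<in> cball 0 1. g' z \<in> P'}) = {}
         \<longleftrightarrow> c1 \<and> c2 \<and> c3 \<and> oriented_away (g ` l) P (g' ` l') P'))"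
proof -
  obtain k where k: "k \<in> G0" "l = k ` open_diam" using geodesic_line_param[OF assms(1)] .
  obtain k' where k': "k' \<in> G0" "l' = k' ` open_diam" using geodesic_line_param[OF assms(2)] .
  have s0: "open_diam \<subseteq> cball 0 1" by (auto simp: open_diam_alt)
  note gl = gmul_image[OF s0, of g] gmul_image[OF s0, of g']
  have equiv: "(c1 \<longleftrightarrow> c2) \<and> (c1 \<longleftrightarrow> c3) \<and> (c1 \<longrightarrow> closure (g ` l) \<inter> closure (g' ` l') = {})"
  proof -
    obtain a b a' b' e f e' f' where L: "line_pair g g' a b a' b' e f e' f'"
      and m: "k = mob a b" "k' = mob a' b'" "gmul g k = mob e f" "gmul g' k' = mob e' f'"
      using line_pairI[OF assms(3,4) k(1) k'(1)] .
    interpret line_pair g g' a b a' b' e f e' f' by (rule L)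
    have 1: "c1 \<longleftrightarrow> dominated" unfolding c1_def k(2) k'(2) m by (rule crooked_planes_disjoint_iff)
    have 2: "c2 \<longleftrightarrow> dominated" unfolding c2_def k(2) k'(2) m
      using dominated_imp_expanding expanding_imp_dominated by blast
    have 3: "c3 \<longleftrightarrow> dominated" unfolding c3_def k(2) k'(2) m by (rule dominated_iff_F_ideal[symmetric])
    have "closure (g ` l) = mob e f ` closed_diam" "closure (g' ` l') = mob e' f' ` closed_diam"
      unfolding k(2) k'(2) gl[symmetric] m(3,4) by (rule closure_line[OF maps_in_G0(3)], rule closure_line[OF maps_in_G0(4)])
    then show ?thesis using 1 2 3 dominated_closures_disjoint by simp
  qed
  have "gmul g ` Hplus_closed l {z \<in> cball 0 1. g z \<in> P} \<inter> gmul g' ` Hplus_closed l' {z \<in> cball 0 1. g' z \<in> P'} = {}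
      \<longleftrightarrow> c1 \<and> oriented_away (g ` l) P (g' ` l') P'"
    if P: "transverse_orientation (g ` l) P" and P': "transverse_orientation (g' ` l') P'" for P P'
  proof -
    have "transverse_orientation (gmul g k ` open_diam) P" "transverse_orientation (gmul g' k' ` open_diam) P'"
      using P P' unfolding k(2) k'(2) gl by simp_all
    then obtain r r' where r: "r = G0_id \<or> r = half_turn" "P = gmul (gmul g k) r ` upper_side"
      and r': "r' = G0_id \<or> r' = half_turn" "P' = gmul (gmul g' k') r' ` upper_side"
      using transverse_orientation_param[OF gmul_G0[OF assms(3) k(1)]] transverse_orientation_param[OF gmul_G0[OF assms(4) k'(1)]] by metis
    have rG: "r \<in> G0" "r' \<in> G0" using r r' G0_id_in half_turn_G0 by auto
    have idi: "G0_id ` open_diam = open_diam" using s0 by (force simp: G0_id_apply image_def)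
    have rs: "r ` open_diam = open_diam" "r' ` open_diam = open_diam" using r r' idi half_turn_image by auto
    \<comment> \<open>A half-turn inserted where the orientation asks for it leaves each line
      unchanged and makes its positive side an image of \<open>upper_side\<close>.\<close>
    define n n' where "n = gmul k r" and "n' = gmul k' r'"
    have n: "n \<in> G0" "n' \<in> G0" unfolding n_def n'_def using gmul_G0 k k' rG by blast+
    have ln: "l = n ` open_diam" "l' = n' ` open_diam" unfolding k(2) k'(2) n_def n'_def gmul_image[OF s0] rs by simp_all
    have Pn: "P = gmul g n ` upper_side" "P' = gmul g' n' ` upper_side"
      unfolding r(2) r'(2) n_def n'_def by (simp_all add: gmul_assoc rG)
    obtain a b a' b' e f e' f' where L: "line_pair g g' a b a' b' e f e' f'"
      and m: "n = mob a b" "n' = mob a' b'" "gmul g n = mob e f" "gmul g' n' = mob e' f'"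
      using line_pairI[OF assms(3,4) n] .
    interpret line_pair g g' a b a' b' e f e' f' by (rule L)
    have 1: "c1 \<longleftrightarrow> dominated" unfolding c1_def ln m by (rule crooked_planes_disjoint_iff)
    have cl: "closure (g ` l) = mob e f ` closed_diam" "closure (g' ` l') = mob e' f' ` closed_diam"
      unfolding ln gl[symmetric] m(3,4) by (rule closure_line[OF maps_in_G0(3)], rule closure_line[OF maps_in_G0(4)])
    have 2: "oriented_away (g ` l) P (g' ` l') P' \<longleftrightarrow> mob e' f' ` closed_diam \<inter> mob e f ` upper_side = {} \<and> mob e f ` closed_diam \<inter> mob e' f' ` upper_side = {}"
      unfolding oriented_away_def cl Pn m(3,4) ..
    have H: "Hplus_closed l {z \<in> cball 0 1. g z \<in> P} = crooked (mob a b ` (upper_side \<union> closed_diam))"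
      "Hplus_closed l' {z \<in> cball 0 1. g' z \<in> P'} = crooked (mob a' b' ` (upper_side \<union> closed_diam))"
      using Hplus_closed_side[OF assms(3) n(1)] Hplus_closed_side[OF assms(4) n(2)]
      unfolding Pn[symmetric] ln[symmetric] unfolding m(1,2) by blast+
    show ?thesis unfolding H 1 2 by (rule half_spaces_disjoint_iff)
  qed
  then show ?thesis using equiv by blast
qed

end
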